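(* Fix integers $m\geq n\geq 1$. The following four conditions are equivalent: (a) for every $v_1,\dots,v_m\in\mathbb{R}^n$, the volume polynomial $f(x)=\left|\sum_{i=1}^m x_i[0,v_i]\right|$ is Rayleigh; (b) $|A|\,|A+B+C|\leq|A+B|\,|A+C|$ for all zonotopes $A,B,C\subset\mathbb{R}^n$ generated by a common set of $m$ vectors; (c) $\displaystyle\frac{|A|}{|P_{u^\perp}A|_{n-1}}\leq\frac{|A+B|}{|P_{u^\perp}(A+B)|_{n-1}}$ for all zonotopes $A,B\subset\mathbb{R}^n$ generated by a common set of $m-1$ vectors with $A$ full-dimensional, and every $u\in\mathbb{S}^{n-1}$; (d) $|A|\,|P_{\{u,v\}^\perp}A|_{n-2}\leq|P_{u^\perp}A|_{n-1}\,|P_{v^\perp}A|_{n-1}$ for every full-dimensional zonotope $A\subset\mathbb{R}^n$ generated by $m-2$ vectors and every pair of orthonormal vectors $u,v\in\mathbb{S}^{n-1}$.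
   Context: For vectors $v_1,\dots,v_k\in\mathbb{R}^n$, a zonotope generated by $v_1,\dots,v_k$ is a translate of $\sum_{i=1}^k x_i[0,v_i]$ (Minkowski sum of segments) with coefficients $x_i\geq 0$ (zero coefficients allowed; for $k=0$ it is a point). $|K|$ is $n$-dimensional Lebesgue measure; $|K|_d$ is $d$-dimensional Hausdorff measure for a set in a $d$-dimensional subspace (a point has $|\cdot|_0=1$). $P_E$ is orthogonal projection onto the linear subspace $E$; $u^\perp$, $\{u,v\}^\perp$ are orthogonal complements. If $n=1$, condition (d) is vacuous. For $v_1,\dots,v_m\in\mathbb{R}^n$ and $x\in\mathbb{R}_+^m=[0,\infty)^m$, $$f(x)=\Big|\sum_{i=1}^m x_i[0,v_i]\Big|=\sum_{I\subset[m],\,|I|=n}|\det(v_i)_{i\in I}|\prod_{i\in I}x_i .$$ A homogeneous multiaffine polynomial $f$ in $m$ variables with nonnegative coefficients is called Rayleigh if $\partial_i f(x)\,\partial_j f(x)\geq f(x)\,\partial_{ij}f(x)$ for all $x\in\mathbb{R}_+^m$ and all $i\neq j$, where $\partial_{ij}=\partial_i\partial_j$. *)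

theory Defs
  imports "HOL-Analysis.Analysis"
begin

subsection \<open>Zonotopes\<close>

text \<open>Sums of sets are Minkowski sums. Vectors and coefficients are families indexed by
  \<open>{..<k}\<close>; repeated, zero and linearly dependent vectors are allowed, and for \<open>k = 0\<close>
  the sum is \<open>{0}\<close>.\<close>

definition segment_sum :: "nat \<Rightarrow> (nat \<Rightarrow> 'a::real_vector) \<Rightarrow> (nat \<Rightarrow> real) \<Rightarrow> 'a set" where
  "segment_sum k v x = (\<Sum>i<k. (\<lambda>y. x i *\<^sub>R y) ` closed_segment 0 (v i))"

definition zonotope_generated_by :: "nat \<Rightarrow> (nat \<Rightarrow> 'a::real_vector) \<Rightarrow> 'a set \<Rightarrow> bool" where
  "zonotope_generated_by k v A \<longleftrightarrow>
     (\<exists>a x. (\<forall>i<k. 0 \<le> x i) \<and> A = (+) a ` segment_sum k v x)"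


subsection \<open>Orthogonal projection\<close>

definition orth_proj :: "'a::euclidean_space set \<Rightarrow> 'a \<Rightarrow> 'a" where
  "orth_proj E x = (THE y. y \<in> E \<and> x - y \<in> E\<^sup>\<bottom>)"


subsection \<open>Hausdorff measure\<close>

text \<open>The covering sets are required to be bounded because \<^const>\<open>diameter\<close> is
  unspecified on unbounded sets. The case distinction on \<open>U i = {}\<close> only matters for
  \<open>d = 0\<close>, where the empty set must contribute 0 and not \<open>0 ^ 0 = 1\<close>.\<close>

definition hausdorff_content :: "nat \<Rightarrow> real \<Rightarrow> 'a::metric_space set \<Rightarrow> ennreal" where
  "hausdorff_content d \<delta> S =
     (INF U \<in> {U :: nat \<Rightarrow> 'a set. S \<subseteq> (\<Union>i. U i) \<and> (\<forall>i. bounded (U i) \<and> diameter (U i) \<le> \<delta>)}.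
        \<Sum>i. if U i = {} then 0 else ennreal (diameter (U i) ^ d))"

definition hausdorff_raw :: "nat \<Rightarrow> 'a::metric_space set \<Rightarrow> ennreal" where
  "hausdorff_raw d S = (SUP \<delta>\<in>{0<..}. hausdorff_content d \<delta> S)"

text \<open>A unit cube spanned by \<open>d\<close> of the standard basis vectors (meaningful for
  \<open>d \<le> DIM('a)\<close>); the choice is immaterial as all of these cubes are isometric.\<close>

definition unit_cube :: "nat \<Rightarrow> 'a::euclidean_space set" where
  "unit_cube d = cbox 0 (\<Sum>(SOME B. B \<subseteq> Basis \<and> card B = d))"

text \<open>The \<open>d\<close>-dimensional Hausdorff measure with the normalization under which it is
  \<open>d\<close>-dimensional Lebesgue measure on \<open>d\<close>-dimensional subspaces, i.e. unit
  \<open>d\<close>-cubes have measure 1.\<close>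

definition hausdorff_volume :: "nat \<Rightarrow> 'a::euclidean_space set \<Rightarrow> real" where
  "hausdorff_volume d S = enn2real (hausdorff_raw d S / hausdorff_raw d (unit_cube d :: 'a set))"

lemma hausdorff_content_0_singleton:
  assumes "0 < \<delta>"
  shows "hausdorff_content 0 \<delta> {a} = 1"
proof (rule antisym)
  let ?U = "\<lambda>i::nat. if i = 0 then {a} else {}"
  have "hausdorff_content 0 \<delta> {a}
      \<le> (\<Sum>i. if ?U i = {} then 0 else ennreal (diameter (?U i) ^ 0))"
    unfolding hausdorff_content_def using assms by (intro INF_lower) auto
  also have "\<dots> = (\<Sum>i\<in>{0}. if ?U i = {} then 0 else ennreal (diameter (?U i) ^ 0))"
    by (rule suminf_finite) auto
  finally show "hausdorff_content 0 \<delta> {a} \<le> 1" by simp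
next
  show "1 \<le> hausdorff_content 0 \<delta> {a}"
    unfolding hausdorff_content_def
  proof (intro INF_greatest)
    fix U :: "nat \<Rightarrow> 'a set"
    assume "U \<in> {U. {a} \<subseteq> (\<Union>i. U i) \<and> (\<forall>i. bounded (U i) \<and> diameter (U i) \<le> \<delta>)}"
    then obtain j where "a \<in> U j" by auto
    then have "1 = (\<Sum>i\<in>{j}. if U i = {} then 0 else ennreal (diameter (U i) ^ 0))" by auto
    also have "\<dots> \<le> (\<Sum>i. if U i = {} then 0 else ennreal (diameter (U i) ^ 0))"
      by (intro sum_le_suminf) auto
    finally show "1 \<le> (\<Sum>i. if U i = {} then 0 else ennreal (diameter (U i) ^ 0))" .
  qed
qed

lemma hausdorff_volume_0_singleton: "hausdorff_volume 0 {a :: 'a::euclidean_space} = 1"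
proof -
  have raw: "hausdorff_raw 0 {b :: 'a} = 1" for b
    unfolding hausdorff_raw_def
    by (subst SUP_cong[OF refl hausdorff_content_0_singleton]) auto
  have "(SOME B :: 'a set. B \<subseteq> Basis \<and> card B = 0) = {}"
  proof (rule some_equality)
    fix B :: "'a set" assume "B \<subseteq> Basis \<and> card B = 0"
    then show "B = {}" using finite_subset[OF _ finite_Basis] by (metis card_0_eq)
  qed auto
  then have "(unit_cube 0 :: 'a set) = {0}" by (simp add: unit_cube_def)
  then show ?thesis by (simp add: hausdorff_volume_def raw divide_ennreal_def)
qed


subsection \<open>Rayleigh polynomials\<close>

text \<open>A polynomial in \<open>m\<close> variables is represented by its polynomial function on families
  \<open>nat \<Rightarrow> real\<close>, of which only the components with index in \<open>{..<m}\<close> are used. The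
  homogeneous multiaffine polynomials of degree \<open>d\<close> are those whose monomials are products over
  \<open>d\<close>-element index sets.\<close>

definition homogeneous_multiaffine ::
    "nat \<Rightarrow> nat \<Rightarrow> (nat set \<Rightarrow> real) \<Rightarrow> (nat \<Rightarrow> real) \<Rightarrow> real" where
  "homogeneous_multiaffine m d c x = (\<Sum>I | I \<subseteq> {..<m} \<and> card I = d. c I * (\<Prod>i\<in>I. x i))"

definition partial_deriv ::
    "nat \<Rightarrow> ((nat \<Rightarrow> real) \<Rightarrow> real) \<Rightarrow> (nat \<Rightarrow> real) \<Rightarrow> real" where
  "partial_deriv i f x = deriv (\<lambda>t. f (x(i := t))) (x i)"

definition rayleigh :: "nat \<Rightarrow> ((nat \<Rightarrow> real) \<Rightarrow> real) \<Rightarrow> bool" where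
  "rayleigh m f \<longleftrightarrow>
     (\<exists>d c. (\<forall>I. 0 \<le> c I) \<and> f = homogeneous_multiaffine m d c) \<and>
     (\<forall>x i j. (\<forall>k<m. 0 \<le> x k) \<and> i < m \<and> j < m \<and> i \<noteq> j \<longrightarrow>
        partial_deriv i f x * partial_deriv j f x \<ge> f x * partial_deriv i (partial_deriv j f) x)"

text \<open>The volume is a polynomial in the coefficients only on the nonnegative orthant (elsewhere
  the volume of the segment sum involves absolute values). A polynomial is determined by its
  values there, so at most one homogeneous multiaffine \<open>f\<close> satisfies the following.\<close>

definition represents_volume ::
    "nat \<Rightarrow> (nat \<Rightarrow> 'a::euclidean_space) \<Rightarrow> ((nat \<Rightarrow> real) \<Rightarrow> real) \<Rightarrow> bool" where
  "represents_volume m v f \<longleftrightarrow>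
     (\<forall>x. (\<forall>i<m. 0 \<le> x i) \<longrightarrow> f x = measure lebesgue (segment_sum m v x))"


subsection \<open>The four conditions\<close>

text \<open>The dimension is \<open>n = CARD('n)\<close>. For \<open>CARD('n) = 1\<close> there are no orthogonal
  unit vectors \<open>u\<close>, \<open>w\<close>, so the truncated subtractions in the last condition are harmless.\<close>

definition volume_polynomials_rayleigh :: "'n::finite itself \<Rightarrow> nat \<Rightarrow> bool" where
  "volume_polynomials_rayleigh _ m \<longleftrightarrow>
     (\<forall>v :: nat \<Rightarrow> real ^ 'n. \<exists>f. represents_volume m v f \<and> rayleigh m f)"

definition zonotope_volume_inequality :: "'n::finite itself \<Rightarrow> nat \<Rightarrow> bool" where
  "zonotope_volume_inequality _ m \<longleftrightarrow>
     (\<forall>(v :: nat \<Rightarrow> real ^ 'n) A B C.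
        zonotope_generated_by m v A \<and> zonotope_generated_by m v B \<and> zonotope_generated_by m v C \<longrightarrow>
        measure lebesgue A * measure lebesgue (A + B + C)
          \<le> measure lebesgue (A + B) * measure lebesgue (A + C))"

definition projection_ratio_monotone :: "'n::finite itself \<Rightarrow> nat \<Rightarrow> bool" where
  "projection_ratio_monotone _ k \<longleftrightarrow>
     (\<forall>(v :: nat \<Rightarrow> real ^ 'n) A B u.
        zonotope_generated_by k v A \<and> zonotope_generated_by k v B \<and>
        aff_dim A = int CARD('n) \<and> u \<in> sphere 0 1 \<longrightarrow>
        measure lebesgue A / hausdorff_volume (CARD('n) - 1) (orth_proj ({u}\<^sup>\<bottom>) ` A)
          \<le> measure lebesgue (A + B)
             / hausdorff_volume (CARD('n) - 1) (orth_proj ({u}\<^sup>\<bottom>) ` (A + B)))"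

definition projection_product_inequality :: "'n::finite itself \<Rightarrow> nat \<Rightarrow> bool" where
  "projection_product_inequality _ k \<longleftrightarrow>
     (\<forall>(v :: nat \<Rightarrow> real ^ 'n) A u w.
        zonotope_generated_by k v A \<and> aff_dim A = int CARD('n) \<and>
        u \<in> sphere 0 1 \<and> w \<in> sphere 0 1 \<and> orthogonal u w \<longrightarrow>
        measure lebesgue A * hausdorff_volume (CARD('n) - 2) (orth_proj ({u, w}\<^sup>\<bottom>) ` A)
          \<le> hausdorff_volume (CARD('n) - 1) (orth_proj ({u}\<^sup>\<bottom>) ` A)
            * hausdorff_volume (CARD('n) - 1) (orth_proj ({w}\<^sup>\<bottom>) ` A))"

end

theory Submission
  imports Defs
begin

text \<open>For a convex body \<open>A\<close> the volume \<open>|A + t[0,v]|\<close> is affine in \<open>t \<ge> 0\<close>. Its slope is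
  \<open>|P A|\<^sub>n\<^sub>-\<^sub>1\<close>, with \<open>P\<close> the projection along \<open>v\<close>, if \<open>v\<close> is a unit vector. So all four conditions
  reduce to the inequality \<open>|A| |A+[0,p]+[0,q]| \<le> |A+[0,p]| |A+[0,q]|\<close> for zonotopes \<open>A\<close> generated by
  \<open>m - 2\<close> further vectors. It is the Rayleigh inequality, which does not depend on \<open>x\<^sub>i\<close> and \<open>x\<^sub>j\<close>;
  chaining it along the coordinates gives (b); with \<open>q\<close> a generator of \<open>B\<close> and \<open>p\<close> parallel to \<open>u\<close> it
  is the infinitesimal form of (c); and a linear shear makes \<open>p\<close> and \<open>q\<close> orthogonal, which gives (d).\<close>

subsection \<open>Adding a segment to a convex body\<close>

text \<open>Volume gains are controlled line by line. On every line parallel to \<open>v\<close>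
  that meets \<open>A\<close>, the part of \<open>A + [0, t v]\<close> outside \<open>A\<close> is a
  half-open interval of length \<open>t\<close>, so the gain depends only on which lines meet
  \<open>A\<close>. Comparing \<open>A\<close> with \<open>A + [0, s v]\<close> gives affinity;
  comparing it with its projection, which has volume zero, turns the gain into the volume of
  \<open>P A + [0, v]\<close>. That volume must still be identified with a Hausdorff measure defined
  by coverings and normalized on a coordinate cube. It suffices to compare Hausdorff measure with
  cylinder volume on compact sets up to a constant, which cancels once it is known to be positive
  and finite. The volume polynomial is obtained from affinity and scaling alone. The determinants
  never appear: only the sign of the coefficients matters, and each coefficient is itself a volume.
  Conditions (c) and (d) speak of unit vectors and full-dimensional bodies only. The return to
  arbitrary \<open>p\<close> and \<open>q\<close> is possible because the truth of the inequality
  for one length of each vector gives it for all lengths, and because it is trivial when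
  \<open>A\<close> has volume zero.\<close>

lemma mem_plus_segment:
  fixes v :: "'a::real_vector"
  assumes "0 \<le> t"
  shows "x \<in> A + closed_segment 0 (t *\<^sub>R v) \<longleftrightarrow> (\<exists>s. 0 \<le> s \<and> s \<le> t \<and> x - s *\<^sub>R v \<in> A)"
proof
  assume "x \<in> A + closed_segment 0 (t *\<^sub>R v)"
  then obtain a r where "x = a + r *\<^sub>R t *\<^sub>R v" "a \<in> A" "0 \<le> r" "r \<le> 1"
    by (auto simp: set_plus_def in_segment)
  then show "\<exists>s. 0 \<le> s \<and> s \<le> t \<and> x - s *\<^sub>R v \<in> A"
    using assms by (intro exI[of _ "r * t"]) (auto simp: mult_left_le_one_le)
next
  assume "\<exists>s. 0 \<le> s \<and> s \<le> t \<and> x - s *\<^sub>R v \<in> A"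
  then obtain s where s: "0 \<le> s" "s \<le> t" "x - s *\<^sub>R v \<in> A" by blast
  have "s *\<^sub>R v \<in> closed_segment 0 (t *\<^sub>R v)"
    using s assms by (cases "t = 0") (auto simp: in_segment intro!: exI[of _ "s / t"])
  with s(3) show "x \<in> A + closed_segment 0 (t *\<^sub>R v)"
    by (metis diff_add_cancel set_plus_intro)
qed

lemma compact_set_plus:
  fixes A B :: "'a::real_normed_vector set"
  assumes "compact A" "compact B"
  shows "compact (A + B)"
proof -
  have "A + B = {x + y |x y. x \<in> A \<and> y \<in> B}" by (auto simp: set_plus_def)
  then show ?thesis using compact_sums[OF assms] by simp
qed

lemma segment_plus_segment:
  fixes v :: "'a::real_vector"
  assumes "0 \<le> s" "0 \<le> t"
  shows "closed_segment 0 (s *\<^sub>R v) + closed_segment 0 (t *\<^sub>R v) = closed_segment 0 ((s + t) *\<^sub>R v)"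
    (is "?L = ?R")
proof -
  have seg: "x \<in> closed_segment 0 (r *\<^sub>R v) \<longleftrightarrow> (\<exists>q. 0 \<le> q \<and> q \<le> r \<and> x = q *\<^sub>R v)" if "0 \<le> r" for r x
    using mem_plus_segment[OF that, of x "{0}" v] by simp
  show ?thesis
  proof (intro equalityI subsetI)
    fix x assume "x \<in> ?L"
    then obtain p q where "0 \<le> p" "p \<le> s" "0 \<le> q" "q \<le> t" "x = p *\<^sub>R v + q *\<^sub>R v"
      unfolding set_plus_def Bex_def mem_Collect_eq seg[OF assms(1)] seg[OF assms(2)] by (elim exE conjE) simp
    then have "0 \<le> p + q \<and> p + q \<le> s + t \<and> x = (p + q) *\<^sub>R v" by (simp add: scaleR_left_distrib)
    then show "x \<in> ?R" unfolding seg[OF add_nonneg_nonneg[OF assms]] by (rule exI)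
  next
    fix x assume "x \<in> ?R"
    then obtain q where q: "0 \<le> q" "q \<le> s + t" "x = q *\<^sub>R v"
      unfolding seg[OF add_nonneg_nonneg[OF assms]] by (elim exE conjE)
    \<comment> \<open>The first segment is filled as far as it goes; the remainder then fits into
      the second one.\<close>
    have "x = min q s *\<^sub>R v + (q - min q s) *\<^sub>R v" unfolding q(3) scaleR_left_distrib[symmetric] by simp
    moreover have "min q s *\<^sub>R v \<in> closed_segment 0 (s *\<^sub>R v)"
      unfolding seg[OF assms(1)] using q assms by (intro exI[of _ "min q s"]) simp
    moreover have "(q - min q s) *\<^sub>R v \<in> closed_segment 0 (t *\<^sub>R v)"
      unfolding seg[OF assms(2)] using q assms by (intro exI[of _ "q - min q s"]) auto
    ultimately show "x \<in> ?L" by (metis set_plus_intro)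
  qed
qed

text \<open>The parameters of the points of \<open>A\<close> on the line form a compact convex set
  of reals; \<open>v \<noteq> 0\<close> is what bounds it.\<close>

lemma convex_compact_line_section:
  fixes A :: "'a::real_normed_vector set"
  assumes "compact A" "convex A" "v \<noteq> 0" "x + s0 *\<^sub>R v \<in> A"
  obtains \<alpha> \<beta> where "\<alpha> \<le> \<beta>" "\<And>s. x + s *\<^sub>R v \<in> A \<longleftrightarrow> \<alpha> \<le> s \<and> s \<le> \<beta>"
proof -
  define J where "J = {s. x + s *\<^sub>R v \<in> A}"
  have eq: "J = (\<lambda>s. x + s *\<^sub>R v) -` A" by (auto simp: J_def)
  have "closed J"
    unfolding eq by (intro closed_vimage compact_imp_closed assms continuous_intros)
  moreover have "bounded J"
  proof -
    obtain M where M: "\<And>y. y \<in> A \<Longrightarrow> norm y \<le> M"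
      using compact_imp_bounded[OF assms(1)] bounded_iff by metis
    have "norm s \<le> (M + norm x) / norm v" if "s \<in> J" for s
    proof -
      have "\<bar>s\<bar> * norm v = norm ((x + s *\<^sub>R v) - x)" by simp
      also have "\<dots> \<le> norm (x + s *\<^sub>R v) + norm x" by (rule norm_triangle_ineq4)
      also have "\<dots> \<le> M + norm x" using M that by (auto simp: J_def)
      finally show ?thesis using assms(3) by (simp add: field_simps)
    qed
    then show ?thesis unfolding bounded_iff by blast
  qed
  ultimately have "compact J" by (simp add: compact_eq_bounded_closed)
  moreover have "connected J"
  proof (intro convex_connected convexI)
    fix a b p q :: real assume *: "a \<in> J" "b \<in> J" "0 \<le> p" "0 \<le> q" "p + q = 1"
    have "p *\<^sub>R (x + a *\<^sub>R v) + q *\<^sub>R (x + b *\<^sub>R v) \<in> A"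
      using * assms(2) by (intro convexD) (auto simp: J_def)
    also have "p *\<^sub>R (x + a *\<^sub>R v) + q *\<^sub>R (x + b *\<^sub>R v) = (p + q) *\<^sub>R x + (p * a + q * b) *\<^sub>R v"
      by (simp only: scaleR_add_right scaleR_add_left scaleR_scaleR) (simp add: algebra_simps)
    finally show "p *\<^sub>R a + q *\<^sub>R b \<in> J" using * by (simp add: J_def)
  qed
  ultimately obtain \<alpha> \<beta> where J: "J = {\<alpha>..\<beta>}"
    using connected_compact_interval_1[of J] by auto
  have "s0 \<in> J" using assms by (simp add: J_def)
  then have "\<alpha> \<le> \<beta>" using J by simp
  moreover have "x + s *\<^sub>R v \<in> A \<longleftrightarrow> \<alpha> \<le> s \<and> s \<le> \<beta>" for s
    using J unfolding J_def by (simp add: set_eq_iff)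
  ultimately show thesis by (rule that)
qed

text \<open>If the line meets \<open>A\<close> in the parameter interval from \<alpha> to \<beta>,
  it meets \<open>A + [0, t v]\<close> in the one from \<alpha> to \<beta> + t. The collar is the
  half-open difference of length \<open>t\<close>, which contains exactly one integer multiple of
  \<open>t\<close>.\<close>

lemma segment_collar_unique_translate:
  fixes A :: "'a::real_normed_vector set"
  assumes "compact A" "convex A" "v \<noteq> 0" "0 < t" "x + s0 *\<^sub>R v \<in> A"
  shows "\<exists>!k::int. x + (of_int k * t) *\<^sub>R v \<in> (A + closed_segment 0 (t *\<^sub>R v)) - A"
proof -
  obtain \<alpha> \<beta> where "\<alpha> \<le> \<beta>" and sec: "\<And>s. x + s *\<^sub>R v \<in> A \<longleftrightarrow> \<alpha> \<le> s \<and> s \<le> \<beta>"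
    using convex_compact_line_section[OF assms(1,2,3,5)] by blast
  have D: "x + s *\<^sub>R v \<in> (A + closed_segment 0 (t *\<^sub>R v)) - A \<longleftrightarrow> \<beta> < s \<and> s \<le> \<beta> + t" for s
  proof -
    have "x + s *\<^sub>R v \<in> A + closed_segment 0 (t *\<^sub>R v) \<longleftrightarrow> (\<exists>r. 0 \<le> r \<and> r \<le> t \<and> x + (s - r) *\<^sub>R v \<in> A)"
      using assms(4) by (subst mem_plus_segment) (auto simp: algebra_simps)
    also have "\<dots> \<longleftrightarrow> \<alpha> \<le> s \<and> s \<le> \<beta> + t"
      unfolding sec
    proof safe
      assume "\<alpha> \<le> s" "s \<le> \<beta> + t"
      \<comment> \<open>The witness goes back by the least amount that brings \<open>s\<close> below
        \<beta>, so it cannot fall below \<alpha>.\<close>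
      then show "\<exists>r. 0 \<le> r \<and> r \<le> t \<and> \<alpha> \<le> s - r \<and> s - r \<le> \<beta>"
        using \<open>\<alpha> \<le> \<beta>\<close> assms(4) by (intro exI[of _ "max 0 (s - \<beta>)"]) auto
    qed auto
    finally show ?thesis using sec[of s] \<open>\<alpha> \<le> \<beta>\<close> by auto
  qed
  show ?thesis
    unfolding D
  proof (rule ex1I)
    \<comment> \<open>The floor gives the last multiple of \<open>t\<close> that is at most \<beta>,
      so its successor is the first one beyond \<beta>.\<close>
    show "\<beta> < of_int (\<lfloor>\<beta> / t\<rfloor> + 1) * t \<and> of_int (\<lfloor>\<beta> / t\<rfloor> + 1) * t \<le> \<beta> + t"
    proof -
      have "\<beta> / t < of_int (\<lfloor>\<beta> / t\<rfloor> + 1)" by linarith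
      then have 1: "\<beta> < of_int (\<lfloor>\<beta> / t\<rfloor> + 1) * t"
        by (simp only: pos_divide_less_eq[OF assms(4)])
      have "of_int \<lfloor>\<beta> / t\<rfloor> \<le> \<beta> / t" by linarith
      then have 2: "of_int \<lfloor>\<beta> / t\<rfloor> * t \<le> \<beta>"
        by (simp only: pos_le_divide_eq[OF assms(4)])
      have 3: "of_int (\<lfloor>\<beta> / t\<rfloor> + 1) * t = of_int \<lfloor>\<beta> / t\<rfloor> * t + t"
        by (simp add: distrib_right)
      show ?thesis using 1 2 unfolding 3 by linarith
    qed
    fix k :: int assume k: "\<beta> < of_int k * t \<and> of_int k * t \<le> \<beta> + t"
    then have "of_int (k - 1) \<le> \<beta> / t" "\<beta> / t < of_int (k - 1) + 1"
      using assms(4) by (simp_all add: field_simps)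
    then have "\<lfloor>\<beta> / t\<rfloor> = k - 1" by (simp add: floor_unique)
    then show "k = \<lfloor>\<beta> / t\<rfloor> + 1" by simp
  qed
qed

text \<open>Both collars are fundamental domains for the translations by integer multiples of
  \<open>t *\<^sub>R v\<close> on the same union of lines, hence are countably equidecomposable.\<close>

lemma emeasure_segment_collar_le:
  fixes A A' :: "'a::euclidean_space set"
  assumes A: "compact A" "convex A" and A': "compact A'" "convex A'"
    and shadow: "\<And>x. x \<in> A \<Longrightarrow> \<exists>s. x + s *\<^sub>R v \<in> A'"
    and "v \<noteq> 0" "0 < t"
  defines "D \<equiv> (A + closed_segment 0 (t *\<^sub>R v)) - A"
    and "D' \<equiv> (A' + closed_segment 0 (t *\<^sub>R v)) - A'"
  shows "emeasure lebesgue D \<le> emeasure lebesgue D'"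
proof -
  define \<tau> where "\<tau> k = (+) ((of_int k * t) *\<^sub>R v)" for k :: int
  have sets: "D \<in> sets lebesgue" "D' \<in> sets lebesgue"
    unfolding D_def D'_def
    by (intro sets.Diff fmeasurableD lmeasurable_compact compact_set_plus compact_segment A A')+
  have tr: "\<tau> k ` S \<in> sets lebesgue" if "S \<in> sets lebesgue" for k S
    unfolding \<tau>_def using that lebesgue_sets_translation by blast
  have em: "emeasure lebesgue (\<tau> k ` S) = emeasure lebesgue S" for k S
    using emeasure_lebesgue_affine[of 1 "(of_int k * t) *\<^sub>R v" S]
    by (simp add: \<tau>_def add.commute cong: image_cong_simp)
  have ex1: "\<exists>!k. \<tau> k x \<in> D'" if "x \<in> D" for x
  proof -
    have "x \<in> A + closed_segment 0 (t *\<^sub>R v)" using that by (simp add: D_def)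
    then obtain r where "x - r *\<^sub>R v \<in> A"
      using mem_plus_segment[OF less_imp_le[OF \<open>0 < t\<close>]] by blast
    then obtain s where "x - r *\<^sub>R v + s *\<^sub>R v \<in> A'" using shadow by blast
    then have "x + (s - r) *\<^sub>R v \<in> A'" by (simp add: algebra_simps)
    from segment_collar_unique_translate[OF A' \<open>v \<noteq> 0\<close> \<open>0 < t\<close> this]
    show ?thesis by (simp add: D'_def \<tau>_def add.commute)
  qed
  have ex1': "k = l" if "x \<in> D'" "\<tau> k x \<in> D" "\<tau> l x \<in> D" for x k l
  proof -
    have "\<tau> k x \<in> A + closed_segment 0 (t *\<^sub>R v)" using that by (simp add: D_def)
    then obtain r where "\<tau> k x - r *\<^sub>R v \<in> A"
      using mem_plus_segment[OF less_imp_le[OF \<open>0 < t\<close>]] by blast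
    then have "x + (of_int k * t - r) *\<^sub>R v \<in> A" by (simp add: \<tau>_def algebra_simps)
    from segment_collar_unique_translate[OF A \<open>v \<noteq> 0\<close> \<open>0 < t\<close> this]
    have "\<exists>!k. \<tau> k x \<in> D" by (simp add: D_def \<tau>_def add.commute)
    with that(2,3) show ?thesis by blast
  qed
  \<comment> \<open>\<open>P k\<close> is the part of \<open>D\<close> that the translation
    \<open>\<tau> k\<close> carries into \<open>D'\<close>. By \<open>ex1\<close> these parts
    partition \<open>D\<close>; by \<open>ex1'\<close> their translates are disjoint in
    \<open>D'\<close>.\<close>
  define P where "P k = D \<inter> \<tau> (- k) ` D'" for k
  have P_sets: "P k \<in> sets lebesgue" for k using sets tr by (auto simp: P_def)
  have mem: "x \<in> \<tau> (- k) ` D' \<longleftrightarrow> \<tau> k x \<in> D'" for x k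
  proof -
    have inv: "\<tau> (- k) (\<tau> k x) = x" "\<tau> k (\<tau> (- k) y) = y" for y by (simp_all add: \<tau>_def)
    show ?thesis
    proof
      assume "\<tau> k x \<in> D'"
      then have "\<tau> (- k) (\<tau> k x) \<in> \<tau> (- k) ` D'" by (rule imageI)
      then show "x \<in> \<tau> (- k) ` D'" by (simp only: inv)
    qed (auto simp: inv)
  qed
  have "D = (\<Union>k. P k)"
  proof (intro equalityI subsetI)
    fix x assume "x \<in> D"
    with ex1 obtain k where "\<tau> k x \<in> D'" by blast
    with \<open>x \<in> D\<close> have "x \<in> P k" by (simp add: P_def mem)
    then show "x \<in> (\<Union>k. P k)" by (rule UN_I[OF UNIV_I])
  qed (auto simp: P_def)
  also have "emeasure lebesgue \<dots> = (\<integral>\<^sup>+k. emeasure lebesgue (P k) \<partial>count_space UNIV)"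
  proof (rule emeasure_UN_countable)
    have "k = l" if "x \<in> P k" "x \<in> P l" for x k l
      using ex1[of x] that by (auto simp: P_def mem)
    then show "disjoint_family_on P UNIV"
      unfolding disjoint_family_on_def by blast
  qed (use P_sets in auto)
  also have "\<dots> = (\<integral>\<^sup>+k. emeasure lebesgue (\<tau> k ` P k) \<partial>count_space UNIV)"
    by (simp add: em)
  also have "\<dots> = emeasure lebesgue (\<Union>k. \<tau> k ` P k)"
  proof (rule emeasure_UN_countable[symmetric])
    have "x \<in> D' \<and> \<tau> (- k) x \<in> D" if "x \<in> \<tau> k ` P k" for x k
      using that by (auto simp: P_def \<tau>_def)
    then have "k = l" if "x \<in> \<tau> k ` P k" "x \<in> \<tau> l ` P l" for x k l
      using ex1'[of x "- k" "- l"] that by simp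
    then show "disjoint_family_on (\<lambda>k. \<tau> k ` P k) UNIV"
      unfolding disjoint_family_on_def by blast
  qed (use P_sets tr in auto)
  also have "\<dots> \<le> emeasure lebesgue D'"
    using sets by (intro emeasure_mono) (auto simp: P_def \<tau>_def)
  finally show ?thesis .
qed

lemma measure_Diff_segment_collar:
  fixes A :: "'a::euclidean_space set"
  assumes "compact A" "0 \<le> t"
  shows "measure lebesgue (A + closed_segment 0 (t *\<^sub>R v))
    = measure lebesgue A + measure lebesgue ((A + closed_segment 0 (t *\<^sub>R v)) - A)"
proof -
  have "A \<subseteq> A + closed_segment 0 (t *\<^sub>R v)"
    using assms(2) by (auto simp: mem_plus_segment intro!: exI[of _ 0])
  moreover have "A + closed_segment 0 (t *\<^sub>R v) \<in> lmeasurable" "A \<in> lmeasurable"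
    by (intro lmeasurable_compact compact_set_plus compact_segment assms)+
  ultimately show ?thesis
    using measurable_measure_Diff[of "A + closed_segment 0 (t *\<^sub>R v)" lebesgue A] by (simp add: fmeasurableD)
qed

text \<open>The hypotheses \<open>sh\<close> say that \<open>A\<close> and \<open>A'\<close> meet
  the same lines parallel to \<open>v\<close>, so the collar estimate applies in both directions.
  The lemma serves twice: with \<open>A'\<close> a longer body, for affinity, and with
  \<open>A'\<close> a projection of \<open>A\<close>.\<close>

lemma measure_plus_segment_same_shadow:
  fixes A A' :: "'a::euclidean_space set"
  assumes A: "compact A" "convex A" and A': "compact A'" "convex A'"
    and sh: "\<And>x. x \<in> A \<Longrightarrow> \<exists>s. x + s *\<^sub>R v \<in> A'" "\<And>x. x \<in> A' \<Longrightarrow> \<exists>s. x + s *\<^sub>R v \<in> A"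
    and "0 \<le> t"
  shows "measure lebesgue (A + closed_segment 0 (t *\<^sub>R v)) - measure lebesgue A
    = measure lebesgue (A' + closed_segment 0 (t *\<^sub>R v)) - measure lebesgue A'"
proof (cases "v = 0 \<or> t = 0")
  case True
  then show ?thesis by (auto simp: set_plus_def)
next
  case False
  then have "v \<noteq> 0" "0 < t" using \<open>0 \<le> t\<close> by auto
  have "emeasure lebesgue ((A + closed_segment 0 (t *\<^sub>R v)) - A)
      = emeasure lebesgue ((A' + closed_segment 0 (t *\<^sub>R v)) - A')"
    by (intro antisym emeasure_segment_collar_le assms \<open>v \<noteq> 0\<close> \<open>0 < t\<close>)
  then show ?thesis
    using measure_Diff_segment_collar[OF A(1) \<open>0 \<le> t\<close>, of v]
      measure_Diff_segment_collar[OF A'(1) \<open>0 \<le> t\<close>, of v]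
    by (simp add: measure_def)
qed

text \<open>Cauchy's functional equation with monotonicity in place of continuity:
  \<open>N * h s\<close> is trapped between \<open>k * h 1\<close> and \<open>(k + 1) * h 1\<close>
  with \<open>k\<close> the floor of \<open>N * s\<close>, so the error
  \<open>\<bar>h s - s * h 1\<bar>\<close> is at most \<open>h 1 / N\<close> for every positive
  \<open>N\<close>.\<close>

lemma additive_nonneg_imp_linear:
  fixes h :: "real \<Rightarrow> real"
  assumes add: "\<And>s t. 0 \<le> s \<Longrightarrow> 0 \<le> t \<Longrightarrow> h (s + t) = h s + h t"
    and nn: "\<And>s. 0 \<le> s \<Longrightarrow> 0 \<le> h s" and "0 \<le> s"
  shows "h s = s * h 1"
proof -
  have mono: "h a \<le> h b" if "0 \<le> a" "a \<le> b" for a b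
    using add[of a "b - a"] nn[of "b - a"] that by simp
  have h0: "h 0 = 0" using add[of 0 0] by simp
  have mult: "h (real n * a) = real n * h a" if "0 \<le> a" for n a
    using that by (induction n) (simp_all add: h0 add distrib_right)
  have bound: "real N * \<bar>h s - s * h 1\<bar> \<le> h 1" for N
  proof (cases "N = 0")
    case False
    define k where "k = nat \<lfloor>real N * s\<rfloor>"
    have k: "real k \<le> real N * s" "real N * s \<le> real (Suc k)"
      unfolding k_def using \<open>0 \<le> s\<close> by (simp add: of_nat_floor) linarith
    have "real k * h 1 \<le> real N * h s"
      using mono[of "real k" "real N * s"] k mult[of 1 k] mult[of s N] \<open>0 \<le> s\<close> by simp
    moreover have "real N * h s \<le> real (Suc k) * h 1"
      using mono[of "real N * s" "real (Suc k)"] k mult[of 1 "Suc k"] mult[of s N] \<open>0 \<le> s\<close> by simp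
    moreover have "real k * h 1 \<le> real N * s * h 1" "real N * s * h 1 \<le> real (Suc k) * h 1"
      using k nn[of 1] by (simp_all add: mult_right_mono del: of_nat_Suc)
    ultimately have "\<bar>real N * h s - real N * s * h 1\<bar> \<le> h 1"
      by (simp add: algebra_simps abs_le_iff)
    moreover have "\<bar>real N * h s - real N * s * h 1\<bar> = real N * \<bar>h s - s * h 1\<bar>"
      by (metis (no_types) abs_mult abs_of_nat mult.assoc right_diff_distrib)
    ultimately show ?thesis by simp
  qed (simp add: nn)
  show ?thesis
  proof (rule ccontr)
    assume "h s \<noteq> s * h 1"
    then obtain N :: nat where "h 1 < real N * \<bar>h s - s * h 1\<bar>"
      using reals_Archimedean3[of "\<bar>h s - s * h 1\<bar>"] by auto
    with bound[of N] show False by simp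
  qed
qed

text \<open>The gain \<open>h\<close> is additive: lengthening the segment by \<open>t\<close> after
  \<open>s\<close> gains \<open>h t\<close>, because \<open>A\<close> and
  \<open>A + [0, s v]\<close> have the same shadow along \<open>v\<close>.\<close>

lemma measure_plus_segment_affine:
  fixes A :: "'a::euclidean_space set"
  assumes "compact A" "convex A" "0 \<le> s"
  shows "measure lebesgue (A + closed_segment 0 (s *\<^sub>R v))
    = measure lebesgue A + s * (measure lebesgue (A + closed_segment 0 v) - measure lebesgue A)"
proof -
  define h where "h s = measure lebesgue (A + closed_segment 0 (s *\<^sub>R v)) - measure lebesgue A" for s
  have "h s = s * h 1"
  proof (rule additive_nonneg_imp_linear)
    fix s :: real assume "0 \<le> s"
    then show "0 \<le> h s"
      using measure_Diff_segment_collar[OF assms(1), of s v] by (simp add: h_def)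
  next
    fix s t :: real assume st: "0 \<le> s" "0 \<le> t"
    let ?A' = "A + closed_segment 0 (s *\<^sub>R v)"
    have "measure lebesgue (A + closed_segment 0 (t *\<^sub>R v)) - measure lebesgue A
      = measure lebesgue (?A' + closed_segment 0 (t *\<^sub>R v)) - measure lebesgue ?A'"
    proof (rule measure_plus_segment_same_shadow)
      fix x assume "x \<in> A"
      then have "x + 0 *\<^sub>R v \<in> ?A'" using st by (auto simp: mem_plus_segment intro!: exI[of _ 0])
      then show "\<exists>s. x + s *\<^sub>R v \<in> ?A'" by blast
    next
      fix x assume "x \<in> ?A'"
      then obtain r where "x - r *\<^sub>R v \<in> A" using st by (auto simp: mem_plus_segment)
      then show "\<exists>s. x + s *\<^sub>R v \<in> A" by (intro exI[of _ "- r"]) simp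
    qed (intro assms st compact_set_plus compact_segment convex_set_plus convex_closed_segment)+
    moreover have "?A' + closed_segment 0 (t *\<^sub>R v) = A + closed_segment 0 ((s + t) *\<^sub>R v)"
      using segment_plus_segment[OF st, of v] by (simp add: add.assoc)
    ultimately show "h (s + t) = h s + h t" by (simp add: h_def)
  qed fact
  then show ?thesis by (simp add: h_def)
qed

subsection \<open>Hausdorff measure\<close>

lemma hausdorff_content_le:
  assumes "S \<subseteq> (\<Union>i. U i)" "\<And>i. bounded (U i)" "\<And>i. diameter (U i) \<le> \<delta>"
  shows "hausdorff_content d \<delta> S \<le> (\<Sum>i. if U i = {} then 0 else ennreal (diameter (U i) ^ d))"
  unfolding hausdorff_content_def using assms by (intro INF_lower) auto

lemma hausdorff_content_greatest:
  assumes "\<And>U. S \<subseteq> (\<Union>i. U i) \<Longrightarrow> (\<And>i. bounded (U i)) \<Longrightarrow> (\<And>i. diameter (U i) \<le> \<delta>)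
    \<Longrightarrow> c \<le> (\<Sum>i. if U i = {} then 0 else ennreal (diameter (U i) ^ d))"
  shows "c \<le> hausdorff_content d \<delta> S"
  unfolding hausdorff_content_def by (intro INF_greatest) (use assms in auto)

lemma hausdorff_content_mono: "S \<subseteq> T \<Longrightarrow> hausdorff_content d \<delta> S \<le> hausdorff_content d \<delta> T"
  by (intro hausdorff_content_greatest hausdorff_content_le) auto

lemma hausdorff_content_empty: "0 \<le> \<delta> \<Longrightarrow> hausdorff_content d \<delta> {} = 0"
  using hausdorff_content_le[of "{}" "\<lambda>_. {}" \<delta> d] by simp

lemma hausdorff_raw_mono: "S \<subseteq> T \<Longrightarrow> hausdorff_raw d S \<le> hausdorff_raw d T"
  unfolding hausdorff_raw_def by (intro SUP_mono') (rule hausdorff_content_mono)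

lemma hausdorff_content_le_raw: "0 < \<delta> \<Longrightarrow> hausdorff_content d \<delta> S \<le> hausdorff_raw d S"
  unfolding hausdorff_raw_def by (intro SUP_upper) auto

text \<open>Nearly optimal covers of the sets \<open>S i\<close>, with errors
  \<open>e * (1/2) ^ Suc i\<close> summing to \<open>e\<close>, are merged into one sequence by
  \<open>prod_decode\<close>. Infinite contents are split off, since adding an error to them gives
  no strict inequality.\<close>

lemma hausdorff_content_UN_le:
  fixes S :: "nat \<Rightarrow> 'a::metric_space set"
  shows "hausdorff_content d \<delta> (\<Union>i. S i) \<le> (\<Sum>i. hausdorff_content d \<delta> (S i))"
proof (cases "\<exists>i. hausdorff_content d \<delta> (S i) = \<infinity>")
  case True
  then have "(\<Sum>i. hausdorff_content d \<delta> (S i)) = \<infinity>"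
    using ennreal_suminf_lessD[of "\<lambda>i. hausdorff_content d \<delta> (S i)" \<infinity>]
    by (metis infinity_ennreal_def less_top order_less_irrefl)
  then show ?thesis by simp
next
  case False
  define w where "w U = (\<Sum>i. if U i = {} then 0 else ennreal (diameter (U i) ^ d))" for U :: "nat \<Rightarrow> 'a set"
  show ?thesis
  proof (rule ennreal_le_epsilon)
    fix e :: real assume "0 < e"
    have "\<exists>U. S i \<subseteq> (\<Union>j. U j) \<and> (\<forall>j. bounded (U j) \<and> diameter (U j) \<le> \<delta>) \<and>
        w U \<le> hausdorff_content d \<delta> (S i) + ennreal (e * (1/2) ^ Suc i)" for i
    proof -
      have "hausdorff_content d \<delta> (S i) < hausdorff_content d \<delta> (S i) + ennreal (e * (1/2) ^ Suc i)"
        using False \<open>0 < e\<close> by (simp add: ennreal_add_left_cancel_less)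
      then show ?thesis
        by (subst (asm) hausdorff_content_def) (auto simp: INF_less_iff w_def intro: less_imp_le)
    qed
    then obtain U where U: "\<And>i. S i \<subseteq> (\<Union>j. U i j)" "\<And>i j. bounded (U i j)" "\<And>i j. diameter (U i j) \<le> \<delta>"
      and wU: "\<And>i. w (U i) \<le> hausdorff_content d \<delta> (S i) + ennreal (e * (1/2) ^ Suc i)"
      by metis
    have "hausdorff_content d \<delta> (\<Union>i. S i) \<le> w (\<lambda>k. case prod_decode k of (i, j) \<Rightarrow> U i j)"
      unfolding w_def
    proof (rule hausdorff_content_le)
      show "(\<Union>i. S i) \<subseteq> (\<Union>k. case prod_decode k of (i, j) \<Rightarrow> U i j)"
      proof
        fix x assume "x \<in> (\<Union>i. S i)"
        then obtain i j where "x \<in> U i j" using U(1) by blast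
        then have "x \<in> (case prod_decode (prod_encode (i, j)) of (i, j) \<Rightarrow> U i j)" by simp
        then show "x \<in> (\<Union>k. case prod_decode k of (i, j) \<Rightarrow> U i j)" by (rule UN_I[OF UNIV_I])
      qed
    qed (use U in \<open>auto split: prod.split\<close>)
    also have "\<dots> = (\<Sum>k. case prod_decode k of (i, j) \<Rightarrow> if U i j = {} then 0 else ennreal (diameter (U i j) ^ d))"
      unfolding w_def by (intro suminf_cong) (auto split: prod.split)
    also have "\<dots> = (\<Sum>i. w (U i))"
      unfolding w_def
      using suminf_ennreal_2dimen[of "\<lambda>i. \<Sum>j. if U i j = {} then 0 else ennreal (diameter (U i j) ^ d)"
          "\<lambda>(i, j). if U i j = {} then 0 else ennreal (diameter (U i j) ^ d)"]
      by (simp add: comp_def)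
    also have "\<dots> \<le> (\<Sum>i. hausdorff_content d \<delta> (S i) + ennreal (e * (1/2) ^ Suc i))"
      by (intro suminf_le wU) auto
    also have "\<dots> = (\<Sum>i. hausdorff_content d \<delta> (S i)) + (\<Sum>i. ennreal (e * (1/2) ^ Suc i))"
      by (intro suminf_add[symmetric]) auto
    also have "(\<Sum>i. ennreal (e * (1/2) ^ Suc i)) = ennreal e"
      using sums_mult[OF power_half_series, of e] \<open>0 < e\<close>
      by (intro suminf_ennreal_eq) auto
    finally show "hausdorff_content d \<delta> (\<Union>i. S i) \<le> (\<Sum>i. hausdorff_content d \<delta> (S i)) + ennreal e" .
  qed
qed

lemma hausdorff_raw_UN_le: "hausdorff_raw d (\<Union>i. S i) \<le> (\<Sum>i. hausdorff_raw d (S i))"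
  unfolding hausdorff_raw_def[of d "\<Union>i. S i"]
proof (rule SUP_least)
  fix \<delta> :: real assume "\<delta> \<in> {0<..}"
  then have "(\<Sum>i. hausdorff_content d \<delta> (S i)) \<le> (\<Sum>i. hausdorff_raw d (S i))"
    by (intro suminf_le hausdorff_content_le_raw) auto
  with hausdorff_content_UN_le show "hausdorff_content d \<delta> (\<Union>i. S i) \<le> (\<Sum>i. hausdorff_raw d (S i))"
    by (rule order_trans)
qed

lemma hausdorff_content_Un_le:
  assumes "0 \<le> \<delta>"
  shows "hausdorff_content d \<delta> (S \<union> T) \<le> hausdorff_content d \<delta> S + hausdorff_content d \<delta> T"
proof -
  let ?S = "\<lambda>i::nat. if i = 0 then S else if i = 1 then T else {}"
  have "(\<Union>i. ?S i) = S \<union> T" by (auto split: if_splits)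
  moreover have "(\<Sum>i. hausdorff_content d \<delta> (?S i)) = (\<Sum>i\<in>{0,1}. hausdorff_content d \<delta> (?S i))"
    using assms by (intro suminf_finite) (auto simp: hausdorff_content_empty)
  ultimately show ?thesis using hausdorff_content_UN_le[of d \<delta> ?S] by simp
qed

lemma hausdorff_content_finite_UN_le:
  assumes "0 \<le> \<delta>" "finite I"
  shows "hausdorff_content d \<delta> (\<Union>i\<in>I. S i) \<le> (\<Sum>i\<in>I. hausdorff_content d \<delta> (S i))"
  using assms(2)
proof (induction I)
  case empty
  then show ?case using assms by (simp add: hausdorff_content_empty)
next
  case (insert i I)
  have "hausdorff_content d \<delta> (\<Union>i\<in>insert i I. S i)
      \<le> hausdorff_content d \<delta> (S i) + hausdorff_content d \<delta> (\<Union>i\<in>I. S i)"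
    using hausdorff_content_Un_le[OF assms(1)] by simp
  also have "\<dots> \<le> hausdorff_content d \<delta> (S i) + (\<Sum>i\<in>I. hausdorff_content d \<delta> (S i))"
    by (intro add_left_mono insert.IH)
  finally show ?case using insert.hyps by simp
qed

lemma hausdorff_raw_Un_le: "hausdorff_raw d (S \<union> T) \<le> hausdorff_raw d S + hausdorff_raw d T"
  unfolding hausdorff_raw_def[of d "S \<union> T"]
proof (rule SUP_least)
  fix \<delta> :: real assume \<delta>: "\<delta> \<in> {0<..}"
  have "hausdorff_content d \<delta> (S \<union> T) \<le> hausdorff_content d \<delta> S + hausdorff_content d \<delta> T"
    using \<delta> by (intro hausdorff_content_Un_le) auto
  also have "\<dots> \<le> hausdorff_raw d S + hausdorff_raw d T"
    using \<delta> by (intro add_mono hausdorff_content_le_raw) auto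
  finally show "hausdorff_content d \<delta> (S \<union> T) \<le> hausdorff_raw d S + hausdorff_raw d T" .
qed

section \<open>Hausdorff measure under Lipschitz maps and similarities\<close>

lemma diameter_Lipschitz_image_le:
  fixes f :: "'a::real_normed_vector \<Rightarrow> 'b::real_normed_vector"
  assumes "bounded S" "0 \<le> L" "\<And>x y. x \<in> S \<Longrightarrow> y \<in> S \<Longrightarrow> dist (f x) (f y) \<le> L * dist x y"
  shows "diameter (f ` S) \<le> L * diameter S"
proof (cases "S = {}")
  case False
  show ?thesis
  proof (rule diameter_le)
    fix x y assume "x \<in> f ` S" "y \<in> f ` S"
    then obtain a b where "a \<in> S" "b \<in> S" "x = f a" "y = f b" by blast
    then have "dist x y \<le> L * dist a b" using assms(3) by simp
    also have "\<dots> \<le> L * diameter S"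
      using assms(2) diameter_bounded_bound[OF assms(1) \<open>a \<in> S\<close> \<open>b \<in> S\<close>] by (rule mult_left_mono[rotated])
    finally show "norm (x - y) \<le> L * diameter S" by (simp add: dist_norm)
  qed (use False in auto)
qed simp

text \<open>A cover of \<open>S\<close> is mapped forward after intersecting its members with
  \<open>S\<close>, because \<open>f\<close> is controlled only there. Diameters grow by at most the
  factor \<open>L\<close>.\<close>

lemma hausdorff_content_Lipschitz_image_le:
  fixes f :: "'a::real_normed_vector \<Rightarrow> 'b::real_normed_vector"
  assumes "0 < L" and lip: "\<And>x y. x \<in> S \<Longrightarrow> y \<in> S \<Longrightarrow> dist (f x) (f y) \<le> L * dist x y"
  shows "hausdorff_content d (L * \<delta>) (f ` S) \<le> ennreal (L ^ d) * hausdorff_content d \<delta> S"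
proof -
  have "hausdorff_content d (L * \<delta>) (f ` S)
      \<le> ennreal (L ^ d) * (\<Sum>i. if U i = {} then 0 else ennreal (diameter (U i) ^ d))"
    if U: "S \<subseteq> (\<Union>i. U i)" "\<And>i. bounded (U i)" "\<And>i. diameter (U i) \<le> \<delta>" for U
  proof -
    have diam: "diameter (f ` (S \<inter> U i)) \<le> L * diameter (U i)" for i
    proof -
      have "diameter (f ` (S \<inter> U i)) \<le> L * diameter (S \<inter> U i)"
          using assms by (intro diameter_Lipschitz_image_le bounded_Int) (use U in auto)
      also have "\<dots> \<le> L * diameter (U i)"
        using U assms(1) by (intro mult_left_mono diameter_subset) auto
      finally show ?thesis .
    qed
    have bdd: "bounded (f ` (S \<inter> U i))" for i
    proof (cases "S \<inter> U i = {}")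
      case False
      then obtain a where a: "a \<in> S \<inter> U i" by blast
      obtain e where e: "\<And>y. y \<in> U i \<Longrightarrow> dist a y \<le> e"
        using U(2) bounded_any_center[of "U i" a] by auto
      have "dist (f a) y \<le> L * e" if "y \<in> f ` (S \<inter> U i)" for y
      proof -
        from that obtain b where b: "b \<in> S \<inter> U i" "y = f b" by blast
        then have "dist (f a) y \<le> L * dist a b" using lip a by auto
        also have "\<dots> \<le> L * e" using e b assms(1) by (intro mult_left_mono) auto
        finally show ?thesis .
      qed
      then show ?thesis unfolding bounded_def by blast
    qed simp
    have "hausdorff_content d (L * \<delta>) (f ` S)
      \<le> (\<Sum>i. if f ` (S \<inter> U i) = {} then 0 else ennreal (diameter (f ` (S \<inter> U i)) ^ d))"
    proof (rule hausdorff_content_le)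
      show "diameter (f ` (S \<inter> U i)) \<le> L * \<delta>" for i
        using diam[of i] mult_left_mono[OF U(3)[of i] less_imp_le[OF assms(1)]] by linarith
      show "f ` S \<subseteq> (\<Union>i. f ` (S \<inter> U i))" using U(1) by blast
    qed (use bdd in auto)
    also have "\<dots> \<le> (\<Sum>i. ennreal (L ^ d) * (if U i = {} then 0 else ennreal (diameter (U i) ^ d)))"
    proof (intro suminf_le)
      fix i
      have "diameter (f ` (S \<inter> U i)) ^ d \<le> L ^ d * diameter (U i) ^ d"
        using power_mono[OF diam[of i] diameter_ge_0[OF bdd[of i]], of d] by (simp add: power_mult_distrib)
      then have "ennreal (diameter (f ` (S \<inter> U i)) ^ d) \<le> ennreal (L ^ d) * ennreal (diameter (U i) ^ d)"
        using assms(1) by (simp add: ennreal_mult'[symmetric] ennreal_leI)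
      then show "(if f ` (S \<inter> U i) = {} then 0 else ennreal (diameter (f ` (S \<inter> U i)) ^ d))
          \<le> ennreal (L ^ d) * (if U i = {} then 0 else ennreal (diameter (U i) ^ d))"
        by auto
    qed auto
    also have "\<dots> = ennreal (L ^ d) * (\<Sum>i. if U i = {} then 0 else ennreal (diameter (U i) ^ d))"
      by (rule ennreal_suminf_cmult)
    finally show ?thesis .
  qed
  note key = this
  have c: "ennreal (L ^ d) \<noteq> 0" "ennreal (L ^ d) \<noteq> top" using assms(1) by simp_all
  \<comment> \<open>Moving the constant to the left leaves a lower bound for every cover sum, which
    passes to the infimum.\<close>
  have "hausdorff_content d (L * \<delta>) (f ` S) / ennreal (L ^ d) \<le> hausdorff_content d \<delta> S"
  proof (rule hausdorff_content_greatest)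
    fix U assume "S \<subseteq> (\<Union>i. U i)" "\<And>i::nat. bounded (U i)" "\<And>i. diameter (U i) \<le> \<delta>"
    from divide_right_mono_ennreal[OF key[OF this], of "ennreal (L ^ d)"]
    show "hausdorff_content d (L * \<delta>) (f ` S) / ennreal (L ^ d)
        \<le> (\<Sum>i. if U i = {} then 0 else ennreal (diameter (U i) ^ d))"
      by (simp only: mult.commute[of "ennreal (L ^ d)"] mult_divide_eq_ennreal[OF c])
  qed
  from mult_left_mono[OF this, of "ennreal (L ^ d)"] show ?thesis
    by (simp only: ennreal_times_divide mult.commute[of "ennreal (L ^ d)" "hausdorff_content d (L * \<delta>) (f ` S)"]
        mult_divide_eq_ennreal[OF c]) simp
qed

lemma hausdorff_raw_Lipschitz_image_le:
  fixes f :: "'a::real_normed_vector \<Rightarrow> 'b::real_normed_vector"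
  assumes "0 < L" "\<And>x y. x \<in> S \<Longrightarrow> y \<in> S \<Longrightarrow> dist (f x) (f y) \<le> L * dist x y"
  shows "hausdorff_raw d (f ` S) \<le> ennreal (L ^ d) * hausdorff_raw d S"
  unfolding hausdorff_raw_def[of d "f ` S"]
proof (rule SUP_least)
  fix \<delta> :: real assume \<delta>: "\<delta> \<in> {0<..}"
  have "hausdorff_content d (L * (\<delta> / L)) (f ` S) \<le> ennreal (L ^ d) * hausdorff_content d (\<delta> / L) S"
    by (intro hausdorff_content_Lipschitz_image_le assms)
  also have "\<dots> \<le> ennreal (L ^ d) * hausdorff_raw d S"
    using \<delta> assms(1) by (intro mult_left_mono hausdorff_content_le_raw) auto
  finally show "hausdorff_content d \<delta> (f ` S) \<le> ennreal (L ^ d) * hausdorff_raw d S"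
    using assms(1) by simp
qed

text \<open>The inverse of \<open>f\<close> on its image is Lipschitz with constant
  \<open>1 / L\<close>, so the Lipschitz estimate yields both inequalities.\<close>

lemma hausdorff_raw_similarity_image:
  fixes f :: "'a::real_normed_vector \<Rightarrow> 'b::real_normed_vector"
  assumes "0 < L" "\<And>x y. x \<in> S \<Longrightarrow> y \<in> S \<Longrightarrow> dist (f x) (f y) = L * dist x y"
  shows "hausdorff_raw d (f ` S) = ennreal (L ^ d) * hausdorff_raw d S"
proof (rule antisym)
  show "hausdorff_raw d (f ` S) \<le> ennreal (L ^ d) * hausdorff_raw d S"
    using assms by (intro hausdorff_raw_Lipschitz_image_le) auto
  have inj: "inj_on f S" using assms by (auto simp: inj_on_def) (metis dist_eq_0_iff mult_eq_0_iff less_irrefl)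
  have "hausdorff_raw d (the_inv_into S f ` f ` S) \<le> ennreal ((1 / L) ^ d) * hausdorff_raw d (f ` S)"
  proof (rule hausdorff_raw_Lipschitz_image_le)
    fix x y assume "x \<in> f ` S" "y \<in> f ` S"
    then obtain a b where ab: "a \<in> S" "b \<in> S" "x = f a" "y = f b" by blast
    then show "dist (the_inv_into S f x) (the_inv_into S f y) \<le> 1 / L * dist x y"
      using assms by (simp add: the_inv_into_f_f[OF inj])
  qed (use assms in auto)
  also have "the_inv_into S f ` f ` S = S"
    using the_inv_into_f_f[OF inj] by force
  finally have "ennreal (L ^ d) * hausdorff_raw d S
      \<le> ennreal (L ^ d) * (ennreal ((1 / L) ^ d) * hausdorff_raw d (f ` S))"
    by (intro mult_left_mono) auto
  also have "\<dots> = ennreal (L ^ d * (1 / L) ^ d) * hausdorff_raw d (f ` S)"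
    using assms(1) by (simp add: ennreal_mult mult.assoc)
  also have "L ^ d * (1 / L) ^ d = 1" using assms(1) by (simp add: power_mult_distrib[symmetric])
  finally show "ennreal (L ^ d) * hausdorff_raw d S \<le> hausdorff_raw d (f ` S)" by simp
qed

subsection \<open>Hausdorff measure on coordinate subspaces\<close>

definition coord_proj :: "'a::euclidean_space set \<Rightarrow> 'a \<Rightarrow> 'a" where
  "coord_proj B x = (\<Sum>b\<in>B. (x \<bullet> b) *\<^sub>R b)"

text \<open>The cylinder of unit height over \<open>S\<close> in the missing coordinate directions: its Lebesgue measure
  plays the role of the \<open>card B\<close>-dimensional Lebesgue measure of \<open>S\<close>.\<close>

definition cylinder :: "'a::euclidean_space set \<Rightarrow> 'a set \<Rightarrow> 'a set" where
  "cylinder B S = {x. coord_proj B x \<in> S \<and> (\<forall>b\<in>Basis - B. 0 \<le> x \<bullet> b \<and> x \<bullet> b \<le> 1)}"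

definition coord_plane :: "'a::euclidean_space set \<Rightarrow> 'a set" where
  "coord_plane B = {x. \<forall>b\<in>Basis - B. x \<bullet> b = 0}"

lemma inner_coord_proj:
  assumes "B \<subseteq> Basis" "i \<in> Basis"
  shows "coord_proj B x \<bullet> i = (if i \<in> B then x \<bullet> i else 0)"
proof -
  have "coord_proj B x \<bullet> i = (\<Sum>b\<in>B. if b = i then x \<bullet> i else 0)"
    unfolding coord_proj_def inner_sum_left
    using assms by (intro sum.cong) (auto simp: inner_Basis)
  then show ?thesis
    using assms finite_subset[OF assms(1)] by (simp add: sum.delta)
qed

lemma inner_sum_subset_Basis:
  assumes "B \<subseteq> Basis" "i \<in> Basis"
  shows "\<Sum>B \<bullet> i = (if i \<in> B then 1 else 0)"
proof -
  have "\<Sum>B \<bullet> i = (\<Sum>b\<in>B. if b = i then 1 else 0)"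
    unfolding inner_sum_left using assms by (intro sum.cong) (auto simp: inner_Basis)
  then show ?thesis
    using assms finite_subset[OF assms(1)] by (simp add: sum.delta)
qed

lemma coord_cube_iff:
  assumes "B \<subseteq> Basis"
  shows "x \<in> cbox 0 (\<Sum>B) \<longleftrightarrow> x \<in> coord_plane B \<and> (\<forall>b\<in>B. 0 \<le> x \<bullet> b \<and> x \<bullet> b \<le> 1)"
  using assms by (force simp: mem_box coord_plane_def inner_sum_subset_Basis split: if_splits)

text \<open>Coordinates in \<open>B\<close> come from \<open>S\<close>, the others from the cube.
  This form yields compactness of cylinders, and it turns their volumes into volumes of bodies with
  segments added when one or two basis vectors lie outside \<open>B\<close>.\<close>

lemma cylinder_eq_plus:
  assumes B: "B \<subseteq> Basis" and S: "S \<subseteq> coord_plane B"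
  shows "cylinder B S = S + cbox 0 (\<Sum>(Basis - B))"
proof (intro equalityI subsetI)
  fix x assume x: "x \<in> cylinder B S"
  have "x - coord_proj B x \<in> cbox 0 (\<Sum>(Basis - B))"
    using x B by (auto simp: cylinder_def mem_box inner_diff_left inner_coord_proj inner_sum_subset_Basis)
  moreover have "coord_proj B x \<in> S" "x = coord_proj B x + (x - coord_proj B x)"
    using x by (auto simp: cylinder_def)
  ultimately show "x \<in> S + cbox 0 (\<Sum>(Basis - B))" by (metis set_plus_intro)
next
  fix x assume "x \<in> S + cbox 0 (\<Sum>(Basis - B))"
  then obtain z y where x: "x = z + y" and z: "z \<in> S" and y: "y \<in> cbox 0 (\<Sum>(Basis - B))"
    by (auto simp: set_plus_def)
  have z0: "z \<bullet> b = 0" if "b \<in> Basis - B" for b using z S that by (auto simp: coord_plane_def)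
  have y0: "y \<bullet> b = 0" if "b \<in> B" for b
    using y B that by (force simp: coord_cube_iff coord_plane_def)
  have "coord_proj B x = z"
    unfolding euclidean_eq_iff[of "coord_proj B x"]
    using B z0 y0 by (auto simp: inner_coord_proj x inner_add_left)
  moreover have "0 \<le> x \<bullet> b \<and> x \<bullet> b \<le> 1" if "b \<in> Basis - B" for b
    using y z0[OF that] that by (auto simp: x inner_add_left coord_cube_iff)
  ultimately show "x \<in> cylinder B S" using z by (auto simp: cylinder_def)
qed

section \<open>The Hausdorff measure of the unit cube is positive and finite\<close>

lemma emeasure_cbox_two_sides:
  fixes u v :: "'a::euclidean_space"
  assumes "B \<subseteq> Basis" "0 \<le> p" "0 \<le> q"
    and "\<And>b. b \<in> B \<Longrightarrow> v \<bullet> b - u \<bullet> b = p" "\<And>b. b \<in> Basis - B \<Longrightarrow> v \<bullet> b - u \<bullet> b = q"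
  shows "emeasure lborel (cbox u v) = ennreal (p ^ card B * q ^ (DIM('a) - card B))"
proof -
  have "u \<bullet> b \<le> v \<bullet> b" if "b \<in> Basis" for b
    using assms(2,3) assms(4)[of b] assms(5)[of b] that by (cases "b \<in> B") auto
  then have "emeasure lborel (cbox u v) = ennreal (\<Prod>b\<in>Basis. (v - u) \<bullet> b)"
    by (rule emeasure_lborel_cbox)
  also have "(\<Prod>b\<in>Basis. (v - u) \<bullet> b) = (\<Prod>b\<in>B. (v - u) \<bullet> b) * (\<Prod>b\<in>Basis - B. (v - u) \<bullet> b)"
    using assms(1) by (simp add: prod.subset_diff mult.commute)
  also have "(\<Prod>b\<in>B. (v - u) \<bullet> b) = p ^ card B"
    using assms(4) by (simp add: inner_diff_left)
  also have "(\<Prod>b\<in>Basis - B. (v - u) \<bullet> b) = q ^ card (Basis - B)"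
    using assms(5) by (simp add: inner_diff_left)
  also have "card (Basis - B) = DIM('a) - card B"
    using assms(1) by (meson card_Diff_subset finite_Basis finite_subset)
  finally show ?thesis .
qed

text \<open>A set of diameter \<open>r\<close> lies, in the directions of \<open>B\<close>, in a box
  of side \<open>2 * r\<close> centred at any of its points. Thickened by unit intervals in the
  other directions, these boxes cover the full-dimensional unit cube, so their volumes
  \<open>(2 * r) ^ card B\<close> add up to at least 1.\<close>

lemma hausdorff_content_coord_cube_ge:
  fixes B :: "'a::euclidean_space set"
  assumes B: "B \<subseteq> Basis"
  shows "1 \<le> ennreal (2 ^ card B) * hausdorff_content (card B) \<delta> (cbox 0 (\<Sum>B))"
proof -
  let ?d = "card B"
  have "ennreal (1 / 2 ^ ?d) \<le> hausdorff_content ?d \<delta> (cbox 0 (\<Sum>B))"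
  proof (rule hausdorff_content_greatest)
    fix U :: "nat \<Rightarrow> 'a set"
    assume cov: "cbox 0 (\<Sum>B) \<subseteq> (\<Union>i. U i)" and bdd: "\<And>i. bounded (U i)"
    define c where "c i = (SOME x. x \<in> U i)" for i
    define lo where "lo i = (\<Sum>b\<in>Basis. (if b \<in> B then c i \<bullet> b - diameter (U i) else 0) *\<^sub>R b)" for i
    define hi where "hi i = (\<Sum>b\<in>Basis. (if b \<in> B then c i \<bullet> b + diameter (U i) else 1) *\<^sub>R b)" for i
    define X where "X i = (if U i = {} then {} else cbox (lo i) (hi i))" for i
    have "cbox 0 One \<subseteq> (\<Union>i. X i)"
    proof
      fix x :: 'a assume x: "x \<in> cbox 0 One"
      have "coord_proj B x \<in> cbox 0 (\<Sum>B)"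
        using x B by (auto simp: mem_box inner_coord_proj inner_sum_subset_Basis)
      then obtain i where i: "coord_proj B x \<in> U i" using cov by blast
      then have c: "c i \<in> U i" unfolding c_def by (rule someI)
      have near: "\<bar>x \<bullet> b - c i \<bullet> b\<bar> \<le> diameter (U i)" if "b \<in> B" for b
      proof -
        have "\<bar>(coord_proj B x - c i) \<bullet> b\<bar> \<le> norm (coord_proj B x - c i)"
          using that B by (intro Basis_le_norm) auto
        also have "\<dots> \<le> diameter (U i)"
          using diameter_bounded_bound[OF bdd i c] by (simp add: dist_norm)
        finally show ?thesis
          using inner_coord_proj[OF B subsetD[OF B that], of x] that by (simp add: inner_diff_left)
      qed
      have "x \<in> X i"
        using x i near by (auto simp: X_def mem_box lo_def hi_def abs_le_iff algebra_simps)
      then show "x \<in> (\<Union>i. X i)" by blast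
    qed
    then have "emeasure lborel (cbox 0 One :: 'a set) \<le> emeasure lborel (\<Union>i. X i)"
      by (intro emeasure_mono) (auto simp: X_def)
    also have "\<dots> \<le> (\<Sum>i. emeasure lborel (X i))"
      by (intro emeasure_subadditive_countably) (auto simp: X_def)
    also have "\<dots> \<le> (\<Sum>i. ennreal (2 ^ ?d) * (if U i = {} then 0 else ennreal (diameter (U i) ^ ?d)))"
    proof (intro suminf_le)
      fix i
      have "emeasure lborel (cbox (lo i) (hi i)) = ennreal ((2 * diameter (U i)) ^ ?d * 1 ^ (DIM('a) - ?d))"
        using B diameter_ge_0[OF bdd[of i]]
        by (intro emeasure_cbox_two_sides) (auto simp: lo_def hi_def subset_iff)
      then show "emeasure lborel (X i)
          \<le> ennreal (2 ^ ?d) * (if U i = {} then 0 else ennreal (diameter (U i) ^ ?d))"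
        using diameter_ge_0[OF bdd[of i]] by (simp add: X_def power_mult_distrib ennreal_mult)
    qed auto
    also have "\<dots> = ennreal (2 ^ ?d) * (\<Sum>i. if U i = {} then 0 else ennreal (diameter (U i) ^ ?d))"
      by (rule ennreal_suminf_cmult)
    finally have "1 \<le> ennreal (2 ^ ?d) * (\<Sum>i. if U i = {} then 0 else ennreal (diameter (U i) ^ ?d))"
      by simp
    then have "ennreal (1 / 2 ^ ?d) * 1 \<le> ennreal (1 / 2 ^ ?d) *
        (ennreal (2 ^ ?d) * (\<Sum>i. if U i = {} then 0 else ennreal (diameter (U i) ^ ?d)))"
      by (intro mult_left_mono) auto
    then show "ennreal (1 / 2 ^ ?d) \<le> (\<Sum>i. if U i = {} then 0 else ennreal (diameter (U i) ^ ?d))"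
      by (simp add: mult.assoc[symmetric] ennreal_mult[symmetric])
  qed
  then have "ennreal (2 ^ ?d) * ennreal (1 / 2 ^ ?d) \<le> ennreal (2 ^ ?d) * hausdorff_content ?d \<delta> (cbox 0 (\<Sum>B))"
    by (intro mult_left_mono) auto
  then show ?thesis by (simp add: ennreal_mult[symmetric])
qed

lemma hausdorff_raw_coord_cube_pos:
  fixes B :: "'a::euclidean_space set"
  assumes B: "B \<subseteq> Basis"
  shows "hausdorff_raw (card B) (cbox 0 (\<Sum>B)) \<noteq> 0"
proof
  assume "hausdorff_raw (card B) (cbox 0 (\<Sum>B)) = 0"
  then have "hausdorff_content (card B) 1 (cbox 0 (\<Sum>B)) = 0"
    using hausdorff_content_le_raw[of 1 "card B" "cbox 0 (\<Sum>B)"] by simp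
  then show False using hausdorff_content_coord_cube_ge[OF B, of 1] by simp
qed

lemma hausdorff_content_antimono:
  "\<delta> \<le> \<delta>' \<Longrightarrow> hausdorff_content d \<delta>' S \<le> hausdorff_content d \<delta> S"
  by (intro hausdorff_content_greatest hausdorff_content_le) (auto intro: order_trans)

text \<open>The cube is a union of \<open>2 ^ card B\<close> copies of itself at half scale, and
  halving the scale multiplies the content by at most \<open>(1/2) ^ card B\<close>. The two factors
  cancel, so refining the admissible diameter does not raise the content.\<close>

lemma hausdorff_content_coord_cube_halve:
  fixes B :: "'a::euclidean_space set"
  assumes B: "B \<subseteq> Basis" and \<delta>: "0 \<le> \<delta>"
  shows "hausdorff_content (card B) (1/2 * \<delta>) (cbox 0 (\<Sum>B)) \<le> hausdorff_content (card B) \<delta> (cbox 0 (\<Sum>B))"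
proof -
  let ?Q = "cbox 0 (\<Sum>B)" and ?d = "card B"
  let ?f = "\<lambda>T x. (1/2) *\<^sub>R \<Sum>T + (1/2) *\<^sub>R x"
  have fin: "finite B" using B finite_Basis by (rule finite_subset)
  have "?Q \<subseteq> (\<Union>T\<in>Pow B. ?f T ` ?Q)"
  proof
    fix x assume x: "x \<in> ?Q"
    \<comment> \<open>\<open>T\<close> records the coordinates in which \<open>x\<close> lies in the
      upper half; \<open>y\<close> is the position of \<open>x\<close> within the corresponding
      subcube, rescaled to the whole cube.\<close>
    define T where "T = {b \<in> B. 1/2 < x \<bullet> b}"
    define y where "y = 2 *\<^sub>R x - \<Sum>T"
    have T: "T \<subseteq> B" "T \<subseteq> Basis" using B by (auto simp: T_def)
    have "0 \<le> y \<bullet> b \<and> y \<bullet> b \<le> (\<Sum>B) \<bullet> b" if "b \<in> Basis" for b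
      using x that B T by (auto simp: y_def T_def mem_box inner_diff_left inner_sum_subset_Basis split: if_splits)
    then have "y \<in> ?Q" by (simp add: mem_box)
    moreover have "x = ?f T y" by (simp add: y_def algebra_simps)
    ultimately show "x \<in> (\<Union>T\<in>Pow B. ?f T ` ?Q)" using T by blast
  qed
  then have "hausdorff_content ?d (1/2 * \<delta>) ?Q \<le> hausdorff_content ?d (1/2 * \<delta>) (\<Union>T\<in>Pow B. ?f T ` ?Q)"
    by (rule hausdorff_content_mono)
  also have "\<dots> \<le> (\<Sum>T\<in>Pow B. hausdorff_content ?d (1/2 * \<delta>) (?f T ` ?Q))"
    using \<delta> fin by (intro hausdorff_content_finite_UN_le) auto
  also have "\<dots> \<le> (\<Sum>T\<in>Pow B. ennreal ((1/2) ^ ?d) * hausdorff_content ?d \<delta> ?Q)"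
    by (intro sum_mono hausdorff_content_Lipschitz_image_le)
      (auto simp: dist_norm scaleR_diff_right[symmetric])
  also have "\<dots> = ennreal (2 ^ ?d) * (ennreal ((1/2) ^ ?d) * hausdorff_content ?d \<delta> ?Q)"
    using fin by (simp add: card_Pow ennreal_of_nat_eq_real_of_nat)
  also have "\<dots> = hausdorff_content ?d \<delta> ?Q"
    by (simp add: mult.assoc[symmetric] ennreal_mult[symmetric] power_mult_distrib[symmetric])
  finally show ?thesis .
qed

text \<open>At scale \<open>\<delta>0\<close> the cube covers itself, so its content is finite
  there. Repeated halving reaches arbitrarily small scales without increasing it.\<close>

lemma hausdorff_raw_coord_cube_finite:
  fixes B :: "'a::euclidean_space set"
  assumes B: "B \<subseteq> Basis"
  shows "hausdorff_raw (card B) (cbox 0 (\<Sum>B)) \<noteq> \<infinity>"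
proof -
  let ?Q = "cbox 0 (\<Sum>B)" and ?d = "card B"
  \<comment> \<open>The maximum with 1 keeps the scale positive when the cube is a single
    point.\<close>
  define \<delta>0 where "\<delta>0 = max 1 (diameter ?Q)"
  have \<delta>0: "0 < \<delta>0" by (simp add: \<delta>0_def)
  have halves: "hausdorff_content ?d (\<delta>0 * (1/2) ^ k) ?Q \<le> hausdorff_content ?d \<delta>0 ?Q" for k
  proof (induction k)
    case (Suc k)
    have "hausdorff_content ?d (1/2 * (\<delta>0 * (1/2) ^ k)) ?Q \<le> hausdorff_content ?d (\<delta>0 * (1/2) ^ k) ?Q"
      using \<delta>0 by (intro hausdorff_content_coord_cube_halve B) auto
    with Suc show ?case by (simp add: mult.left_commute)
  qed simp
  have "hausdorff_raw ?d ?Q \<le> hausdorff_content ?d \<delta>0 ?Q"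
    unfolding hausdorff_raw_def[of ?d ?Q]
  proof (rule SUP_least)
    fix \<delta> :: real assume \<delta>: "\<delta> \<in> {0<..}"
    obtain k where "(1/2) ^ k < \<delta> / \<delta>0"
      using real_arch_pow_inv[of "\<delta> / \<delta>0" "1/2"] \<delta> \<delta>0 by auto
    then have "\<delta>0 * (1/2) ^ k \<le> \<delta>" using \<delta>0 by (simp add: field_simps)
    then have "hausdorff_content ?d \<delta> ?Q \<le> hausdorff_content ?d (\<delta>0 * (1/2) ^ k) ?Q"
      by (rule hausdorff_content_antimono)
    with halves show "hausdorff_content ?d \<delta> ?Q \<le> hausdorff_content ?d \<delta>0 ?Q"
      by (rule order_trans[rotated])
  qed
  also have "\<dots> \<le> (\<Sum>i. if (if i = 0 then ?Q else {}) = {} then 0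
      else ennreal (diameter (if i = (0::nat) then ?Q else {}) ^ ?d))"
    using \<delta>0 by (intro hausdorff_content_le) (auto simp: \<delta>0_def split: if_splits)
  also have "\<dots> = (\<Sum>i\<in>{0}. if (if i = 0 then ?Q else {}) = {} then 0
      else ennreal (diameter (if i = (0::nat) then ?Q else {}) ^ ?d))"
    by (intro suminf_finite) auto
  also have "\<dots> < \<infinity>" by (auto simp: ennreal_less_top)
  finally show ?thesis by simp
qed

lemma lmeasurable_countable_cube_cover:
  fixes T :: "'a::euclidean_space set"
  assumes "T \<in> lmeasurable" "bounded T" "0 < e"
  obtains u :: "nat \<Rightarrow> 'a" and s :: "nat \<Rightarrow> real"
  where "\<And>i. 0 \<le> s i" "T \<subseteq> (\<Union>i\<in>{i. 0 < s i}. cbox (u i) (u i + s i *\<^sub>R One))"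
    "(\<Sum>i. ennreal (s i ^ DIM('a))) \<le> ennreal (measure lebesgue T + e)"
proof -
  \<comment> \<open>The dyadic pieces have the proportions of the enclosing box, so that box is
    chosen to be a cube.\<close>
  obtain R where R: "0 < R" "T \<subseteq> cbox (- (R *\<^sub>R One)) (R *\<^sub>R One)"
  proof -
    obtain a where a: "T \<subseteq> cbox (- a) a"
      using bounded_subset_cbox_symmetric[OF assms(2)] by blast
    have "cbox (- a) a \<subseteq> cbox (- ((norm a + 1) *\<^sub>R One)) ((norm a + 1) *\<^sub>R One)"
    proof (intro subset_box_imp ballI)
      fix i :: 'a assume "i \<in> Basis"
      then show "- ((norm a + 1) *\<^sub>R One) \<bullet> i \<le> - a \<bullet> i \<and> a \<bullet> i \<le> ((norm a + 1) *\<^sub>R One) \<bullet> i"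
        using Basis_le_norm[of i a] by (auto simp: abs_le_iff)
    qed
    with a show thesis by (intro that[of "norm a + 1"]) (auto simp: add_nonneg_pos)
  qed
  obtain \<D> where \<D>: "countable \<D>"
    "\<And>K. K \<in> \<D> \<Longrightarrow> K \<subseteq> cbox (- (R *\<^sub>R One)) (R *\<^sub>R One) \<and> K \<noteq> {} \<and> (\<exists>c d. K = cbox c d)"
    "pairwise (\<lambda>A B. interior A \<inter> interior B = {}) \<D>"
    "\<And>u v. cbox u v \<in> \<D> \<Longrightarrow> \<exists>n. \<forall>i\<in>Basis. v \<bullet> i - u \<bullet> i = ((R *\<^sub>R One) \<bullet> i - (- (R *\<^sub>R One)) \<bullet> i) / 2 ^ n"
    "T \<subseteq> \<Union>\<D>" "\<Union>\<D> \<in> lmeasurable" "measure lebesgue (\<Union>\<D>) \<le> measure lebesgue T + e"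
    using measurable_outer_intervals_bounded[OF assms(1) R(2) assms(3)] by metis
  have "\<exists>u s. 0 < s \<and> K = cbox u (u + s *\<^sub>R One)" if K: "K \<in> \<D>" for K
  proof -
    obtain u v where uv: "K = cbox u v" using \<D>(2)[OF K] by blast
    then obtain n where n: "\<forall>i\<in>Basis. v \<bullet> i - u \<bullet> i = 2 * R / 2 ^ n"
      using \<D>(4)[of u v] K by auto
    have "v = u + (2 * R / 2 ^ n) *\<^sub>R One"
      unfolding euclidean_eq_iff[of v] using n by (auto simp: inner_add_left algebra_simps)
    with uv R(1) show ?thesis by (intro exI[of _ u] exI[of _ "2 * R / 2 ^ n"]) auto
  qed
  then obtain U S where US: "\<And>K. K \<in> \<D> \<Longrightarrow> 0 < S K \<and> K = cbox (U K) (U K + S K *\<^sub>R One)"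
    by metis
  define I where "I = to_nat_on \<D> ` \<D>"
  define g where "g = from_nat_into \<D>"
  have g: "g (to_nat_on \<D> K) = K" if "K \<in> \<D>" for K
    using that \<D>(1) by (simp add: g_def)
  have gI: "g i \<in> \<D>" if "i \<in> I" for i using that g by (auto simp: I_def)
  have ginj: "i = j" if "i \<in> I" "j \<in> I" "g i = g j" for i j
    using that g by (auto simp: I_def)
  define s where "s i = (if i \<in> I then S (g i) else 0)" for i
  define u where "u i = U (g i)" for i
  have cube: "g i = cbox (u i) (u i + s i *\<^sub>R One)" "0 < s i" if "i \<in> I" for i
    using US[OF gI[OF that]] that by (auto simp: u_def s_def)
  have s0: "0 \<le> s i" for i using cube(2)[of i] by (cases "i \<in> I") (auto simp: s_def)
  have box: "box (u i) (u i + s i *\<^sub>R One) = (if i \<in> I then interior (g i) else {})" for i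
  proof (cases "i \<in> I")
    case True
    then show ?thesis by (simp only: cube(1)[OF True] interior_cbox if_True)
  next
    case False
    then show ?thesis using nonempty_Basis by (auto simp: s_def box_eq_empty)
  qed
  show thesis
  proof (rule that)
    show "T \<subseteq> (\<Union>i\<in>{i. 0 < s i}. cbox (u i) (u i + s i *\<^sub>R One))"
    proof
      fix x assume "x \<in> T"
      then obtain K where K: "K \<in> \<D>" "x \<in> K" using \<D>(5) by blast
      define i where "i = to_nat_on \<D> K"
      have "i \<in> I" "g i = K" using K g by (auto simp: i_def I_def)
      with cube[of i] K show "x \<in> (\<Union>i\<in>{i. 0 < s i}. cbox (u i) (u i + s i *\<^sub>R One))"
        by auto
    qed
    have "(\<Sum>i. ennreal (s i ^ DIM('a))) = (\<Sum>i. emeasure lborel (box (u i) (u i + s i *\<^sub>R One)))"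
      using s0 by (intro suminf_cong) (subst emeasure_lborel_box, auto simp: inner_add_left)
    also have "\<dots> = emeasure lborel (\<Union>i. box (u i) (u i + s i *\<^sub>R One))"
    proof (rule suminf_emeasure)
      have "box (u i) (u i + s i *\<^sub>R One) \<inter> box (u j) (u j + s j *\<^sub>R One) = {}" if "i \<noteq> j" for i j
        unfolding box using pairwiseD[OF \<D>(3), of "g i" "g j"] gI[of i] gI[of j] ginj[of i j] that by auto
      then show "disjoint_family (\<lambda>i. box (u i) (u i + s i *\<^sub>R One))"
        by (auto simp: disjoint_family_on_def)
    qed auto
    also have "\<dots> = emeasure lebesgue (\<Union>i. box (u i) (u i + s i *\<^sub>R One))" by simp
    also have "\<dots> \<le> emeasure lebesgue (\<Union>\<D>)"
    proof (rule emeasure_mono)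
      have "(if i \<in> I then interior (g i) else {}) \<subseteq> \<Union>\<D>" for i
        using gI[of i] interior_subset[of "g i"] by auto
      then show "(\<Union>i. box (u i) (u i + s i *\<^sub>R One)) \<subseteq> \<Union>\<D>" unfolding box by (rule UN_least)
    qed (use \<D>(6) in \<open>simp add: fmeasurableD\<close>)
    also have "\<dots> = ennreal (measure lebesgue (\<Union>\<D>))"
      using \<D>(6) by (simp add: emeasure_eq_measure2)
    also have "\<dots> \<le> ennreal (measure lebesgue T + e)"
      using \<D>(7) by (rule ennreal_leI)
    finally show "(\<Sum>i. ennreal (s i ^ DIM('a))) \<le> ennreal (measure lebesgue T + e)" .
  qed (rule s0)
qed

section \<open>Comparison of Hausdorff measure with the volume of the cylinder\<close>

lemma coord_box_eq_cube_image:
  fixes B :: "'a::euclidean_space set"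
  assumes B: "B \<subseteq> Basis" and "0 < s"
  shows "{z \<in> coord_plane B. \<forall>b\<in>B. u \<bullet> b \<le> z \<bullet> b \<and> z \<bullet> b \<le> u \<bullet> b + s}
    = (\<lambda>x. coord_proj B u + s *\<^sub>R x) ` cbox 0 (\<Sum>B)"
proof (intro equalityI subsetI)
  fix z assume z: "z \<in> {z \<in> coord_plane B. \<forall>b\<in>B. u \<bullet> b \<le> z \<bullet> b \<and> z \<bullet> b \<le> u \<bullet> b + s}"
  define x where "x = (1 / s) *\<^sub>R (z - coord_proj B u)"
  have "x \<in> cbox 0 (\<Sum>B)"
    using z \<open>0 < s\<close> B unfolding coord_cube_iff[OF B]
    by (auto simp: x_def inner_diff_left inner_coord_proj coord_plane_def subset_iff field_simps)
  moreover have "z = coord_proj B u + s *\<^sub>R x" using \<open>0 < s\<close> by (simp add: x_def)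
  ultimately show "z \<in> (\<lambda>x. coord_proj B u + s *\<^sub>R x) ` cbox 0 (\<Sum>B)" by blast
next
  fix z assume "z \<in> (\<lambda>x. coord_proj B u + s *\<^sub>R x) ` cbox 0 (\<Sum>B)"
  then obtain x where x: "x \<in> cbox 0 (\<Sum>B)" "z = coord_proj B u + s *\<^sub>R x" by blast
  then show "z \<in> {z \<in> coord_plane B. \<forall>b\<in>B. u \<bullet> b \<le> z \<bullet> b \<and> z \<bullet> b \<le> u \<bullet> b + s}"
    using \<open>0 < s\<close> B unfolding coord_cube_iff[OF B]
    by (auto simp: inner_add_left inner_coord_proj coord_plane_def subset_iff mult_left_le)
qed

lemma hausdorff_raw_coord_box:
  fixes B :: "'a::euclidean_space set"
  assumes "B \<subseteq> Basis" "0 < s"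
  shows "hausdorff_raw d {z \<in> coord_plane B. \<forall>b\<in>B. u \<bullet> b \<le> z \<bullet> b \<and> z \<bullet> b \<le> u \<bullet> b + s}
    = ennreal (s ^ d) * hausdorff_raw d (cbox 0 (\<Sum>B))"
  unfolding coord_box_eq_cube_image[OF assms] using assms(2)
  by (intro hausdorff_raw_similarity_image) (auto simp: dist_norm scaleR_diff_right[symmetric])

text \<open>A cube cover of the cylinder over \<open>S\<close> cuts every horizontal slice of it in a cube cover of
  \<open>S\<close>; averaging the resulting bounds over all slices gives the claim.\<close>

lemma hausdorff_raw_le_cylinder_aux:
  fixes B :: "'a::euclidean_space set"
  assumes B: "B \<subseteq> Basis" and S: "S \<subseteq> coord_plane B"
    and T: "cylinder B S \<in> lmeasurable" "bounded (cylinder B S)" and "0 < e"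
  shows "hausdorff_raw (card B) S
    \<le> ennreal (measure lebesgue (cylinder B S) + e) * hausdorff_raw (card B) (cbox 0 (\<Sum>B))"
proof -
  let ?d = "card B" and ?n = "DIM('a)"
  define q where "q = hausdorff_raw ?d (cbox 0 (\<Sum>B))"
  obtain u :: "nat \<Rightarrow> 'a" and s :: "nat \<Rightarrow> real" where s: "\<And>i. 0 \<le> s i"
    and cov: "cylinder B S \<subseteq> (\<Union>i\<in>{i. 0 < s i}. cbox (u i) (u i + s i *\<^sub>R One))"
    and tot: "(\<Sum>i. ennreal (s i ^ ?n)) \<le> ennreal (measure lebesgue (cylinder B S) + e)"
    by (rule lmeasurable_countable_cube_cover[OF T \<open>0 < e\<close>]) (rule that)
  have dn: "?d \<le> ?n" using B by (simp add: card_mono)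
  \<comment> \<open>Slices are indexed by points \<open>x\<close> of the full unit cube, of which
    only the coordinates outside \<open>B\<close> matter; hence the range from 0 to 1 in the
    directions of \<open>B\<close>. \<open>X i\<close> describes the slices that cube
    \<open>i\<close> meets, \<open>P i\<close> what it cuts out of the coordinate plane.\<close>
  define lo where "lo i = (\<Sum>b\<in>Basis. (if b \<in> B then 0 else u i \<bullet> b) *\<^sub>R b)" for i
  define hi where "hi i = (\<Sum>b\<in>Basis. (if b \<in> B then 1 else u i \<bullet> b + s i) *\<^sub>R b)" for i
  define X where "X i = (if 0 < s i then cbox (lo i) (hi i) else {})" for i
  define P where "P i = {z \<in> coord_plane B. \<forall>b\<in>B. u i \<bullet> b \<le> z \<bullet> b \<and> z \<bullet> b \<le> u i \<bullet> b + s i}" for i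
  have slice: "hausdorff_raw ?d S \<le> (\<Sum>i. ennreal (s i ^ ?d) * q * indicator (X i) x)"
    if x: "x \<in> cbox 0 One" for x :: 'a
  proof -
    define Y where "Y i = (if x \<in> X i then P i else {})" for i
    have "S \<subseteq> (\<Union>i. Y i)"
    proof
      fix z assume z: "z \<in> S"
      define w where "w = z + (x - coord_proj B x)"
      have zp: "z \<bullet> b = 0" if "b \<in> Basis - B" for b
        using z S that by (auto simp: coord_plane_def)
      have wi: "w \<bullet> b = (if b \<in> B then z \<bullet> b else x \<bullet> b)" if "b \<in> Basis" for b
        using zp[of b] that B by (auto simp: w_def inner_add_left inner_diff_left inner_coord_proj)
      have "coord_proj B w = z"
        unfolding euclidean_eq_iff[of "coord_proj B w"] using B zp by (auto simp: inner_coord_proj wi)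
      then have "w \<in> cylinder B S"
        using z x by (auto simp: cylinder_def wi mem_box)
      then obtain i where i: "0 < s i" "w \<in> cbox (u i) (u i + s i *\<^sub>R One)" using cov by blast
      have wb: "u i \<bullet> b \<le> w \<bullet> b \<and> w \<bullet> b \<le> u i \<bullet> b + s i" if "b \<in> Basis" for b
        using i(2) that by (auto simp: mem_box inner_add_left)
      have wX: "u i \<bullet> b \<le> x \<bullet> b \<and> x \<bullet> b \<le> u i \<bullet> b + s i" if "b \<in> Basis" "b \<notin> B" for b
        using wb[OF that(1)] that wi by simp
      have wP: "u i \<bullet> b \<le> z \<bullet> b \<and> z \<bullet> b \<le> u i \<bullet> b + s i" if "b \<in> B" for b
        using wb[OF subsetD[OF B that]] wi[OF subsetD[OF B that]] that by simp
      have "x \<in> X i"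
        using i(1) x wX by (auto simp: X_def mem_box lo_def hi_def)
      moreover have "z \<in> P i"
        using z S wP by (auto simp: P_def)
      ultimately show "z \<in> (\<Union>i. Y i)" unfolding Y_def by auto
    qed
    then have "hausdorff_raw ?d S \<le> hausdorff_raw ?d (\<Union>i. Y i)" by (rule hausdorff_raw_mono)
    also have "\<dots> \<le> (\<Sum>i. hausdorff_raw ?d (Y i))" by (rule hausdorff_raw_UN_le)
    also have "\<dots> = (\<Sum>i. ennreal (s i ^ ?d) * q * indicator (X i) x)"
    proof (rule suminf_cong)
      fix i
      show "hausdorff_raw ?d (Y i) = ennreal (s i ^ ?d) * q * indicator (X i) x"
      proof (cases "x \<in> X i")
        case True
        then have "0 < s i" by (auto simp: X_def split: if_splits)
        with True show ?thesis
          using hausdorff_raw_coord_box[OF B, of "s i" ?d "u i"] by (simp add: Y_def P_def q_def)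
      qed (simp add: Y_def hausdorff_raw_def hausdorff_content_empty)
    qed
    finally show ?thesis .
  qed
  have X[measurable]: "X i \<in> sets lborel" for i by (auto simp: X_def)
  have vol: "emeasure lborel (X i) \<le> ennreal (s i ^ (?n - ?d))" for i
    using emeasure_cbox_two_sides[OF B, of 1 "s i" "hi i" "lo i"] s[of i] B
    by (auto simp: X_def lo_def hi_def subset_iff)
  have "hausdorff_raw ?d S = (\<integral>\<^sup>+x. hausdorff_raw ?d S * indicator (cbox 0 One :: 'a set) x \<partial>lborel)"
    by (subst nn_integral_cmult_indicator) auto
  also have "\<dots> \<le> (\<integral>\<^sup>+x. (\<Sum>i. ennreal (s i ^ ?d) * q * indicator (X i) x) \<partial>lborel)"
    using slice by (intro nn_integral_mono) (auto simp: indicator_def)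
  also have "\<dots> = (\<Sum>i. \<integral>\<^sup>+x. ennreal (s i ^ ?d) * q * indicator (X i) x \<partial>lborel)"
    by (intro nn_integral_suminf) auto
  also have "\<dots> = (\<Sum>i. ennreal (s i ^ ?d) * q * emeasure lborel (X i))"
    by (intro suminf_cong nn_integral_cmult_indicator X)
  also have "\<dots> \<le> (\<Sum>i. q * ennreal (s i ^ ?n))"
  proof (intro suminf_le)
    fix i
    have "ennreal (s i ^ ?d) * q * emeasure lborel (X i) \<le> ennreal (s i ^ ?d) * q * ennreal (s i ^ (?n - ?d))"
      by (intro mult_left_mono vol) auto
    also have "\<dots> = q * ennreal (s i ^ ?d * s i ^ (?n - ?d))"
      using s[of i] by (simp add: ennreal_mult mult_ac)
    also have "s i ^ ?d * s i ^ (?n - ?d) = s i ^ ?n"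
      using dn by (simp add: power_add[symmetric])
    finally show "ennreal (s i ^ ?d) * q * emeasure lborel (X i) \<le> q * ennreal (s i ^ ?n)" .
  qed auto
  also have "\<dots> = q * (\<Sum>i. ennreal (s i ^ ?n))" by (rule ennreal_suminf_cmult)
  also have "\<dots> \<le> q * ennreal (measure lebesgue (cylinder B S) + e)"
    by (intro mult_left_mono tot) auto
  finally show ?thesis by (simp add: q_def mult.commute)
qed

lemma hausdorff_raw_le_cylinder:
  fixes B :: "'a::euclidean_space set"
  assumes B: "B \<subseteq> Basis" and S: "S \<subseteq> coord_plane B"
    and T: "cylinder B S \<in> lmeasurable" "bounded (cylinder B S)"
  shows "hausdorff_raw (card B) S
    \<le> ennreal (measure lebesgue (cylinder B S)) * hausdorff_raw (card B) (cbox 0 (\<Sum>B))"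
proof -
  obtain r where r: "0 \<le> r" "hausdorff_raw (card B) (cbox 0 (\<Sum>B)) = ennreal r"
    using hausdorff_raw_coord_cube_finite[OF B] by (cases "hausdorff_raw (card B) (cbox 0 (\<Sum>B))") auto
  show ?thesis
  proof (rule ennreal_le_epsilon)
    fix e :: real assume e: "0 < e"
    let ?m = "measure lebesgue (cylinder B S)"
    \<comment> \<open>Dividing the error by \<open>r + 1\<close> also covers
      \<open>r = 0\<close>.\<close>
    have "hausdorff_raw (card B) S \<le> ennreal (?m + e / (r + 1)) * ennreal r"
      using hausdorff_raw_le_cylinder_aux[OF assms, of "e / (r + 1)"] e r by simp
    also have "\<dots> = ennreal ((?m + e / (r + 1)) * r)" using e r by (simp add: ennreal_mult)
    also have "\<dots> \<le> ennreal (?m * r + e)"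
    proof (rule ennreal_leI)
      have "e / (r + 1) * r \<le> e" using e r by (simp add: field_simps)
      then show "(?m + e / (r + 1)) * r \<le> ?m * r + e" by (simp add: distrib_right)
    qed
    also have "\<dots> = ennreal ?m * hausdorff_raw (card B) (cbox 0 (\<Sum>B)) + ennreal e"
      using e r by (simp add: ennreal_mult)
    finally show "hausdorff_raw (card B) S
      \<le> ennreal ?m * hausdorff_raw (card B) (cbox 0 (\<Sum>B)) + ennreal e" .
  qed
qed

lemma compact_cylinder:
  fixes B :: "'a::euclidean_space set"
  assumes "B \<subseteq> Basis" "S \<subseteq> coord_plane B" "compact S"
  shows "compact (cylinder B S)"
  unfolding cylinder_eq_plus[OF assms(1,2)]
  by (intro compact_set_plus assms(3) compact_cbox)

text \<open>The lower bound follows from the upper bound for the complement of \<open>Z\<close> in a large cube,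
  so no additivity of Hausdorff measure is needed.\<close>

lemma hausdorff_raw_eq_cylinder:
  fixes B :: "'a::euclidean_space set"
  assumes B: "B \<subseteq> Basis" and Z: "Z \<subseteq> coord_plane B" "compact Z"
  shows "hausdorff_raw (card B) Z
    = ennreal (measure lebesgue (cylinder B Z)) * hausdorff_raw (card B) (cbox 0 (\<Sum>B))"
proof -
  let ?d = "card B" and ?n = "DIM('a)"
  have cZ: "cylinder B Z \<in> lmeasurable" "bounded (cylinder B Z)"
    using compact_cylinder[OF B Z] by (auto intro: lmeasurable_compact compact_imp_bounded)
  have le: "hausdorff_raw ?d Z
      \<le> ennreal (measure lebesgue (cylinder B Z)) * hausdorff_raw ?d (cbox 0 (\<Sum>B))"
    by (rule hausdorff_raw_le_cylinder[OF B Z(1) cZ])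
  obtain r where r: "0 \<le> r" "hausdorff_raw ?d (cbox 0 (\<Sum>B)) = ennreal r"
    using hausdorff_raw_coord_cube_finite[OF B] by (cases "hausdorff_raw ?d (cbox 0 (\<Sum>B))") auto
  obtain z where z: "hausdorff_raw ?d Z = ennreal z" "0 \<le> z"
    using le r by (cases "hausdorff_raw ?d Z") (auto simp: ennreal_mult[symmetric] top_unique)
  obtain R where R: "0 < R" "\<And>x. x \<in> Z \<Longrightarrow> norm x \<le> R"
    using compact_imp_bounded[OF Z(2)] bounded_pos by blast
  define u where "u = - (R *\<^sub>R One :: 'a)"
  define Q where "Q = {x \<in> coord_plane B. \<forall>b\<in>B. u \<bullet> b \<le> x \<bullet> b \<and> x \<bullet> b \<le> u \<bullet> b + 2 * R}"
  have ZQ: "Z \<subseteq> Q"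
  proof
    fix x assume x: "x \<in> Z"
    have "- R \<le> x \<bullet> b \<and> x \<bullet> b \<le> R" if "b \<in> B" for b
      using Basis_le_norm[of b x] R(2)[OF x] that B by (auto simp: abs_le_iff)
    with x Z(1) B show "x \<in> Q" by (auto simp: Q_def u_def subset_iff)
  qed
  define lo where "lo = (\<Sum>b\<in>Basis. (if b \<in> B then - R else 0) *\<^sub>R b :: 'a)"
  define hi where "hi = (\<Sum>b\<in>Basis. (if b \<in> B then R else 1) *\<^sub>R b :: 'a)"
  have cQ: "cylinder B Q = cbox lo hi"
  proof (intro set_eqI)
    fix x
    have "x \<in> cylinder B Q \<longleftrightarrow> (\<forall>b\<in>B. - R \<le> x \<bullet> b \<and> x \<bullet> b \<le> R) \<and> (\<forall>b\<in>Basis - B. 0 \<le> x \<bullet> b \<and> x \<bullet> b \<le> 1)"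
      using B by (auto simp: cylinder_def Q_def u_def coord_plane_def inner_coord_proj subset_iff)
    also have "\<dots> \<longleftrightarrow> x \<in> cbox lo hi"
      using B by (auto simp: mem_box lo_def hi_def subset_iff split: if_splits)
    finally show "x \<in> cylinder B Q \<longleftrightarrow> x \<in> cbox lo hi" .
  qed
  have "emeasure lborel (cbox lo hi) = ennreal ((2 * R) ^ ?d * 1 ^ (?n - ?d))"
    using R(1) B by (intro emeasure_cbox_two_sides) (auto simp: lo_def hi_def subset_iff)
  then have mQ: "measure lebesgue (cylinder B Q) = (2 * R) ^ ?d"
    using R(1) by (simp add: cQ measure_def)
  have QZ: "cylinder B (Q - Z) = cylinder B Q - cylinder B Z" by (auto simp: cylinder_def)
  have sub: "cylinder B Z \<subseteq> cylinder B Q" using ZQ by (auto simp: cylinder_def)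
  have mQZ: "measure lebesgue (cylinder B (Q - Z)) = (2 * R) ^ ?d - measure lebesgue (cylinder B Z)"
    unfolding QZ mQ[symmetric] using cZ(1) sub
    by (intro measurable_measure_Diff) (auto simp: cQ fmeasurableD)
  have "ennreal ((2 * R) ^ ?d) * ennreal r = hausdorff_raw ?d Q"
    using hausdorff_raw_coord_box[OF B, of "2 * R" ?d u] R(1) r by (simp add: Q_def)
  also have "\<dots> \<le> hausdorff_raw ?d (Z \<union> (Q - Z))" by (intro hausdorff_raw_mono) auto
  also have "\<dots> \<le> hausdorff_raw ?d Z + hausdorff_raw ?d (Q - Z)" by (rule hausdorff_raw_Un_le)
  also have "\<dots> \<le> hausdorff_raw ?d Z + ennreal (measure lebesgue (cylinder B (Q - Z))) * ennreal r"
    unfolding r(2)[symmetric]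
  proof (intro add_left_mono hausdorff_raw_le_cylinder[OF B])
    show "Q - Z \<subseteq> coord_plane B" by (auto simp: Q_def)
    show "cylinder B (Q - Z) \<in> lmeasurable" "bounded (cylinder B (Q - Z))"
      unfolding QZ cQ using cZ by (auto intro: fmeasurable.Diff bounded_subset[OF bounded_cbox])
  qed
  finally have "ennreal ((2 * R) ^ ?d * r)
      \<le> ennreal (z + ((2 * R) ^ ?d - measure lebesgue (cylinder B Z)) * r)"
    using R(1) r z mQZ measure_nonneg[of lebesgue "cylinder B (Q - Z)"] by (simp add: ennreal_mult)
  moreover have "0 \<le> z + ((2 * R) ^ ?d - measure lebesgue (cylinder B Z)) * r"
    using r z mQZ measure_nonneg[of lebesgue "cylinder B (Q - Z)"] by simp
  ultimately have "(2 * R) ^ ?d * r \<le> z + ((2 * R) ^ ?d - measure lebesgue (cylinder B Z)) * r"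
    by (simp add: ennreal_le_iff)
  then have "measure lebesgue (cylinder B Z) * r \<le> z" by (simp add: left_diff_distrib)
  then have "ennreal (measure lebesgue (cylinder B Z)) * ennreal r \<le> ennreal z"
    using r by (simp add: ennreal_mult[symmetric] ennreal_leI)
  with le r z show ?thesis by simp
qed

text \<open>The set \<open>B\<close> is the one that \<open>SOME\<close> picks in
  \<open>unit_cube\<close>; for it the normalizing constant is literally the Hausdorff measure of
  the cube spanned by \<open>B\<close> and cancels. Other subspaces are later rotated onto this
  coordinate plane.\<close>

lemma hausdorff_volume_coord_plane:
  fixes Z :: "'a::euclidean_space set"
  assumes "d \<le> DIM('a)"
  obtains B :: "'a set" where "B \<subseteq> Basis" "card B = d"
    "\<And>Z. Z \<subseteq> coord_plane B \<Longrightarrow> compact Z \<Longrightarrow>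
      hausdorff_volume d Z = measure lebesgue (Z + cbox 0 (\<Sum>(Basis - B)))"
proof -
  define B :: "'a set" where "B = (SOME B. B \<subseteq> Basis \<and> card B = d)"
  have "\<exists>B::'a set. B \<subseteq> Basis \<and> card B = d"
    using obtain_subset_with_card_n[OF assms] by metis
  then have B: "B \<subseteq> Basis" "card B = d"
    unfolding B_def by (metis (mono_tags, lifting) someI_ex)+
  have "hausdorff_volume d Z = measure lebesgue (Z + cbox 0 (\<Sum>(Basis - B)))"
    if Z: "Z \<subseteq> coord_plane B" "compact Z" for Z
  proof -
    let ?q = "hausdorff_raw d (cbox 0 (\<Sum>B))"
    have q: "?q \<noteq> 0" "?q \<noteq> top"
      using hausdorff_raw_coord_cube_pos[OF B(1)] hausdorff_raw_coord_cube_finite[OF B(1)] B(2) by auto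
    have "hausdorff_raw d Z / ?q = ennreal (measure lebesgue (cylinder B Z))"
      using hausdorff_raw_eq_cylinder[OF B(1) Z] B(2) by (simp add: mult_divide_eq_ennreal[OF q])
    then show ?thesis
      by (simp add: hausdorff_volume_def unit_cube_def B_def[symmetric] cylinder_eq_plus[OF B(1) Z(1)])
  qed
  with B show thesis by (rule that)
qed

subsection \<open>Volumes of projections\<close>

lemma compact_linear_image:
  fixes f :: "'a::euclidean_space \<Rightarrow> 'b::real_normed_vector"
  assumes "linear f" "compact S"
  shows "compact (f ` S)"
  using assms by (intro compact_continuous_image linear_continuous_on) (simp_all add: linear_linear)

text \<open>The image of a cube of side \<open>s\<close> is a translate of \<open>s\<close> times
  the image of the unit cube. Hence the images of a cube cover have total volume \<open>k\<close>
  times that of the cover, which may be taken arbitrarily close to the volume of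
  \<open>S\<close>.\<close>

lemma emeasure_linear_image_le:
  fixes f :: "'a::euclidean_space \<Rightarrow> 'a"
  assumes f: "linear f" and S: "S \<in> lmeasurable" "bounded S"
  shows "emeasure lebesgue (f ` S)
    \<le> ennreal (measure lebesgue (f ` cbox 0 One)) * ennreal (measure lebesgue S)"
proof -
  define k where "k = measure lebesgue (f ` cbox 0 One)"
  have cf: "compact (f ` K)" if "compact K" for K
    using f that by (rule compact_linear_image)
  have mf: "f ` cbox a b \<in> sets lebesgue" for a b
    by (intro fmeasurableD lmeasurable_compact cf compact_cbox)
  have k: "emeasure lebesgue (f ` cbox 0 One) = ennreal k" "0 \<le> k"
    using lmeasurable_compact[OF cf[OF compact_cbox]] by (auto simp: k_def emeasure_eq_measure2)
  have "emeasure lebesgue (f ` S) \<le> ennreal k * ennreal (measure lebesgue S) + ennreal e" if "0 < e" for e :: real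
  proof -
    have e': "0 < e / (k + 1)" using k(2) that by simp
    obtain u :: "nat \<Rightarrow> 'a" and s :: "nat \<Rightarrow> real" where s: "\<And>i. 0 \<le> s i"
      and cov: "S \<subseteq> (\<Union>i\<in>{i. 0 < s i}. cbox (u i) (u i + s i *\<^sub>R One))"
      and tot: "(\<Sum>i. ennreal (s i ^ DIM('a))) \<le> ennreal (measure lebesgue S + e / (k + 1))"
      by (rule lmeasurable_countable_cube_cover[OF S e']) (rule that)
    have im: "f ` cbox (u i) (u i + s i *\<^sub>R One) = (\<lambda>x. s i *\<^sub>R x + f (u i)) ` f ` cbox 0 One" for i
    proof -
      have "cbox (u i) (u i + s i *\<^sub>R One) = (\<lambda>x. s i *\<^sub>R x + u i) ` cbox 0 One"
        using s[of i] unfolding image_affinity_cbox by (simp add: add.commute)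
      then show ?thesis
        by (simp add: image_image linear_add[OF f] linear_scale[OF f])
    qed
    have "emeasure lebesgue (f ` S) \<le> emeasure lebesgue (\<Union>i. f ` cbox (u i) (u i + s i *\<^sub>R One))"
    proof (rule emeasure_mono)
      have "S \<subseteq> (\<Union>i. cbox (u i) (u i + s i *\<^sub>R One))" using cov by blast
      then show "f ` S \<subseteq> (\<Union>i. f ` cbox (u i) (u i + s i *\<^sub>R One))" by (auto simp: image_UN[symmetric])
    qed (use mf in auto)
    also have "\<dots> \<le> (\<Sum>i. emeasure lebesgue (f ` cbox (u i) (u i + s i *\<^sub>R One)))"
      by (intro emeasure_subadditive_countably) (use mf in auto)
    also have "\<dots> = (\<Sum>i. ennreal k * ennreal (s i ^ DIM('a)))"
      unfolding im emeasure_lebesgue_affine k(1) using s by (simp add: mult.commute)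
    also have "\<dots> = ennreal k * (\<Sum>i. ennreal (s i ^ DIM('a)))" by (rule ennreal_suminf_cmult)
    also have "\<dots> \<le> ennreal k * ennreal (measure lebesgue S + e / (k + 1))"
      by (intro mult_left_mono tot) simp
    also have "\<dots> = ennreal (k * measure lebesgue S + k * (e / (k + 1)))"
      using k(2) that by (simp add: ennreal_mult[symmetric] distrib_left)
    also have "\<dots> \<le> ennreal (k * measure lebesgue S + e)"
      using k(2) that by (intro ennreal_leI) (simp add: field_simps)
    finally show ?thesis using k(2) that by (simp add: ennreal_mult)
  qed
  then show ?thesis unfolding k_def by (rule ennreal_le_epsilon)
qed

text \<open>The library has this, with the determinant as factor, only for well-ordered index types.\<close>

lemma measure_linear_inj_image:
  fixes f :: "'a::euclidean_space \<Rightarrow> 'a"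
  assumes f: "linear f" "inj f"
  obtains k where "0 < k" "\<And>S. compact S \<Longrightarrow> measure lebesgue (f ` S) = k * measure lebesgue S"
proof -
  define k where "k = measure lebesgue (f ` cbox 0 One)"
  have k0: "0 \<le> k" by (simp add: k_def)
  have cf: "compact (g ` K)" if "compact K" "linear g" for K and g :: "'a \<Rightarrow> 'a"
    using that(2,1) by (rule compact_linear_image)
  have le: "measure lebesgue (f ` S) \<le> k * measure lebesgue S"
    if S: "S \<in> lmeasurable" "bounded S" for S
  proof -
    have "emeasure lebesgue (f ` S) \<le> ennreal (k * measure lebesgue S)"
      using emeasure_linear_image_le[OF f(1) S] k0 by (simp add: k_def[symmetric] ennreal_mult)
    then show ?thesis
      unfolding measure_def[of lebesgue "f ` S"] using k0 by (intro enn2real_leI) auto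
  qed
  have eq: "measure lebesgue (f ` Z) = k * measure lebesgue Z" if Z: "compact Z" for Z
  proof -
    obtain a where a: "Z \<subseteq> cbox (- a) a"
      using bounded_subset_cbox_symmetric[OF compact_imp_bounded[OF Z]] by blast
    define R where "R = norm a + 1"
    have R: "0 < R" by (simp add: R_def add_nonneg_pos)
    \<comment> \<open>Again the lower bound for \<open>Z\<close> comes from the upper bound for its
      complement in a large cube, on which the volume of the image is known exactly.\<close>
    define Q where "Q = (\<lambda>x. (2 * R) *\<^sub>R x + (- (R *\<^sub>R One))) ` cbox 0 (One :: 'a)"
    have Qbox: "Q = cbox (- (R *\<^sub>R One)) (R *\<^sub>R One)"
    proof -
      have "(2 * R) *\<^sub>R One - R *\<^sub>R One = (R *\<^sub>R One :: 'a)"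
        by (simp only: scaleR_left_diff_distrib[symmetric]) simp
      then show ?thesis using R unfolding Q_def image_affinity_cbox by simp
    qed
    have ZQ: "Z \<subseteq> Q"
    proof -
      have "cbox (- a) a \<subseteq> Q"
        unfolding Qbox
      proof (intro subset_box_imp ballI)
        fix i :: 'a assume "i \<in> Basis"
        then show "- (R *\<^sub>R One) \<bullet> i \<le> - a \<bullet> i \<and> a \<bullet> i \<le> (R *\<^sub>R One) \<bullet> i"
          using Basis_le_norm[of i a] by (auto simp: abs_le_iff R_def)
      qed
      with a show ?thesis by blast
    qed
    have cQ: "compact Q" by (simp add: Qbox)
    have vQ: "measure lebesgue Q = (2 * R) ^ DIM('a)"
      unfolding Q_def measure_lebesgue_affine using R by simp
    have "f ` Q = (\<lambda>x. (2 * R) *\<^sub>R x + f (- (R *\<^sub>R One))) ` f ` cbox 0 One"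
      unfolding Q_def image_image linear_add[OF f(1)] linear_scale[OF f(1)] ..
    then have "measure lebesgue (f ` Q) = (2 * R) ^ DIM('a) * k"
      using R by (simp add: measure_lebesgue_affine k_def)
    moreover have "measure lebesgue (f ` (Q - Z)) = measure lebesgue (f ` Q) - measure lebesgue (f ` Z)"
      unfolding image_set_diff[OF f(2)] using ZQ
      by (intro measurable_measure_Diff fmeasurableD lmeasurable_compact cf cQ Z f image_mono)
    moreover have "measure lebesgue (Q - Z) = measure lebesgue Q - measure lebesgue Z"
      using ZQ by (intro measurable_measure_Diff fmeasurableD lmeasurable_compact cQ Z)
    moreover have "measure lebesgue (f ` (Q - Z)) \<le> k * measure lebesgue (Q - Z)"
      by (intro le fmeasurable.Diff lmeasurable_compact cQ Z bounded_subset[OF compact_imp_bounded[OF cQ]]) auto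
    ultimately have "k * measure lebesgue Z \<le> measure lebesgue (f ` Z)"
      using vQ by (simp add: right_diff_distrib)
    with le[of Z] Z show ?thesis by (simp add: lmeasurable_compact compact_imp_bounded)
  qed
  have "0 < k"
  proof -
    \<comment> \<open>By surjectivity some compact set is mapped onto the unit cube, of volume 1, so
      \<open>k\<close> cannot vanish.\<close>
    obtain g where g: "linear g" "\<And>x. f (g x) = x"
      using linear_inj_imp_surj[OF f] linear_surjective_right_inverse[OF f(1)] by (metis comp_apply id_apply)
    have "f ` g ` cbox 0 One = cbox 0 (One :: 'a)" by (simp add: image_image g(2))
    then have "1 = k * measure lebesgue (g ` cbox 0 One)"
      using eq[OF cf[OF compact_cbox g(1)], of 0 One] by simp
    then have "k \<noteq> 0" by auto
    with k0 show ?thesis by simp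
  qed
  then show thesis using eq by (rule that)
qed

text \<open>The constant factor of the linear map is tested on the unit ball, which \<open>f\<close>
  maps onto itself.\<close>

lemma measure_orthogonal_image_compact:
  fixes f :: "'a::euclidean_space \<Rightarrow> 'a"
  assumes f: "orthogonal_transformation f" and S: "compact S"
  shows "measure lebesgue (f ` S) = measure lebesgue S"
proof -
  obtain k where k: "\<And>S. compact S \<Longrightarrow> measure lebesgue (f ` S) = k * measure lebesgue S"
    using measure_linear_inj_image[of f] orthogonal_transformation_linear[OF f] orthogonal_transformation_inj[OF f]
    by blast
  have "f ` cball 0 1 = cball 0 1"
    using image_orthogonal_transformation_cball[OF f, of 0 1] f
    by (simp add: orthogonal_transformation_def linear_0)
  then have "measure lebesgue (cball 0 1 :: 'a set) = k * measure lebesgue (cball 0 1 :: 'a set)"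
    using k[OF compact_cball[of 0 1]] by simp
  moreover have "measure lebesgue (cball 0 1 :: 'a set) > 0"
    using content_cball_pos[of 1 "0::'a"] by simp
  ultimately have "k = 1" by simp
  with k[OF S] show ?thesis by simp
qed

lemma linear_image_set_plus:
  assumes "linear f"
  shows "f ` (A + B) = f ` A + f ` B"
proof (intro equalityI subsetI)
  fix y assume "y \<in> f ` (A + B)"
  then obtain a b where "a \<in> A" "b \<in> B" "y = f (a + b)" by (auto simp: set_plus_def)
  then show "y \<in> f ` A + f ` B" by (auto simp: linear_add[OF assms] intro!: set_plus_intro)
next
  fix y assume "y \<in> f ` A + f ` B"
  then obtain a b where "a \<in> A" "b \<in> B" "y = f a + f b" by (auto simp: set_plus_def)
  then show "y \<in> f ` (A + B)"
    by (auto simp: linear_add[OF assms, symmetric] intro!: imageI set_plus_intro)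
qed

section \<open>Orthogonal projections of codimension one and two\<close>

lemma orth_proj_eqI:
  assumes "y \<in> E" "x - y \<in> E\<^sup>\<bottom>" "subspace E"
  shows "orth_proj E x = y"
  unfolding orth_proj_def
proof (rule the_equality)
  fix z assume z: "z \<in> E \<and> x - z \<in> E\<^sup>\<bottom>"
  have "z - y \<in> E" using z assms by (simp add: subspace_diff)
  moreover have "(x - y) - (x - z) \<in> E\<^sup>\<bottom>"
    using z assms(2) subspace_orthogonal_comp by (blast intro: subspace_diff)
  ultimately have "orthogonal (z - y) (z - y)" by (simp add: orthogonal_comp_def)
  then show "z = y" by (simp add: orthogonal_def)
qed (use assms in simp)

lemma orth_proj_perp:
  assumes "norm u = 1"
  shows "orth_proj ({u}\<^sup>\<bottom>) = (\<lambda>x. x - (x \<bullet> u) *\<^sub>R u)"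
proof
  fix x
  have "u \<bullet> u = 1" using assms by (simp add: norm_eq_1)
  then show "orth_proj ({u}\<^sup>\<bottom>) x = x - (x \<bullet> u) *\<^sub>R u"
    by (intro orth_proj_eqI subspace_orthogonal_comp)
      (auto simp: orthogonal_comp_def orthogonal_def inner_diff_right inner_commute)
qed

lemma orth_proj_perp2:
  assumes "norm u = 1" "norm w = 1" "orthogonal u w"
  shows "orth_proj ({u, w}\<^sup>\<bottom>) = (\<lambda>x. x - (x \<bullet> u) *\<^sub>R u - (x \<bullet> w) *\<^sub>R w)"
proof
  fix x
  have *: "u \<bullet> u = 1" "w \<bullet> w = 1" "u \<bullet> w = 0" "w \<bullet> u = 0"
    using assms by (simp_all add: norm_eq_1 orthogonal_def inner_commute)
  show "orth_proj ({u, w}\<^sup>\<bottom>) x = x - (x \<bullet> u) *\<^sub>R u - (x \<bullet> w) *\<^sub>R w"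
    by (intro orth_proj_eqI subspace_orthogonal_comp)
      (auto simp: orthogonal_comp_def orthogonal_def inner_diff_right inner_add_right inner_commute *)
qed

lemma cbox_0_Basis:
  fixes b :: "'a::euclidean_space"
  assumes "b \<in> Basis"
  shows "cbox 0 b = closed_segment 0 b"
proof (intro equalityI subsetI)
  fix x assume x: "x \<in> cbox 0 b"
  have "x = (x \<bullet> b) *\<^sub>R b"
    unfolding euclidean_eq_iff[of x]
  proof
    fix i :: 'a assume "i \<in> Basis"
    then show "x \<bullet> i = ((x \<bullet> b) *\<^sub>R b) \<bullet> i"
      using x assms by (auto simp: mem_box inner_Basis split: if_splits)
  qed
  moreover have "0 \<le> x \<bullet> b" "x \<bullet> b \<le> 1" using x assms by (auto simp: mem_box)
  ultimately show "x \<in> closed_segment 0 b" by (auto simp: in_segment)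
next
  fix x assume "x \<in> closed_segment 0 b"
  then obtain t where "0 \<le> t" "t \<le> 1" "x = t *\<^sub>R b" by (auto simp: in_segment)
  then show "x \<in> cbox 0 b"
    using assms by (auto simp: mem_box inner_Basis)
qed

lemma cbox_0_Basis2:
  fixes b c :: "'a::euclidean_space"
  assumes "b \<in> Basis" "c \<in> Basis" "b \<noteq> c"
  shows "cbox 0 (b + c) = closed_segment 0 b + closed_segment 0 c"
proof (intro equalityI subsetI)
  fix x assume x: "x \<in> cbox 0 (b + c)"
  have "x = (x \<bullet> b) *\<^sub>R b + (x \<bullet> c) *\<^sub>R c"
    unfolding euclidean_eq_iff[of x]
  proof
    fix i :: 'a assume "i \<in> Basis"
    then have "0 \<le> x \<bullet> i" "x \<bullet> i \<le> b \<bullet> i + c \<bullet> i" using x by (auto simp: mem_box inner_add_left)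
    with \<open>i \<in> Basis\<close> show "x \<bullet> i = ((x \<bullet> b) *\<^sub>R b + (x \<bullet> c) *\<^sub>R c) \<bullet> i"
      using assms by (auto simp: inner_Basis inner_add_left split: if_splits)
  qed
  moreover have "0 \<le> x \<bullet> b" "x \<bullet> b \<le> 1" "0 \<le> x \<bullet> c" "x \<bullet> c \<le> 1"
    using x assms by (auto simp: mem_box inner_add_left inner_Basis)
  then have "(x \<bullet> b) *\<^sub>R b \<in> closed_segment 0 b" "(x \<bullet> c) *\<^sub>R c \<in> closed_segment 0 c"
    by (auto simp: in_segment)
  ultimately show "x \<in> closed_segment 0 b + closed_segment 0 c" by (metis set_plus_intro)
next
  fix x assume "x \<in> closed_segment 0 b + closed_segment 0 c"
  then obtain s t where "0 \<le> s" "s \<le> 1" "0 \<le> t" "t \<le> 1" "x = s *\<^sub>R b + t *\<^sub>R c"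
    by (auto simp: in_segment set_plus_def)
  then show "x \<in> cbox 0 (b + c)"
    using assms by (auto simp: mem_box inner_Basis inner_add_left)
qed

text \<open>After \<open>f\<close> has moved \<open>u\<close> to \<open>b\<close>, the reflection
  \<open>g\<close> exchanges \<open>f w\<close> and \<open>c\<close>. It fixes \<open>b\<close>,
  since \<open>b\<close> is orthogonal to both.\<close>

lemma orthogonal_transformation_exists_2:
  fixes u w b c :: "real ^ 'n"
  assumes "norm u = 1" "norm w = 1" "orthogonal u w" "norm b = 1" "norm c = 1" "orthogonal b c"
  obtains f where "orthogonal_transformation f" "f u = b" "f w = c"
proof -
  obtain f where f: "orthogonal_transformation f" "f u = b"
    using orthogonal_transformation_exists_1[OF assms(1,4)] by blast
  \<comment> \<open>\<open>a\<close> is the normal of the mirror; for \<open>a = 0\<close> the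
    formula for \<open>g\<close> is the identity, as required.\<close>
  define a where "a = f w - c"
  define g where "g x = x - (2 * (x \<bullet> a) / (a \<bullet> a)) *\<^sub>R a" for x
  have fw: "f w \<bullet> f w = 1" "c \<bullet> c = 1" "b \<bullet> c = 0" "b \<bullet> f w = 0"
  proof -
    show "b \<bullet> f w = 0"
      using assms(3) f by (metis orthogonal_def orthogonal_transformation_def)
  qed (use assms f in \<open>auto simp: norm_eq_1 orthogonal_def orthogonal_transformation_def\<close>)
  have "linear g"
    by (rule linearI) (simp_all add: g_def inner_add_left add_divide_distrib algebra_simps)
  moreover have "g x \<bullet> g y = x \<bullet> y" for x y
  proof (cases "a = 0")
    case False
    define K where "K = a \<bullet> a"
    define \<alpha> where "\<alpha> x = 2 * (x \<bullet> a) / K" for x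
    have "K \<noteq> 0" using False by (simp add: K_def)
    then have \<alpha>: "x \<bullet> a = \<alpha> x * K / 2" "y \<bullet> a = \<alpha> y * K / 2" by (simp_all add: \<alpha>_def)
    have "g x \<bullet> g y = (x - \<alpha> x *\<^sub>R a) \<bullet> (y - \<alpha> y *\<^sub>R a)" by (simp add: g_def \<alpha>_def K_def)
    also have "\<dots> = x \<bullet> y - \<alpha> y * (x \<bullet> a) - \<alpha> x * (y \<bullet> a) + \<alpha> x * \<alpha> y * K"
      by (simp add: inner_diff_left inner_diff_right inner_commute[of a y] K_def algebra_simps)
    also have "\<dots> = x \<bullet> y" unfolding \<alpha> by simp
    finally show ?thesis .
  qed (simp add: g_def)
  ultimately have "orthogonal_transformation g" by (simp add: orthogonal_transformation_def)
  then have "orthogonal_transformation (g \<circ> f)" using f(1) by (rule orthogonal_transformation_compose)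
  moreover have "(g \<circ> f) u = b"
    using fw by (simp add: g_def f a_def inner_diff_right)
  moreover have "(g \<circ> f) w = c"
  proof (cases "a = 0")
    case False
    have "a \<bullet> a = 2 * (f w \<bullet> a)"
      using fw by (simp add: a_def inner_diff_left inner_diff_right inner_commute[of c "f w"])
    then have "2 * (f w \<bullet> a) / (a \<bullet> a) = 1"
      using False by (metis divide_self inner_eq_zero_iff)
    then have "g (f w) = f w - a" by (simp only: g_def scaleR_one)
    then show ?thesis by (simp add: a_def)
  qed (simp add: g_def a_def)
  ultimately show thesis by (rule that)
qed

lemma hausdorff_volume_orthogonal_image:
  fixes f :: "'a::euclidean_space \<Rightarrow> 'a"
  assumes "orthogonal_transformation f"
  shows "hausdorff_volume d (f ` Z) = hausdorff_volume d Z"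
proof -
  have "hausdorff_raw d (f ` Z) = ennreal (1 ^ d) * hausdorff_raw d Z"
    using assms unfolding orthogonal_transformation_isometry
    by (intro hausdorff_raw_similarity_image) auto
  then show ?thesis by (simp add: hausdorff_volume_def)
qed

text \<open>Hausdorff measure and Lebesgue measure are both invariant under \<open>f\<close>. So the
  cylinder formula passes from the coordinate plane to the rotated subspace, with \<open>Q\<close>
  in place of the complementary cube.\<close>

lemma hausdorff_volume_rotate:
  fixes f :: "real ^ 'n \<Rightarrow> real ^ 'n"
  assumes hv: "\<And>Z. Z \<subseteq> coord_plane B \<Longrightarrow> compact Z \<Longrightarrow>
      hausdorff_volume d Z = measure lebesgue (Z + cbox 0 (\<Sum>(Basis - B)))"
    and f: "orthogonal_transformation f" and Z: "f ` Z \<subseteq> coord_plane B" "compact Z"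
    and Q: "cbox 0 (\<Sum>(Basis - B)) = f ` Q" "compact Q"
  shows "hausdorff_volume d Z = measure lebesgue (Z + Q)"
proof -
  have lin: "linear f" using f by (simp add: orthogonal_transformation_def)
  have "compact (f ` Z)" using lin Z(2) by (rule compact_linear_image)
  have "hausdorff_volume d Z = hausdorff_volume d (f ` Z)"
    by (rule hausdorff_volume_orthogonal_image[OF f, symmetric])
  also have "\<dots> = measure lebesgue (f ` Z + f ` Q)"
    using hv[OF Z(1) \<open>compact (f ` Z)\<close>] Q by simp
  also have "\<dots> = measure lebesgue (f ` (Z + Q))" by (simp add: linear_image_set_plus[OF lin])
  also have "\<dots> = measure lebesgue (Z + Q)"
    by (intro measure_orthogonal_image_compact f compact_set_plus Z Q)
  finally show ?thesis .
qed

lemma hausdorff_volume_hyperplane: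
  fixes u :: "real ^ 'n"
  assumes u: "norm u = 1" and Z: "compact Z" "\<And>z. z \<in> Z \<Longrightarrow> z \<bullet> u = 0"
  shows "hausdorff_volume (CARD('n) - 1) Z = measure lebesgue (Z + closed_segment 0 u)"
proof -
  obtain B :: "(real ^ 'n) set" where B: "B \<subseteq> Basis" "card B = CARD('n) - 1" and
    hv: "\<And>Z. Z \<subseteq> coord_plane B \<Longrightarrow> compact Z \<Longrightarrow>
      hausdorff_volume (CARD('n) - 1) Z = measure lebesgue (Z + cbox 0 (\<Sum>(Basis - B)))"
    using hausdorff_volume_coord_plane[of "CARD('n) - 1"] by (metis DIM_cart DIM_real diff_le_self mult_1_right)
  have "card (Basis - B) = 1"
    using B zero_less_card_finite[where 'a='n]
    by (subst card_Diff_subset) (auto intro: finite_subset[OF B(1)])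
  then obtain b where b: "Basis - B = {b}" by (auto simp: card_1_singleton_iff)
  then have bB: "b \<in> Basis" by auto
  obtain f where f: "orthogonal_transformation f" "f u = b"
    using orthogonal_transformation_exists_1[OF u norm_Basis[OF bB]] by blast
  show ?thesis
  proof (rule hausdorff_volume_rotate[OF hv f(1)])
    show "f ` Z \<subseteq> coord_plane B"
      using Z(2) f by (auto simp: coord_plane_def b) (metis orthogonal_transformation_def)
    show "cbox 0 (\<Sum>(Basis - B)) = f ` closed_segment 0 u"
      using f closed_segment_linear_image[of f 0 u]
      by (simp add: b cbox_0_Basis[OF bB] orthogonal_transformation_def linear_0)
  qed (use Z in auto)
qed

lemma CARD_ge_2_of_orthonormal:
  fixes u w :: "real ^ 'n"
  assumes "norm u = 1" "norm w = 1" "orthogonal u w"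
  shows "2 \<le> CARD('n)"
proof -
  have "u \<noteq> w" using assms by (auto simp: orthogonal_def)
  moreover have "independent {u, w}"
    using assms by (intro pairwise_orthogonal_independent)
      (auto simp: pairwise_def orthogonal_commute)
  ultimately show ?thesis using independent_bound[of "{u, w}"] by simp
qed

lemma hausdorff_volume_codim2:
  fixes u w :: "real ^ 'n"
  assumes uw: "norm u = 1" "norm w = 1" "orthogonal u w"
    and Z: "compact Z" "\<And>z. z \<in> Z \<Longrightarrow> z \<bullet> u = 0" "\<And>z. z \<in> Z \<Longrightarrow> z \<bullet> w = 0"
  shows "hausdorff_volume (CARD('n) - 2) Z
    = measure lebesgue (Z + (closed_segment 0 u + closed_segment 0 w))"
proof -
  note ge2 = CARD_ge_2_of_orthonormal[OF uw]
  obtain B :: "(real ^ 'n) set" where B: "B \<subseteq> Basis" "card B = CARD('n) - 2" and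
    hv: "\<And>Z. Z \<subseteq> coord_plane B \<Longrightarrow> compact Z \<Longrightarrow>
      hausdorff_volume (CARD('n) - 2) Z = measure lebesgue (Z + cbox 0 (\<Sum>(Basis - B)))"
    using hausdorff_volume_coord_plane[of "CARD('n) - 2"] by (metis DIM_cart DIM_real diff_le_self mult_1_right)
  have "card (Basis - B) = 2"
    using B ge2 by (subst card_Diff_subset) (auto intro: finite_subset[OF B(1)])
  then obtain b c where bc: "Basis - B = {b, c}" "b \<noteq> c" by (auto simp: card_2_iff)
  then have bB: "b \<in> Basis" "c \<in> Basis" by auto
  then have "orthogonal b c" using bc(2) by (simp add: orthogonal_def inner_Basis)
  then obtain f where f: "orthogonal_transformation f" "f u = b" "f w = c"
    using orthogonal_transformation_exists_2[OF uw norm_Basis[OF bB(1)] norm_Basis[OF bB(2)]] by blast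
  have lin: "linear f" using f by (simp add: orthogonal_transformation_def)
  show ?thesis
  proof (rule hausdorff_volume_rotate[OF hv f(1)])
    show "f ` Z \<subseteq> coord_plane B"
      using Z(2,3) f by (auto simp: coord_plane_def bc) (metis orthogonal_transformation_def)+
    show "cbox 0 (\<Sum>(Basis - B)) = f ` (closed_segment 0 u + closed_segment 0 w)"
      using f lin closed_segment_linear_image[OF lin, of 0 u] closed_segment_linear_image[OF lin, of 0 w]
      by (simp add: bc cbox_0_Basis2[OF bB bc(2)] linear_image_set_plus linear_0)
  qed (use Z in \<open>auto intro: compact_set_plus\<close>)
qed

lemma linear_shear: "linear (\<lambda>x. x - (x \<bullet> a) *\<^sub>R p)"
  by (rule linearI) (simp_all add: inner_add_left algebra_simps)

text \<open>\<open>A\<close> and its projection meet the same lines parallel to \<open>u\<close>, so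
  adding the segment gains the same volume. The projection lies in a hyperplane and starts from
  volume zero.\<close>

lemma measure_reject_plus_segment:
  fixes A :: "(real ^ 'n) set"
  assumes u: "norm u = 1" and A: "compact A" "convex A"
  shows "measure lebesgue ((\<lambda>x. x - (x \<bullet> u) *\<^sub>R u) ` A + closed_segment 0 u)
    = measure lebesgue (A + closed_segment 0 u) - measure lebesgue A"
proof -
  let ?P = "\<lambda>x. x - (x \<bullet> u) *\<^sub>R u"
  have uu: "u \<bullet> u = 1" using u by (simp add: norm_eq_1)
  have "?P ` A \<subseteq> {x. u \<bullet> x = 0}"
    using uu by (auto simp: inner_diff_right inner_commute)
  moreover have "negligible {x. u \<bullet> x = 0}" using u by (intro negligible_hyperplane) auto
  ultimately have "negligible (?P ` A)" by (rule negligible_subset[rotated])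
  then have 0: "measure lebesgue (?P ` A) = 0" by (rule negligible_imp_measure0)
  have "measure lebesgue (A + closed_segment 0 (1 *\<^sub>R u)) - measure lebesgue A
    = measure lebesgue (?P ` A + closed_segment 0 (1 *\<^sub>R u)) - measure lebesgue (?P ` A)"
  proof (rule measure_plus_segment_same_shadow[OF A])
    show "compact (?P ` A)"
      by (rule compact_linear_image[OF linear_shear A(1)])
    show "convex (?P ` A)" using linear_shear A(2) by (rule convex_linear_image)
    show "\<exists>s. x + s *\<^sub>R u \<in> ?P ` A" if "x \<in> A" for x
      using that by (intro exI[of _ "- (x \<bullet> u)"]) auto
    show "\<exists>s. x + s *\<^sub>R u \<in> A" if x: "x \<in> ?P ` A" for x
    proof -
      obtain a where a: "a \<in> A" "x = ?P a" using x by blast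
      then have "x + (a \<bullet> u) *\<^sub>R u \<in> A" by simp
      then show ?thesis by blast
    qed
  qed simp
  with 0 show ?thesis by simp
qed

lemma hausdorff_volume_orth_proj_perp:
  fixes A :: "(real ^ 'n) set"
  assumes u: "norm u = 1" and A: "compact A" "convex A"
  shows "hausdorff_volume (CARD('n) - 1) (orth_proj ({u}\<^sup>\<bottom>) ` A)
    = measure lebesgue (A + closed_segment 0 u) - measure lebesgue A"
proof -
  have uu: "u \<bullet> u = 1" using u by (simp add: norm_eq_1)
  have "hausdorff_volume (CARD('n) - 1) ((\<lambda>x. x - (x \<bullet> u) *\<^sub>R u) ` A)
      = measure lebesgue ((\<lambda>x. x - (x \<bullet> u) *\<^sub>R u) ` A + closed_segment 0 u)"
  proof (rule hausdorff_volume_hyperplane[OF u])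
    show "compact ((\<lambda>x. x - (x \<bullet> u) *\<^sub>R u) ` A)"
      by (rule compact_linear_image[OF linear_shear A(1)])
  qed (use uu in \<open>auto simp: inner_diff_left\<close>)
  then show ?thesis by (simp add: orth_proj_perp[OF u] measure_reject_plus_segment[OF assms])
qed

text \<open>Projecting along \<open>u\<close> and then along \<open>w\<close> replaces each
  projection by a first difference of volumes; together they give a mixed second difference.\<close>

lemma hausdorff_volume_orth_proj_perp2:
  fixes A :: "(real ^ 'n) set"
  assumes uw: "norm u = 1" "norm w = 1" "orthogonal u w" and A: "compact A" "convex A"
  shows "hausdorff_volume (CARD('n) - 2) (orth_proj ({u, w}\<^sup>\<bottom>) ` A)
    = measure lebesgue (A + closed_segment 0 u + closed_segment 0 w)
      - measure lebesgue (A + closed_segment 0 u) - measure lebesgue (A + closed_segment 0 w)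
      + measure lebesgue A"
proof -
  let ?P = "\<lambda>x. x - (x \<bullet> u) *\<^sub>R u" and ?R = "\<lambda>x. x - (x \<bullet> w) *\<^sub>R w"
  have i: "u \<bullet> u = 1" "w \<bullet> w = 1" "u \<bullet> w = 0" "w \<bullet> u = 0"
    using uw by (simp_all add: norm_eq_1 orthogonal_def inner_commute)
  have proj: "orth_proj ({u, w}\<^sup>\<bottom>) ` A = ?R ` ?P ` A"
    unfolding orth_proj_perp2[OF uw] image_image using i by (simp add: inner_diff_left)
  have cP: "compact (?P ` A)" and cR: "compact (?R ` ?P ` A)"
    by (intro compact_linear_image linear_shear A(1))+
  have vP: "convex (?P ` A)" using linear_shear A(2) by (rule convex_linear_image)
  let ?PA = "?P ` A" and ?U = "closed_segment 0 u" and ?W = "closed_segment 0 w"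
  \<comment> \<open>As \<open>u\<close> and \<open>w\<close> are orthogonal, the projection along
    one of them fixes the segment in the direction of the other.\<close>
  have Rlin: "?R ` (?PA + ?U) = ?R ` ?PA + ?U"
    using i closed_segment_linear_image[OF linear_shear[of w w], of 0 u]
    by (simp add: linear_image_set_plus[OF linear_shear] del: image_image)
  have Plin: "?P ` (A + ?W) = ?PA + ?W"
    using i closed_segment_linear_image[OF linear_shear[of u u], of 0 w]
    by (simp add: linear_image_set_plus[OF linear_shear] del: image_image)
  have "hausdorff_volume (CARD('n) - 2) (orth_proj ({u, w}\<^sup>\<bottom>) ` A)
      = measure lebesgue (?R ` ?PA + (?U + ?W))"
    unfolding proj by (rule hausdorff_volume_codim2[OF uw cR]) (auto simp: inner_diff_left i)
  also have "\<dots> = measure lebesgue (?R ` (?PA + ?U) + ?W)" by (simp add: Rlin add.assoc)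
  also have "\<dots> = measure lebesgue (?PA + ?U + ?W) - measure lebesgue (?PA + ?U)"
    by (intro measure_reject_plus_segment uw compact_set_plus convex_set_plus compact_segment
        convex_closed_segment cP vP)
  also have "?PA + ?U + ?W = ?P ` (A + ?W) + ?U" by (simp add: Plin add_ac)
  also have "measure lebesgue (?P ` (A + ?W) + ?U)
      = measure lebesgue (A + ?W + ?U) - measure lebesgue (A + ?W)"
    by (intro measure_reject_plus_segment uw compact_set_plus convex_set_plus compact_segment
        convex_closed_segment A)
  also have "measure lebesgue (?PA + ?U) = measure lebesgue (A + ?U) - measure lebesgue A"
    by (intro measure_reject_plus_segment uw A)
  finally show ?thesis by (simp add: add_ac)
qed

subsection \<open>Volume polynomials of zonotopes\<close>

lemma measure_plus_ge:
  fixes A B :: "'a::euclidean_space set"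
  assumes "compact A" "compact B" "b \<in> B"
  shows "measure lebesgue A \<le> measure lebesgue (A + B)"
proof -
  have "measure lebesgue A = measure lebesgue ((+) b ` A)" by (simp add: measure_translation)
  also have "\<dots> \<le> measure lebesgue (A + B)"
    using assms
    by (intro measure_mono_fmeasurable fmeasurableD lmeasurable_compact compact_set_plus compact_translation)
      (auto simp: add.commute[of b] intro!: set_plus_intro)
  finally show ?thesis .
qed

text \<open>For negative \<open>s\<close> the segment is a translate of its opposite, hence the
  absolute value.\<close>

lemma measure_plus_segment_scaleR:
  fixes A :: "'a::euclidean_space set"
  assumes "compact A" "convex A"
  shows "measure lebesgue (A + closed_segment 0 (s *\<^sub>R v))
    = measure lebesgue A + \<bar>s\<bar> * (measure lebesgue (A + closed_segment 0 v) - measure lebesgue A)"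
proof (cases "0 \<le> s")
  case False
  have "closed_segment 0 (s *\<^sub>R v) = (+) (s *\<^sub>R v) ` closed_segment 0 ((- s) *\<^sub>R v)"
    using closed_segment_translation[of "s *\<^sub>R v" 0 "(- s) *\<^sub>R v"] by (simp add: closed_segment_commute)
  moreover have "A + (+) (s *\<^sub>R v) ` K = (+) (s *\<^sub>R v) ` (A + K)" for K
    by (auto simp: set_plus_def image_iff) (metis add.left_commute)+
  ultimately have "measure lebesgue (A + closed_segment 0 (s *\<^sub>R v))
      = measure lebesgue (A + closed_segment 0 ((- s) *\<^sub>R v))"
    by (simp add: measure_translation)
  with False show ?thesis using measure_plus_segment_affine[OF assms, of "- s" v] by simp
qed (simp add: measure_plus_segment_affine[OF assms])

text \<open>With lengths \<open>s\<close> and \<open>t\<close> the four volumes are values of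
  \<alpha> + |s| \<beta> + |t| \<gamma> + |s| |t| \<delta>. The inequality amounts to |s| |t|
  \<alpha> \<delta> \<le> |s| |t| \<beta> \<gamma>, which follows from the case of lengths one. Thus
  vectors may be normalized.\<close>

lemma plus_segments_inequality_scaleR:
  fixes A :: "'a::euclidean_space set"
  assumes A: "compact A" "convex A"
    and ineq: "measure lebesgue A * measure lebesgue (A + closed_segment 0 u + closed_segment 0 w)
      \<le> measure lebesgue (A + closed_segment 0 u) * measure lebesgue (A + closed_segment 0 w)"
  shows "measure lebesgue A * measure lebesgue (A + closed_segment 0 (s *\<^sub>R u) + closed_segment 0 (t *\<^sub>R w))
    \<le> measure lebesgue (A + closed_segment 0 (s *\<^sub>R u)) * measure lebesgue (A + closed_segment 0 (t *\<^sub>R w))"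
proof -
  let ?V = "measure lebesgue" and ?S = "closed_segment 0"
  define \<alpha> \<beta> \<gamma> \<delta> where "\<alpha> = ?V A" and "\<beta> = ?V (A + ?S u) - \<alpha>" and "\<gamma> = ?V (A + ?S w) - \<alpha>"
    and "\<delta> = ?V (A + ?S u + ?S w) - \<alpha> - \<beta> - \<gamma>"
  note defs = \<alpha>_def \<beta>_def \<gamma>_def \<delta>_def
  have cc: "compact (A + ?S v)" "convex (A + ?S v)" for v
    by (intro compact_set_plus convex_set_plus A compact_segment convex_closed_segment)+
  have 1: "?V (A + ?S (s *\<^sub>R u)) = \<alpha> + \<bar>s\<bar> * \<beta>" "?V (A + ?S (t *\<^sub>R w)) = \<alpha> + \<bar>t\<bar> * \<gamma>"
    by (simp_all add: measure_plus_segment_scaleR[OF A] defs)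
  have "?V (A + ?S (s *\<^sub>R u) + ?S w) = \<alpha> + \<gamma> + \<bar>s\<bar> * (\<beta> + \<delta>)"
    using measure_plus_segment_scaleR[OF cc, of w s u] by (simp add: defs add_ac)
  then have 2: "?V (A + ?S (s *\<^sub>R u) + ?S (t *\<^sub>R w))
      = \<alpha> + \<bar>s\<bar> * \<beta> + \<bar>t\<bar> * (\<gamma> + \<bar>s\<bar> * \<delta>)"
    using measure_plus_segment_scaleR[OF cc, of "s *\<^sub>R u" t w] 1(1) by (simp add: algebra_simps)
  have "\<alpha> * (\<alpha> + \<beta> + \<gamma> + \<delta>) \<le> (\<alpha> + \<beta>) * (\<alpha> + \<gamma>)"
    using ineq by (simp add: defs)
  then have "\<alpha> * \<delta> \<le> \<beta> * \<gamma>" by (simp add: algebra_simps)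
  then have "\<bar>s\<bar> * \<bar>t\<bar> * (\<alpha> * \<delta>) \<le> \<bar>s\<bar> * \<bar>t\<bar> * (\<beta> * \<gamma>)" by (intro mult_left_mono) auto
  then show ?thesis unfolding 1 2 \<alpha>_def[symmetric] by (simp add: algebra_simps)
qed

lemma measure_pos_iff_aff_dim:
  fixes A :: "'a::euclidean_space set"
  assumes A: "compact A" "convex A"
  shows "0 < measure lebesgue A \<longleftrightarrow> aff_dim A = int DIM('a)"
proof -
  have "0 < measure lebesgue A \<longleftrightarrow> \<not> negligible A"
    using lmeasurable_compact[OF A(1)] negligible_iff_measure[of A] by (simp add: less_le)
  also have "\<dots> \<longleftrightarrow> interior A \<noteq> {}" by (simp add: negligible_convex_interior[OF A(2)])
  also have "\<dots> \<longleftrightarrow> aff_dim A = int DIM('a)"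
  proof
    assume dim: "aff_dim A = int DIM('a)"
    then have "A \<noteq> {}" by auto
    then show "interior A \<noteq> {}"
      using dim rel_interior_eq_empty[OF A(2)] by (simp add: interior_rel_interior)
  qed (rule aff_dim_nonempty_interior)
  finally show ?thesis .
qed

text \<open>If nothing were gained, affinity would forbid any gain from longer segments too. But a
  long segment makes room for two disjoint translates of \<open>A\<close>. Strictness keeps the
  denominators in (c) positive.\<close>

lemma measure_plus_segment_strict:
  fixes A :: "'a::euclidean_space set"
  assumes A: "compact A" "convex A" "0 < measure lebesgue A" and u: "norm u = 1"
  shows "measure lebesgue A < measure lebesgue (A + closed_segment 0 u)"
proof (rule ccontr)
  assume "\<not> ?thesis"
  then have eq: "measure lebesgue (A + closed_segment 0 u) = measure lebesgue A"
    using measure_plus_ge[of A "closed_segment 0 u" 0] A(1) by auto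
  obtain M where M: "0 < M" "\<And>x. x \<in> A \<Longrightarrow> norm x \<le> M"
    using compact_imp_bounded[OF A(1)] bounded_pos by blast
  \<comment> \<open>This length exceeds the bound \<open>2 * M\<close> on the distance of two points
    of \<open>A\<close>.\<close>
  define t where "t = 2 * M + 1"
  let ?A' = "(+) (t *\<^sub>R u) ` A"
  have "t > 0" using M(1) by (simp add: t_def)
  have "A \<inter> ?A' = {}"
  proof (rule equals0I)
    fix x assume "x \<in> A \<inter> ?A'"
    then obtain y where y: "y \<in> A" "x = t *\<^sub>R u + y" "x \<in> A" by blast
    have "t = norm (x - y)" using y u \<open>t > 0\<close> by simp
    also have "\<dots> \<le> M + M" using norm_triangle_ineq4[of x y] M(2)[of x] M(2)[of y] y by linarith
    finally show False by (simp add: t_def)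
  qed
  moreover have "A \<in> lmeasurable" "?A' \<in> lmeasurable"
    using A(1) by (auto intro: lmeasurable_compact compact_translation)
  ultimately have "measure lebesgue (A \<union> ?A') = measure lebesgue A + measure lebesgue A"
    by (simp add: measure_Un3 measure_translation)
  moreover have "A \<union> ?A' \<subseteq> A + closed_segment 0 (t *\<^sub>R u)"
  proof
    fix x assume "x \<in> A \<union> ?A'"
    then have "x - 0 *\<^sub>R u \<in> A \<or> x - t *\<^sub>R u \<in> A" by auto
    then show "x \<in> A + closed_segment 0 (t *\<^sub>R u)"
      unfolding mem_plus_segment[OF less_imp_le[OF \<open>t > 0\<close>]] using \<open>t > 0\<close>
      by (metis less_imp_le order_refl)
  qed
  then have "measure lebesgue (A \<union> ?A') \<le> measure lebesgue (A + closed_segment 0 (t *\<^sub>R u))"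
    using \<open>A \<in> lmeasurable\<close> \<open>?A' \<in> lmeasurable\<close>
    by (intro measure_mono_fmeasurable lmeasurable_compact compact_set_plus A compact_segment) auto
  moreover have "measure lebesgue (A + closed_segment 0 (t *\<^sub>R u)) = measure lebesgue A"
    using measure_plus_segment_scaleR[OF A(1,2), of t u] eq by simp
  ultimately show False using A(3) by simp
qed

text \<open>Arbitrary index sets allow single generators to be split off, and scaling the endpoint
  turns each summand into a plain segment.\<close>

definition zonotope_sum :: "nat set \<Rightarrow> (nat \<Rightarrow> 'a::real_vector) \<Rightarrow> (nat \<Rightarrow> real) \<Rightarrow> 'a set" where
  "zonotope_sum I v x = (\<Sum>i\<in>I. closed_segment 0 (x i *\<^sub>R v i))"

lemma segment_sum_eq: "segment_sum k v x = zonotope_sum {..<k} v x"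
proof -
  have "(\<lambda>y. x i *\<^sub>R y) ` closed_segment 0 (v i) = closed_segment 0 (x i *\<^sub>R v i)" for i
    using closed_segment_linear_image[OF linear_scale_self, of "x i" 0 "v i"] by simp
  then show ?thesis by (simp add: segment_sum_def zonotope_sum_def)
qed

lemma zonotope_sum_cong:
  "(\<And>i. i \<in> I \<Longrightarrow> x i *\<^sub>R v i = y i *\<^sub>R w i) \<Longrightarrow> zonotope_sum I v x = zonotope_sum I w y"
  by (simp add: zonotope_sum_def)

lemma compact_zonotope_sum: "compact (zonotope_sum I (v :: nat \<Rightarrow> 'a::euclidean_space) x)"
  unfolding zonotope_sum_def
  by (induction I rule: infinite_finite_induct) (auto intro: compact_set_plus)

lemma convex_zonotope_sum: "convex (zonotope_sum I v x)"
  unfolding zonotope_sum_def by (intro convex_set_sum convex_closed_segment)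

lemma zero_mem_zonotope_sum: "0 \<in> zonotope_sum I v x"
  unfolding zonotope_sum_def
proof (induction I rule: infinite_finite_induct)
  case (insert i I)
  have "0 + 0 \<in> closed_segment 0 (x i *\<^sub>R v i) + (\<Sum>i\<in>I. closed_segment 0 (x i *\<^sub>R v i))"
    by (intro set_plus_intro insert.IH) simp
  then show ?case using insert.hyps by simp
qed auto

lemma zonotope_sum_add:
  assumes "\<And>i. i \<in> I \<Longrightarrow> 0 \<le> x i" "\<And>i. i \<in> I \<Longrightarrow> 0 \<le> y i"
  shows "zonotope_sum I v x + zonotope_sum I v y = zonotope_sum I v (\<lambda>i. x i + y i)"
  unfolding zonotope_sum_def sum.distrib[symmetric]
  using assms by (intro sum.cong refl segment_plus_segment) auto

lemma zonotope_sum_remove: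
  assumes "finite I" "i \<in> I"
  shows "zonotope_sum I v x = zonotope_sum (I - {i}) v x + closed_segment 0 (x i *\<^sub>R v i)"
  unfolding zonotope_sum_def by (subst sum.remove[OF assms]) (rule add.commute)

lemma linear_image_zonotope_sum:
  fixes f :: "'a::real_vector \<Rightarrow> 'b::real_vector"
  assumes "linear f"
  shows "f ` zonotope_sum I v x = zonotope_sum I (f \<circ> v) x"
  unfolding zonotope_sum_def
proof (induction I rule: infinite_finite_induct)
  case (insert i I)
  have "f ` closed_segment 0 (x i *\<^sub>R v i) = closed_segment 0 (x i *\<^sub>R f (v i))"
    using closed_segment_linear_image[OF assms, of 0 "x i *\<^sub>R v i"]
    by (simp add: linear_0[OF assms] linear_scale[OF assms])
  with insert show ?case by (simp add: linear_image_set_plus[OF assms])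
qed (simp_all add: linear_0[OF assms] set_zero)

lemma measure_zonotope_sum_affine:
  fixes v :: "nat \<Rightarrow> 'a::euclidean_space"
  assumes "finite I" "i \<in> I" "0 \<le> t"
  shows "measure lebesgue (zonotope_sum I v (x(i := t)))
    = measure lebesgue (zonotope_sum I v (x(i := 0)))
      + t * (measure lebesgue (zonotope_sum I v (x(i := 1))) - measure lebesgue (zonotope_sum I v (x(i := 0))))"
proof -
  let ?A = "zonotope_sum (I - {i}) v x"
  have eq: "zonotope_sum I v (x(i := s)) = ?A + closed_segment 0 (s *\<^sub>R v i)" for s
  proof -
    have "zonotope_sum (I - {i}) v (x(i := s)) = ?A" by (rule zonotope_sum_cong) simp
    then show ?thesis by (simp add: zonotope_sum_remove[OF assms(1,2)])
  qed
  show ?thesis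
    unfolding eq
    using measure_plus_segment_affine[OF compact_zonotope_sum convex_zonotope_sum assms(3), of "I - {i}" v x "v i"]
    by simp
qed

lemma measure_zonotope_sum_scale:
  fixes v :: "nat \<Rightarrow> 'a::euclidean_space"
  assumes "0 \<le> t"
  shows "measure lebesgue (zonotope_sum I v (\<lambda>i. t * x i)) = t ^ DIM('a) * measure lebesgue (zonotope_sum I v x)"
proof -
  have "zonotope_sum I v (\<lambda>i. t * x i) = zonotope_sum I ((*\<^sub>R) t \<circ> v) x"
    by (rule zonotope_sum_cong) (simp add: mult.commute)
  also have "\<dots> = (\<lambda>y. t *\<^sub>R y + 0) ` zonotope_sum I v x"
    by (simp add: linear_image_zonotope_sum[OF linear_scale_self])
  finally show ?thesis using assms by (simp only: measure_lebesgue_affine abs_of_nonneg)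
qed

text \<open>Induction on the variables: \<open>F x\<close> is its value at \<open>x i = 0\<close>
  plus \<open>x i\<close> times the increment \<open>F1\<close>, and both are again affine in each
  remaining variable. Restricting to points that vanish off \<open>I\<close> leaves a single point
  in the base case.\<close>

lemma multiaffine_expansion:
  fixes F :: "(nat \<Rightarrow> real) \<Rightarrow> real"
  assumes "finite I"
    and "\<And>x i t. i \<in> I \<Longrightarrow> (\<And>k. 0 \<le> x k) \<Longrightarrow> 0 \<le> t \<Longrightarrow>
      F (x(i := t)) = F (x(i := 0)) + t * (F (x(i := 1)) - F (x(i := 0)))"
  shows "\<exists>a. \<forall>x. (\<forall>k. 0 \<le> x k) \<and> (\<forall>k. k \<notin> I \<longrightarrow> x k = 0) \<longrightarrow> F x = (\<Sum>S\<in>Pow I. a S * (\<Prod>k\<in>S. x k))"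
  using assms
proof (induction I arbitrary: F)
  case empty
  have "x = (\<lambda>_. 0)" if "\<forall>k::nat. x k = 0" for x :: "nat \<Rightarrow> real" using that by auto
  then show ?case by (intro exI[of _ "\<lambda>_. F (\<lambda>_. 0)"]) auto
next
  case (insert i I)
  define F1 where "F1 x = F (x(i := 1)) - F (x(i := 0))" for x
  obtain a0 where "\<forall>x. (\<forall>k. 0 \<le> x k) \<and> (\<forall>k. k \<notin> I \<longrightarrow> x k = 0) \<longrightarrow> F x = (\<Sum>S\<in>Pow I. a0 S * (\<Prod>k\<in>S. x k))"
    using insert.IH[of F, OF insert.prems[OF insertI2]] by blast
  note a0 = mp[OF spec[OF this]]
  have "F1 (x(k := t)) = F1 (x(k := 0)) + t * (F1 (x(k := 1)) - F1 (x(k := 0)))"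
    if k: "k \<in> I" and x: "\<And>k. 0 \<le> x k" and t: "0 \<le> t" for x k t
  proof -
    have "k \<noteq> i" using k insert.hyps by auto
    have "F (x(k := t, i := s)) = F (x(k := 0, i := s)) + t * (F (x(k := 1, i := s)) - F (x(k := 0, i := s)))"
      if "0 \<le> s" for s
      unfolding fun_upd_twist[OF \<open>k \<noteq> i\<close>] by (rule insert.prems) (use k x t that in auto)
    from this[of 0] this[of 1] show ?thesis by (simp add: F1_def algebra_simps)
  qed
  then obtain a1 where "\<forall>x. (\<forall>k. 0 \<le> x k) \<and> (\<forall>k. k \<notin> I \<longrightarrow> x k = 0) \<longrightarrow> F1 x = (\<Sum>S\<in>Pow I. a1 S * (\<Prod>k\<in>S. x k))"
    using insert.IH[of F1] by blast
  note a1 = mp[OF spec[OF this]]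
  \<comment> \<open>Monomials containing \<open>i\<close> come from \<open>F1\<close>, the others
    from \<open>F\<close> at \<open>x i = 0\<close>.\<close>
  define a where "a S = (if i \<in> S then a1 (S - {i}) else a0 S)" for S
  have "F x = (\<Sum>S\<in>Pow (insert i I). a S * (\<Prod>k\<in>S. x k))"
    if x: "\<forall>k. 0 \<le> x k" "\<forall>k. k \<notin> insert i I \<longrightarrow> x k = 0" for x
  proof -
    define y where "y = x(i := 0)"
    have y: "(\<forall>k. 0 \<le> y k) \<and> (\<forall>k. k \<notin> I \<longrightarrow> y k = 0)" using x by (auto simp: y_def)
    have py: "(\<Prod>k\<in>S. y k) = (\<Prod>k\<in>S. x k)" if "S \<in> Pow I" for S
      using that insert.hyps by (intro prod.cong) (auto simp: y_def)
    have disj: "Pow I \<inter> insert i ` Pow I = {}" using insert.hyps by auto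
    have inj: "inj_on (insert i) (Pow I)" using insert.hyps by (auto simp: inj_on_def)
    have "F (x(i := x i)) = F (x(i := 0)) + x i * (F (x(i := 1)) - F (x(i := 0)))"
      by (rule insert.prems) (use x in auto)
    then have "F x = F y + x i * F1 y" by (simp only: y_def F1_def fun_upd_triv fun_upd_upd)
    also have "F y = (\<Sum>S\<in>Pow I. a S * (\<Prod>k\<in>S. x k))"
      unfolding a0[OF y] using insert.hyps by (intro sum.cong) (auto simp: py a_def)
    also have "x i * F1 y = (\<Sum>S\<in>Pow I. a (insert i S) * (\<Prod>k\<in>insert i S. x k))"
      unfolding a1[OF y] sum_distrib_left
    proof (intro sum.cong refl)
      fix S assume S: "S \<in> Pow I"
      then have "i \<notin> S" "finite S" using insert.hyps by (auto intro: finite_subset)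
      then show "x i * (a1 S * (\<Prod>k\<in>S. y k)) = a (insert i S) * (\<Prod>k\<in>insert i S. x k)"
        using py[OF S] by (simp add: a_def)
    qed
    also have "(\<Sum>S\<in>Pow I. a (insert i S) * (\<Prod>k\<in>insert i S. x k)) = (\<Sum>S\<in>insert i ` Pow I. a S * (\<Prod>k\<in>S. x k))"
      using inj by (simp add: sum.reindex)
    also have "(\<Sum>S\<in>Pow I. a S * (\<Prod>k\<in>S. x k)) + \<dots> = (\<Sum>S\<in>Pow (insert i I). a S * (\<Prod>k\<in>S. x k))"
      unfolding Pow_insert using insert.hyps disj by (intro sum.union_disjoint[symmetric]) auto
    finally show ?thesis .
  qed
  then show ?case by blast
qed

text \<open>Affinity in each coefficient gives a multiaffine polynomial, the scaling law of volume
  leaves only its monomials of degree \<open>DIM('a)\<close>, and evaluation at 0/1 vectors shows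
  that their coefficients are volumes.\<close>

lemma volume_polynomial_exists:
  fixes v :: "nat \<Rightarrow> 'a::euclidean_space"
  obtains c where "\<And>S. 0 \<le> c S" "represents_volume m v (homogeneous_multiaffine m DIM('a) c)"
proof -
  let ?n = "DIM('a)" and ?I = "{..<m}"
  define V where "V x = measure lebesgue (zonotope_sum ?I v x)" for x
  have "\<exists>a. \<forall>x. (\<forall>k. 0 \<le> x k) \<and> (\<forall>k. k \<notin> ?I \<longrightarrow> x k = 0) \<longrightarrow> V x = (\<Sum>S\<in>Pow ?I. a S * (\<Prod>k\<in>S. x k))"
    unfolding V_def by (intro multiaffine_expansion measure_zonotope_sum_affine) auto
  then obtain a where "\<forall>x. (\<forall>k. 0 \<le> x k) \<and> (\<forall>k. k \<notin> ?I \<longrightarrow> x k = 0) \<longrightarrow> V x = (\<Sum>S\<in>Pow ?I. a S * (\<Prod>k\<in>S. x k))"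
    by blast
  note a = mp[OF spec[OF this]]
  have V: "V x = (\<Sum>S\<in>{S \<in> Pow ?I. card S = ?n}. a S * (\<Prod>k\<in>S. x k))"
    if x: "(\<forall>k. 0 \<le> x k) \<and> (\<forall>k. k \<notin> ?I \<longrightarrow> x k = 0)" for x
  proof -
    \<comment> \<open>Along the ray through \<open>x\<close>, \<open>p\<close> is the expansion
      minus the scaling law. It vanishes at all nonnegative \<open>t\<close>, hence identically, and
      the coefficient of degree \<open>?n\<close> is compared.\<close>
    define p where "p = (\<Sum>S\<in>Pow ?I. monom (a S * (\<Prod>k\<in>S. x k)) (card S)) - monom (V x) ?n"
    have "poly p t = 0" if "0 \<le> t" for t
    proof -
      have "t ^ ?n * V x = V (\<lambda>k. t * x k)"
        unfolding V_def by (rule measure_zonotope_sum_scale[OF that, symmetric])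
      also have "\<dots> = (\<Sum>S\<in>Pow ?I. a S * (\<Prod>k\<in>S. t * x k))"
        using x that by (intro a) auto
      also have "\<dots> = (\<Sum>S\<in>Pow ?I. poly (monom (a S * (\<Prod>k\<in>S. x k)) (card S)) t)"
        by (simp add: poly_monom prod.distrib mult_ac)
      finally show ?thesis by (simp add: p_def poly_sum poly_monom mult.commute)
    qed
    then have "{0..} \<subseteq> {t. poly p t = 0}" by auto
    moreover have "infinite {0::real..}" by (simp add: infinite_Ici)
    ultimately have "p = 0" using poly_roots_finite[of p] finite_subset by blast
    then have "coeff p ?n = 0" by simp
    then have "V x = (\<Sum>S\<in>Pow ?I. if card S = ?n then a S * (\<Prod>k\<in>S. x k) else 0)"
      by (simp add: p_def coeff_sum)
    then show ?thesis by (simp add: sum.inter_filter[symmetric])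
  qed
  have a_nonneg: "0 \<le> a S" if S: "S \<subseteq> ?I" "card S = ?n" for S
  proof -
    \<comment> \<open>At the indicator vector of \<open>S\<close>, the monomial of \<open>S\<close>
      is the only one of degree \<open>?n\<close> that survives, so the value there is
      \<open>a S\<close>.\<close>
    define x where "x k = (if k \<in> S then 1 else 0 :: real)" for k
    have "V x = (\<Sum>T\<in>{T \<in> Pow ?I. card T = ?n}. a T * (\<Prod>k\<in>T. x k))"
      using S by (intro V) (auto simp: x_def)
    also have "\<dots> = (\<Sum>T\<in>{T \<in> Pow ?I. card T = ?n}. if T = S then a S else 0)"
    proof (intro sum.cong refl)
      fix T assume T: "T \<in> {T \<in> Pow ?I. card T = ?n}"
      have fin: "finite T" "finite S" using T S by (auto intro: finite_subset)
      show "a T * (\<Prod>k\<in>T. x k) = (if T = S then a S else 0)"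
      proof (cases "T = S")
        case False
        then have "\<not> T \<subseteq> S" using card_subset_eq[OF fin(2)] T S by auto
        then have "(\<Prod>k\<in>T. x k) = 0" using fin by (auto simp: x_def)
        with False show ?thesis by simp
      qed (simp add: x_def)
    qed
    also have "\<dots> = a S" using S by (simp add: sum.delta)
    finally show ?thesis by (metis V_def measure_nonneg)
  qed
  \<comment> \<open>\<open>a\<close> is uncontrolled off the \<open>?n\<close>-element subsets of
    \<open>?I\<close>, whereas \<open>rayleigh\<close> asks for nonnegative coefficients on all
    index sets.\<close>
  define c where "c S = (if S \<subseteq> ?I \<and> card S = ?n then a S else 0)" for S
  show thesis
  proof (rule that)
    show "0 \<le> c S" for S using a_nonneg by (simp add: c_def)
    show "represents_volume m v (homogeneous_multiaffine m ?n c)"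
      unfolding represents_volume_def
    proof (intro allI impI)
      fix x :: "nat \<Rightarrow> real" assume x: "\<forall>i<m. 0 \<le> x i"
      define y where "y k = (if k < m then x k else 0)" for k
      have "measure lebesgue (segment_sum m v x) = V y"
        unfolding V_def segment_sum_eq by (intro arg_cong[where f = "measure lebesgue"] zonotope_sum_cong) (simp add: y_def)
      also have "\<dots> = (\<Sum>S\<in>{S \<in> Pow ?I. card S = ?n}. a S * (\<Prod>k\<in>S. y k))"
        using x by (intro V) (auto simp: y_def)
      also have "\<dots> = homogeneous_multiaffine m ?n c x"
        unfolding homogeneous_multiaffine_def
      proof (rule sum.cong)
        fix S assume S: "S \<in> {S. S \<subseteq> ?I \<and> card S = ?n}"
        then have "(\<Prod>k\<in>S. y k) = (\<Prod>k\<in>S. x k)" by (intro prod.cong) (auto simp: y_def)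
        with S show "a S * (\<Prod>k\<in>S. y k) = c S * (\<Prod>k\<in>S. x k)" by (simp add: c_def)
      qed auto
      finally show "homogeneous_multiaffine m ?n c x = measure lebesgue (segment_sum m v x)" by simp
    qed
  qed
qed

subsection \<open>The Rayleigh inequality and its equivalents\<close>

abbreviation volume_at :: "nat \<Rightarrow> (nat \<Rightarrow> 'a::euclidean_space) \<Rightarrow> (nat \<Rightarrow> real) \<Rightarrow> real" where
  "volume_at m v x \<equiv> measure lebesgue (zonotope_sum {..<m} v x)"

text \<open>Only corner values in the coordinates \<open>i\<close> and \<open>j\<close> occur, all
  at nonnegative arguments. So volumes can replace the representing polynomial and no derivatives
  remain.\<close>

definition volume_exchange_inequality :: "'n::finite itself \<Rightarrow> nat \<Rightarrow> bool" where
  "volume_exchange_inequality _ m \<longleftrightarrow>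
     (\<forall>(v :: nat \<Rightarrow> real ^ 'n) x i j. (\<forall>k<m. 0 \<le> x k) \<and> i < m \<and> j < m \<and> i \<noteq> j \<longrightarrow>
        volume_at m v (x(i := 0, j := 0)) * volume_at m v (x(i := 1, j := 1))
          \<le> volume_at m v (x(i := 1, j := 0)) * volume_at m v (x(i := 0, j := 1)))"

lemma homogeneous_multiaffine_affine:
  "homogeneous_multiaffine m d c (x(i := t)) = homogeneous_multiaffine m d c (x(i := 0))
     + t * (homogeneous_multiaffine m d c (x(i := 1)) - homogeneous_multiaffine m d c (x(i := 0)))"
proof -
  have "(\<Prod>k\<in>S. (x(i := t)) k) = (\<Prod>k\<in>S. (x(i := 0)) k) + t * ((\<Prod>k\<in>S. (x(i := 1)) k) - (\<Prod>k\<in>S. (x(i := 0)) k))"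
    if "S \<subseteq> {..<m}" for S
  proof (cases "i \<in> S")
    case True
    have fin: "finite S" using that finite_subset by blast
    have *: "(\<Prod>k\<in>S. (x(i := s)) k) = s * (\<Prod>k\<in>S - {i}. x k)" for s
      unfolding prod.remove[OF fin True] by (auto intro!: arg_cong2[where f = "(*)"] prod.cong)
    show ?thesis unfolding * by simp
  next
    case False
    then have *: "(\<Prod>k\<in>S. (x(i := s)) k) = (\<Prod>k\<in>S. x k)" for s by (intro prod.cong) auto
    show ?thesis unfolding * by simp
  qed
  note prod_affine = this
  have "homogeneous_multiaffine m d c (x(i := t))
    = (\<Sum>S | S \<subseteq> {..<m} \<and> card S = d. c S * (\<Prod>k\<in>S. (x(i := 0)) k)
        + t * (c S * (\<Prod>k\<in>S. (x(i := 1)) k) - c S * (\<Prod>k\<in>S. (x(i := 0)) k)))"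
    unfolding homogeneous_multiaffine_def
  proof (intro sum.cong refl)
    fix S assume "S \<in> {S. S \<subseteq> {..<m} \<and> card S = d}"
    then have "S \<subseteq> {..<m}" by blast
    show "c S * (\<Prod>k\<in>S. (x(i := t)) k) = c S * (\<Prod>k\<in>S. (x(i := 0)) k)
        + t * (c S * (\<Prod>k\<in>S. (x(i := 1)) k) - c S * (\<Prod>k\<in>S. (x(i := 0)) k))"
      unfolding prod_affine[OF \<open>S \<subseteq> {..<m}\<close>] by (simp only: algebra_simps)
  qed
  then show ?thesis
    by (simp only: homogeneous_multiaffine_def sum.distrib sum_distrib_left sum_subtractf right_diff_distrib)
qed

lemma partial_deriv_affine:
  assumes "\<And>x t. f (x(i := t)) = f (x(i := 0)) + t * (f (x(i := 1)) - f (x(i := 0)))"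
  shows "partial_deriv i f x = f (x(i := 1)) - f (x(i := 0))"
proof -
  have "((\<lambda>t. f (x(i := 0)) + t * (f (x(i := 1)) - f (x(i := 0)))) has_field_derivative
      f (x(i := 1)) - f (x(i := 0))) (at (x i))"
    by (auto intro!: derivative_eq_intros)
  then show ?thesis
    unfolding partial_deriv_def by (subst assms) (rule DERIV_imp_deriv)
qed

text \<open>For fixed other variables, \<open>f\<close> is a biaffine function \<open>e\<close> of
  the coordinates \<open>i\<close> and \<open>j\<close>. By the identity \<open>key\<close>, its
  Rayleigh difference is constant: it is minus the determinant of the 2 by 2 matrix of corner values
  of \<open>e\<close>.\<close>

lemma rayleigh_condition_iff:
  assumes f: "\<And>x i t. f (x(i := t)) = f (x(i := 0)) + t * (f (x(i := 1)) - f (x(i := 0)))" and "i \<noteq> j"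
  shows "f x * partial_deriv i (partial_deriv j f) x \<le> partial_deriv i f x * partial_deriv j f x \<longleftrightarrow>
    f (x(i := 0, j := 0)) * f (x(i := 1, j := 1)) \<le> f (x(i := 1, j := 0)) * f (x(i := 0, j := 1))"
proof -
  define p q where "p = x i" and "q = x j"
  define e where "e a b = f (x(i := a, j := b))" for a b
  have tw: "y(j := b, i := a) = y(i := a, j := b)" for y a b
    using \<open>i \<noteq> j\<close> by (simp add: fun_upd_twist)
  have e2: "e a t = e a 0 + t * (e a 1 - e a 0)" for a t
    unfolding e_def by (rule f)
  have e1: "e t b = e 0 b + t * (e 1 b - e 0 b)" for b t
    unfolding e_def tw[symmetric] by (rule f)
  have upd: "x(i := p) = x" "x(j := q) = x" by (simp_all add: p_def q_def)
  have fx: "f x = e p q" unfolding e_def upd ..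
  have fi: "f (x(i := a)) = e a q" for a
    unfolding e_def using \<open>i \<noteq> j\<close> by (metis fun_upd_twist upd(2))
  have fj: "f (x(j := b)) = e p b" for b
    unfolding e_def upd ..
  have di: "partial_deriv i f x = e 1 q - e 0 q"
    unfolding partial_deriv_affine[OF f] fi ..
  have dj: "partial_deriv j f = (\<lambda>y. f (y(j := 1)) - f (y(j := 0)))"
    by (rule ext) (rule partial_deriv_affine[OF f])
  have djf: "f (y(i := t, j := b)) = f (y(i := 0, j := b)) + t * (f (y(i := 1, j := b)) - f (y(i := 0, j := b)))"
    for y t b unfolding tw[symmetric] by (rule f)
  have dij: "partial_deriv i (partial_deriv j f) x = (e 1 1 - e 1 0) - (e 0 1 - e 0 0)"
    unfolding dj e_def
    by (rule partial_deriv_affine) (subst (1 2) djf, simp add: algebra_simps)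
  have djx: "partial_deriv j f x = e p 1 - e p 0" unfolding dj fj ..
  have key: "(e 1 q - e 0 q) * (e p 1 - e p 0) - e p q * ((e 1 1 - e 1 0) - (e 0 1 - e 0 0))
      = e 1 0 * e 0 1 - e 0 0 * e 1 1"
    unfolding e1[of p q] e1[of p 1] e1[of p 0] e2[of 0 q] e2[of 1 q] by algebra
  show ?thesis
    unfolding di djx dij fx using key unfolding e_def by linarith
qed

text \<open>At boundary points of the orthant the two-sided derivatives involve values of
  \<open>f\<close> that are not volumes. The corner form avoids this: it evaluates \<open>f\<close>
  only where it represents the volume.\<close>

lemma rayleigh_iff_exchange:
  "volume_polynomials_rayleigh TYPE('n::finite) m \<longleftrightarrow> volume_exchange_inequality TYPE('n) m"
proof -
  have iff: "rayleigh m f \<longleftrightarrow> (\<forall>x i j. (\<forall>k<m. 0 \<le> x k) \<and> i < m \<and> j < m \<and> i \<noteq> j \<longrightarrow>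
      volume_at m v (x(i := 0, j := 0)) * volume_at m v (x(i := 1, j := 1))
        \<le> volume_at m v (x(i := 1, j := 0)) * volume_at m v (x(i := 0, j := 1)))"
    if c: "\<forall>S. 0 \<le> c S" "f = homogeneous_multiaffine m d c" and rep: "represents_volume m v f"
    for f d c and v :: "nat \<Rightarrow> real ^ 'n"
  proof -
    have aff: "f (x(i := t)) = f (x(i := 0)) + t * (f (x(i := 1)) - f (x(i := 0)))" for x i t
      unfolding c(2) by (rule homogeneous_multiaffine_affine)
    have "f (x(i := a, j := b)) = volume_at m v (x(i := a, j := b))"
      if "\<forall>k<m. 0 \<le> x k" "0 \<le> a" "0 \<le> b" for x i j a b
      using rep that by (simp add: represents_volume_def segment_sum_eq)
    then have "(f x * partial_deriv i (partial_deriv j f) x \<le> partial_deriv i f x * partial_deriv j f x) \<longleftrightarrow>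
      volume_at m v (x(i := 0, j := 0)) * volume_at m v (x(i := 1, j := 1))
        \<le> volume_at m v (x(i := 1, j := 0)) * volume_at m v (x(i := 0, j := 1))"
      if "\<forall>k<m. 0 \<le> x k" "i \<noteq> j" for x i j
      using that unfolding rayleigh_condition_iff[OF aff that(2)] by simp
    moreover have "\<exists>d c. (\<forall>S. 0 \<le> c S) \<and> f = homogeneous_multiaffine m d c" using c by blast
    ultimately show ?thesis unfolding rayleigh_def by (simp cong: imp_cong conj_cong)
  qed
  show ?thesis
    unfolding volume_polynomials_rayleigh_def volume_exchange_inequality_def
  proof (intro all_cong1 iffI)
    fix v :: "nat \<Rightarrow> real ^ 'n"
    assume "\<exists>f. represents_volume m v f \<and> rayleigh m f"
    then obtain f d c where f: "represents_volume m v f" "rayleigh m f" and c: "\<forall>S. 0 \<le> c S" "f = homogeneous_multiaffine m d c"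
      unfolding rayleigh_def by blast
    show "\<forall>x i j. (\<forall>k<m. 0 \<le> x k) \<and> i < m \<and> j < m \<and> i \<noteq> j \<longrightarrow>
        volume_at m v (x(i := 0, j := 0)) * volume_at m v (x(i := 1, j := 1))
          \<le> volume_at m v (x(i := 1, j := 0)) * volume_at m v (x(i := 0, j := 1))"
      using iff[OF c f(1)] f(2) by (rule iffD1)
  next
    fix v :: "nat \<Rightarrow> real ^ 'n"
    assume *: "\<forall>x i j. (\<forall>k<m. 0 \<le> x k) \<and> i < m \<and> j < m \<and> i \<noteq> j \<longrightarrow>
        volume_at m v (x(i := 0, j := 0)) * volume_at m v (x(i := 1, j := 1))
          \<le> volume_at m v (x(i := 1, j := 0)) * volume_at m v (x(i := 0, j := 1))"
    obtain c where c: "\<And>S. 0 \<le> c S"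
      and rep: "represents_volume m v (homogeneous_multiaffine m DIM(real ^ 'n) c)"
      by (rule volume_polynomial_exists) (rule that)
    have "rayleigh m (homogeneous_multiaffine m DIM(real ^ 'n) c)"
      using iff[OF _ refl rep] c * by blast
    with rep show "\<exists>f. represents_volume m v f \<and> rayleigh m f" by blast
  qed
qed

text \<open>The local exchange inequality says that the ratios \<open>F (x + s e\<^sub>i) / F x\<close> decrease in every
  coordinate direction; moving along the coordinates one after the other gives the general case.\<close>

lemma exchange_imp_log_submodular:
  fixes F :: "(nat \<Rightarrow> real) \<Rightarrow> real"
  assumes I: "finite I" and nonneg: "\<And>x. 0 \<le> F x"
    and mono: "\<And>x i s. i \<in> I \<Longrightarrow> (\<And>k. k \<in> I \<Longrightarrow> 0 \<le> x k) \<Longrightarrow> 0 \<le> s \<Longrightarrow> F x \<le> F (x(i := x i + s))"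
    and aff: "\<And>x i t. i \<in> I \<Longrightarrow> 0 \<le> t \<Longrightarrow>
      F (x(i := t)) = F (x(i := 0)) + t * (F (x(i := 1)) - F (x(i := 0)))"
    and exch: "\<And>x i j. i \<in> I \<Longrightarrow> j \<in> I \<Longrightarrow> i \<noteq> j \<Longrightarrow> (\<And>k. k \<in> I \<Longrightarrow> 0 \<le> x k) \<Longrightarrow>
      F (x(i := 0, j := 0)) * F (x(i := 1, j := 1)) \<le> F (x(i := 1, j := 0)) * F (x(i := 0, j := 1))"
    and x: "\<And>k. k \<in> I \<Longrightarrow> 0 \<le> x k" and y: "\<And>k. k \<in> I \<Longrightarrow> 0 \<le> y k" and z: "\<And>k. k \<in> I \<Longrightarrow> 0 \<le> z k"
  shows "F x * F (\<lambda>k. x k + (if k \<in> I then y k else 0) + (if k \<in> I then z k else 0))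
    \<le> F (\<lambda>k. x k + (if k \<in> I then y k else 0)) * F (\<lambda>k. x k + (if k \<in> I then z k else 0))"
proof -
  define add where "add i s x = x(i := x i + s)" for i and s :: real and x :: "nat \<Rightarrow> real"
  have pair: "F x * F (add j t (add i s x)) \<le> F (add i s x) * F (add j t x)"
    if ij: "i \<in> I" "j \<in> I" and x: "\<And>k. k \<in> I \<Longrightarrow> 0 \<le> x k" and st: "0 \<le> s" "0 \<le> t" for x i j s t
  proof (cases "i = j")
    case True
    \<comment> \<open>On a single coordinate line the difference of the two sides is
      \<open>s * t * \<beta>\<^sup>2\<close>.\<close>
    define \<alpha> \<beta> p where "\<alpha> = F (x(i := 0))" and "\<beta> = F (x(i := 1)) - F (x(i := 0))" and "p = x i"
    have F: "F (x(i := r)) = \<alpha> + r * \<beta>" if "0 \<le> r" for r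
      unfolding \<alpha>_def \<beta>_def by (rule aff[OF ij(1) that])
    have "0 \<le> p" using x ij by (simp add: p_def)
    have "F x = \<alpha> + p * \<beta>" using F[OF \<open>0 \<le> p\<close>] by (simp add: p_def)
    moreover have "F (add i s x) = \<alpha> + (p + s) * \<beta>" "F (add j t x) = \<alpha> + (p + t) * \<beta>"
      using F[of "p + s"] F[of "p + t"] \<open>0 \<le> p\<close> st True by (simp_all add: add_def p_def)
    moreover have "F (add j t (add i s x)) = \<alpha> + (p + s + t) * \<beta>"
      using F[of "p + s + t"] \<open>0 \<le> p\<close> st True by (simp add: add_def p_def)
    moreover have "0 \<le> s * t * \<beta>\<^sup>2" using st by simp
    ultimately show ?thesis by (simp add: algebra_simps power2_eq_square)
  next
    case False
    define p q where "p = x i" and "q = x j"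
    have pq: "0 \<le> p" "0 \<le> q" using x ij by (simp_all add: p_def q_def)
    define e where "e a b = F (x(i := a, j := b))" for a b
    define \<alpha> \<beta> \<gamma> \<delta> where "\<alpha> = e 0 0" and "\<beta> = e 1 0 - e 0 0" and "\<gamma> = e 0 1 - e 0 0"
      and "\<delta> = e 1 1 - e 1 0 - e 0 1 + e 0 0"
    have tw: "y(j := b, i := a) = y(i := a, j := b)" for y :: "nat \<Rightarrow> real" and a b
      using False by (simp add: fun_upd_twist)
    have e2: "e a r = e a 0 + r * (e a 1 - e a 0)" if "0 \<le> r" for a r
      unfolding e_def by (rule aff[OF ij(2) that])
    have e1: "e r b = e 0 b + r * (e 1 b - e 0 b)" if "0 \<le> r" for r b
      unfolding e_def tw[symmetric] by (rule aff[OF ij(1) that])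
    have e: "e a b = \<alpha> + a * \<beta> + b * \<gamma> + a * b * \<delta>" if "0 \<le> a" "0 \<le> b" for a b
      unfolding e2[OF that(2), of a] e1[OF that(1), of 0] e1[OF that(1), of 1]
      by (simp add: \<alpha>_def \<beta>_def \<gamma>_def \<delta>_def algebra_simps)
    have "F x = e p q" by (simp add: e_def p_def q_def)
    moreover have "F (add i s x) = e (p + s) q" "F (add j t x) = e p (q + t)"
      using False by (simp_all add: e_def add_def p_def q_def fun_upd_idem)
    moreover have "F (add j t (add i s x)) = e (p + s) (q + t)"
      using False by (simp add: e_def add_def p_def q_def)
    moreover have "e p q * e (p + s) (q + t) \<le> e (p + s) q * e p (q + t)"
    proof -
      have "\<alpha> * (\<alpha> + \<beta> + \<gamma> + \<delta>) \<le> (\<alpha> + \<beta>) * (\<alpha> + \<gamma>)"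
        using exch[OF ij False x] by (simp add: \<alpha>_def \<beta>_def \<gamma>_def \<delta>_def e_def)
      then have "0 \<le> \<beta> * \<gamma> - \<alpha> * \<delta>" by (simp add: algebra_simps)
      then have "0 \<le> s * t * (\<beta> * \<gamma> - \<alpha> * \<delta>)" using st by simp
      moreover have "e (p + s) q * e p (q + t) - e p q * e (p + s) (q + t) = s * t * (\<beta> * \<gamma> - \<alpha> * \<delta>)"
        using pq st by (simp add: e) algebra
      ultimately show ?thesis by linarith
    qed
    ultimately show ?thesis by simp
  qed
  define plus where "plus J z x = (\<lambda>k. x k + (if k \<in> J then z k else 0))" for J and z x :: "nat \<Rightarrow> real"
  have plus_insert: "plus (insert j J) z x = add j (z j) (plus J z x)" if "j \<notin> J" for j J z x
    using that by (auto simp: plus_def add_def)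
  have plus_add: "plus J z (add j t x) = add j t (plus J z x)" for J z j t x
    by (auto simp: plus_def add_def)
  have plus_nonneg: "0 \<le> plus J z x k"
    if "k \<in> I" "\<And>k. k \<in> I \<Longrightarrow> 0 \<le> z k" "\<And>k. k \<in> I \<Longrightarrow> 0 \<le> x k" for J z x k
    using that by (simp add: plus_def)
  have plus_mono: "F x \<le> F (plus J z x)"
    if "J \<subseteq> I" "\<And>k. k \<in> I \<Longrightarrow> 0 \<le> z k" "\<And>k. k \<in> I \<Longrightarrow> 0 \<le> x k" for J z x
    using finite_subset[OF that(1) I] that(1)
  proof (induction J)
    case (insert j J)
    have "F x \<le> F (plus J z x)" using insert by simp
    also have "\<dots> \<le> F (add j (z j) (plus J z x))"
      unfolding add_def using insert.prems that by (intro mono plus_nonneg) auto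
    finally show ?case using insert.hyps by (simp add: plus_insert)
  qed (simp add: plus_def)
  \<comment> \<open>The inequalities for consecutive points are multiplied and the common factor
    \<open>F ?X\<close> is cancelled. It is positive because \<open>F\<close> is monotone and
    \<open>F x\<close> is positive; for \<open>F x = 0\<close> the final claim is trivial.\<close>
  have step: "F x * F (add i s (plus J z x)) \<le> F (add i s x) * F (plus J z x)"
    if "J \<subseteq> I" and i: "i \<in> I" "0 \<le> s" and x: "\<And>k. k \<in> I \<Longrightarrow> 0 \<le> x k" and z: "\<And>k. k \<in> I \<Longrightarrow> 0 \<le> z k"
      and pos: "0 < F x" for x z i s J
    using finite_subset[OF that(1) I] that(1)
  proof (induction J)
    case (insert j J)
    let ?X = "plus J z x"
    have X: "0 < F ?X" using plus_mono[OF _ z x, of J] insert.prems pos by force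
    have "F ?X * F (add i s (add j (z j) ?X)) \<le> F (add j (z j) ?X) * F (add i s ?X)"
      using insert.prems i z x by (intro pair plus_nonneg) auto
    then have "F x * (F ?X * F (add i s (add j (z j) ?X))) \<le> F x * (F (add j (z j) ?X) * F (add i s ?X))"
      using pos by (intro mult_left_mono) auto
    also have "\<dots> = F (add j (z j) ?X) * (F x * F (add i s ?X))" by (simp only: mult_ac)
    also have "\<dots> \<le> F (add j (z j) ?X) * (F (add i s x) * F ?X)"
      using insert nonneg by (intro mult_left_mono) auto
    finally have "F ?X * (F x * F (add i s (add j (z j) ?X))) \<le> F ?X * (F (add i s x) * F (add j (z j) ?X))"
      by (simp only: mult_ac)
    then show ?case using X insert.hyps by (simp add: plus_insert)
  qed (simp add: plus_def)
  \<comment> \<open>The same chaining once more, now along the coordinates of \<open>y\<close>, with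
    \<open>step\<close> handling the whole of \<open>z\<close> at once.\<close>
  have "F x * F (plus I z (plus J y x)) \<le> F (plus J y x) * F (plus I z x)" if "J \<subseteq> I" "0 < F x" for J
    using finite_subset[OF that(1) I] that(1)
  proof (induction J)
    case (insert j J)
    let ?X = "plus J y x"
    have X: "0 < F ?X" using plus_mono[OF _ y x, of J] insert.prems that by force
    have "F ?X * F (add j (y j) (plus I z ?X)) \<le> F (add j (y j) ?X) * F (plus I z ?X)"
      using insert.prems y z x X by (intro step plus_nonneg) auto
    then have "F x * (F ?X * F (add j (y j) (plus I z ?X))) \<le> F x * (F (add j (y j) ?X) * F (plus I z ?X))"
      using that by (intro mult_left_mono) auto
    also have "\<dots> = F (add j (y j) ?X) * (F x * F (plus I z ?X))" by (simp only: mult_ac)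
    also have "\<dots> \<le> F (add j (y j) ?X) * (F ?X * F (plus I z x))"
      using insert nonneg by (intro mult_left_mono) auto
    finally have "F ?X * (F x * F (add j (y j) (plus I z ?X))) \<le> F ?X * (F (add j (y j) ?X) * F (plus I z x))"
      by (simp only: mult_ac)
    then show ?case using X insert.hyps by (simp add: plus_insert plus_add)
  qed (simp add: plus_def)
  from this[of I] nonneg show ?thesis
    by (cases "F x = 0") (auto simp: plus_def less_le)
qed

section \<open>Implications between the conditions\<close>

lemma translate_plus_translate:
  fixes a b :: "'a::ab_group_add"
  shows "(+) a ` S + (+) b ` T = (+) (a + b) ` (S + T)"
proof (intro equalityI subsetI)
  fix x assume "x \<in> (+) a ` S + (+) b ` T"
  then obtain s t where st: "s \<in> S" "t \<in> T" "x = (a + s) + (b + t)" by (auto simp: set_plus_def)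
  then have "x = (a + b) + (s + t)" by (simp add: algebra_simps)
  with st show "x \<in> (+) (a + b) ` (S + T)" by (blast intro: set_plus_intro)
next
  fix x assume "x \<in> (+) (a + b) ` (S + T)"
  then obtain s t where st: "s \<in> S" "t \<in> T" "x = (a + b) + (s + t)" by (auto simp: set_plus_def)
  then have x: "x = (a + s) + (b + t)" by (simp add: algebra_simps)
  show "x \<in> (+) a ` S + (+) b ` T" unfolding x using st(1,2) by (intro set_plus_intro imageI)
qed

lemma zonotope_generated_by_iff:
  "zonotope_generated_by k v A \<longleftrightarrow> (\<exists>a x. (\<forall>i<k. 0 \<le> x i) \<and> A = (+) a ` zonotope_sum {..<k} v x)"
  by (simp add: zonotope_generated_by_def segment_sum_eq)

lemma zonotope_generated_by_zonotope_sum: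
  "(\<And>i. i < k \<Longrightarrow> 0 \<le> x i) \<Longrightarrow> zonotope_generated_by k v (zonotope_sum {..<k} v x)"
  unfolding zonotope_generated_by_iff by (intro exI[of _ 0] exI[of _ x]) simp

lemma zonotope_generated_by_compact_convex:
  fixes v :: "nat \<Rightarrow> 'a::euclidean_space"
  assumes "zonotope_generated_by k v A"
  shows "compact A" "convex A"
  using assms
  by (auto simp: zonotope_generated_by_iff intro: compact_translation convex_translation
      compact_zonotope_sum convex_zonotope_sum)

lemma zonotope_sum_lessThan_Suc:
  "zonotope_sum {..<Suc k} v x = zonotope_sum {..<k} v x + closed_segment 0 (x k *\<^sub>R v k)"
  by (simp add: zonotope_sum_def lessThan_Suc add.commute)

text \<open>The new generator enters with coefficient 0. Together with the next lemma this puts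
  \<open>A\<close> and the segment of \<open>u\<close> into one generating family, at the price of
  one generator; this accounts for the counts \<open>m - 1\<close> and \<open>m - 2\<close>.\<close>

lemma zonotope_generated_by_Suc:
  assumes "zonotope_generated_by k v A"
  shows "zonotope_generated_by (Suc k) (v(k := u)) A"
proof -
  obtain a x where x: "\<forall>i<k. 0 \<le> x i" "A = (+) a ` zonotope_sum {..<k} v x"
    using assms by (auto simp: zonotope_generated_by_iff)
  have "zonotope_sum {..<k} (v(k := u)) (x(k := 0)) = zonotope_sum {..<k} v x"
    by (rule zonotope_sum_cong) simp
  then have "zonotope_sum {..<Suc k} (v(k := u)) (x(k := 0)) = zonotope_sum {..<k} v x"
    by (simp add: zonotope_sum_lessThan_Suc)
  moreover have "\<forall>i<Suc k. 0 \<le> (x(k := 0)) i" using x(1) by (simp add: less_Suc_eq)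
  ultimately show ?thesis unfolding zonotope_generated_by_iff using x(2) by metis
qed

lemma zonotope_generated_by_Suc_segment:
  "zonotope_generated_by (Suc k) (v(k := u)) (closed_segment 0 u)"
proof -
  let ?x = "\<lambda>i. if i = k then 1 else 0 :: real"
  have "zonotope_sum {..<k} (v(k := u)) ?x = 0"
    unfolding zonotope_sum_def by (intro sum.neutral) auto
  then have "zonotope_sum {..<Suc k} (v(k := u)) ?x = closed_segment 0 u"
    by (simp add: zonotope_sum_lessThan_Suc)
  then show ?thesis using zonotope_generated_by_zonotope_sum[of "Suc k" ?x "v(k := u)"] by simp
qed

text \<open>With common generators, Minkowski addition adds coefficient vectors and translations do
  not affect volume. The claim becomes log-submodularity of the volume as a function of the
  coefficients.\<close>

lemma exchange_imp_zonotope_inequality: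
  assumes "volume_exchange_inequality TYPE('n::finite) m"
  shows "zonotope_volume_inequality TYPE('n) m"
  unfolding zonotope_volume_inequality_def
proof (intro allI impI, elim conjE)
  fix v :: "nat \<Rightarrow> real ^ 'n" and A B C :: "(real ^ 'n) set"
  assume "zonotope_generated_by m v A" "zonotope_generated_by m v B" "zonotope_generated_by m v C"
  then obtain a x b y c z where x: "\<And>i. i < m \<Longrightarrow> 0 \<le> x i" "A = (+) a ` zonotope_sum {..<m} v x"
    and y: "\<And>i. i < m \<Longrightarrow> 0 \<le> y i" "B = (+) b ` zonotope_sum {..<m} v y"
    and z: "\<And>i. i < m \<Longrightarrow> 0 \<le> z i" "C = (+) c ` zonotope_sum {..<m} v z"
    unfolding zonotope_generated_by_iff by blast
  have sum: "zonotope_sum {..<m} v x' + zonotope_sum {..<m} v y'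
      = zonotope_sum {..<m} v (\<lambda>k. x' k + (if k \<in> {..<m} then y' k else 0))"
    if "\<And>i. i < m \<Longrightarrow> 0 \<le> x' i" "\<And>i. i < m \<Longrightarrow> 0 \<le> y' i" for x' y'
  proof -
    have "zonotope_sum {..<m} v x' + zonotope_sum {..<m} v y' = zonotope_sum {..<m} v (\<lambda>k. x' k + y' k)"
      by (rule zonotope_sum_add) (use that in auto)
    also have "\<dots> = zonotope_sum {..<m} v (\<lambda>k. x' k + (if k \<in> {..<m} then y' k else 0))"
      by (rule zonotope_sum_cong) simp
    finally show ?thesis .
  qed
  have "volume_at m v x * volume_at m v (\<lambda>k. x k + (if k \<in> {..<m} then y k else 0) + (if k \<in> {..<m} then z k else 0))
    \<le> volume_at m v (\<lambda>k. x k + (if k \<in> {..<m} then y k else 0)) * volume_at m v (\<lambda>k. x k + (if k \<in> {..<m} then z k else 0))"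
  proof (rule exchange_imp_log_submodular)
    fix x :: "nat \<Rightarrow> real" and i and s :: real
    assume i: "i \<in> {..<m}" and x: "\<And>k. k \<in> {..<m} \<Longrightarrow> 0 \<le> x k" and s: "0 \<le> s"
    have "zonotope_sum ({..<m} - {i}) v (x(i := x i + s)) = zonotope_sum ({..<m} - {i}) v x"
      by (rule zonotope_sum_cong) simp
    then have "zonotope_sum {..<m} v (x(i := x i + s)) = zonotope_sum {..<m} v x + closed_segment 0 (s *\<^sub>R v i)"
      using i x s by (simp add: zonotope_sum_remove[of "{..<m}" i] segment_plus_segment add.assoc)
    then show "volume_at m v x \<le> volume_at m v (x(i := x i + s))"
      using measure_plus_ge[OF compact_zonotope_sum compact_segment, of 0 0 "s *\<^sub>R v i"] by simp
  next
    fix x :: "nat \<Rightarrow> real" and i j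
    assume "i \<in> {..<m}" "j \<in> {..<m}" "i \<noteq> j" "\<And>k. k \<in> {..<m} \<Longrightarrow> 0 \<le> x k"
    then show "volume_at m v (x(i := 0, j := 0)) * volume_at m v (x(i := 1, j := 1))
        \<le> volume_at m v (x(i := 1, j := 0)) * volume_at m v (x(i := 0, j := 1))"
      using assms unfolding volume_exchange_inequality_def by blast
  next
    fix x :: "nat \<Rightarrow> real" and i and t :: real
    assume "i \<in> {..<m}" "0 \<le> t"
    then show "volume_at m v (x(i := t)) = volume_at m v (x(i := 0))
        + t * (volume_at m v (x(i := 1)) - volume_at m v (x(i := 0)))"
      by (intro measure_zonotope_sum_affine) auto
  qed (use x y z in auto)
  then show "measure lebesgue A * measure lebesgue (A + B + C) \<le> measure lebesgue (A + B) * measure lebesgue (A + C)"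
    using x y z by (simp only: translate_plus_translate measure_translation) (simp add: sum)
qed

text \<open>Here \<open>C\<close> is the segment of \<open>u\<close>. Subtracting |A| |A+B| from
  both sides turns the volumes with \<open>u\<close> added into projection volumes.\<close>

lemma zonotope_inequality_imp_ratio_monotone:
  assumes "zonotope_volume_inequality TYPE('n::finite) m" "0 < m"
  shows "projection_ratio_monotone TYPE('n) (m - 1)"
  unfolding projection_ratio_monotone_def
proof (intro allI impI, elim conjE)
  fix v :: "nat \<Rightarrow> real ^ 'n" and A B and u :: "real ^ 'n"
  assume AB: "zonotope_generated_by (m - 1) v A" "zonotope_generated_by (m - 1) v B"
    and dim: "aff_dim A = int CARD('n)" and "u \<in> sphere 0 1"
  then have u: "norm u = 1" by simp
  let ?V = "measure lebesgue" and ?U = "closed_segment 0 u"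
  have cA: "compact A" "convex A" and cB: "compact B" "convex B"
    using AB by (auto dest: zonotope_generated_by_compact_convex)
  then have cAB: "compact (A + B)" "convex (A + B)" by (auto intro: compact_set_plus convex_set_plus)
  have "B \<noteq> {}"
    using AB(2) zero_mem_zonotope_sum unfolding zonotope_generated_by_iff by (metis empty_iff image_is_empty)
  then have "?V A \<le> ?V (A + B)" using measure_plus_ge[OF cA(1) cB(1)] by blast
  moreover have pA: "0 < ?V A" using measure_pos_iff_aff_dim[OF cA] dim by simp
  ultimately have pAB: "0 < ?V (A + B)" by simp
  have "Suc (m - 1) = m" using assms(2) by simp
  then have "zonotope_generated_by m (v(m - 1 := u)) A" "zonotope_generated_by m (v(m - 1 := u)) B"
    "zonotope_generated_by m (v(m - 1 := u)) ?U"
    using zonotope_generated_by_Suc[OF AB(1), of u] zonotope_generated_by_Suc[OF AB(2), of u]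
      zonotope_generated_by_Suc_segment[of "m - 1" v u] by simp_all
  then have "?V A * ?V (A + B + ?U) \<le> ?V (A + B) * ?V (A + ?U)"
    using assms(1) unfolding zonotope_volume_inequality_def by blast
  then have "?V A * (?V (A + B + ?U) - ?V (A + B)) \<le> ?V (A + B) * (?V (A + ?U) - ?V A)"
    by (simp add: algebra_simps)
  then have "?V A / (?V (A + ?U) - ?V A) \<le> ?V (A + B) / (?V (A + B + ?U) - ?V (A + B))"
    using measure_plus_segment_strict[OF cA pA u] measure_plus_segment_strict[OF cAB pAB u]
    by (simp add: field_simps)
  then show "?V A / hausdorff_volume (CARD('n) - 1) (orth_proj ({u}\<^sup>\<bottom>) ` A)
      \<le> ?V (A + B) / hausdorff_volume (CARD('n) - 1) (orth_proj ({u}\<^sup>\<bottom>) ` (A + B))"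
    unfolding hausdorff_volume_orth_proj_perp[OF u cA] hausdorff_volume_orth_proj_perp[OF u cAB] .
qed

text \<open>Here \<open>B\<close> and \<open>C\<close> are the segments of \<open>u\<close> and
  \<open>w\<close>. Once projections are written as differences, all terms of (d) cancel except
  those of (b). An orthonormal pair forces \<open>m\<close> to be at least 2, so
  \<open>m - 2\<close> is not truncated.\<close>

lemma zonotope_inequality_imp_projection_product:
  assumes "zonotope_volume_inequality TYPE('n::finite) m" "CARD('n) \<le> m"
  shows "projection_product_inequality TYPE('n) (m - 2)"
  unfolding projection_product_inequality_def
proof (intro allI impI, elim conjE)
  fix v :: "nat \<Rightarrow> real ^ 'n" and A and u w :: "real ^ 'n"
  assume A: "zonotope_generated_by (m - 2) v A" and "u \<in> sphere 0 1" "w \<in> sphere 0 1"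
    and orth: "orthogonal u w"
  then have u: "norm u = 1" and w: "norm w = 1" by simp_all
  let ?V = "measure lebesgue" and ?U = "closed_segment 0 u" and ?W = "closed_segment 0 w"
  note cA = zonotope_generated_by_compact_convex[OF A]
  have "Suc (Suc (m - 2)) = m" using CARD_ge_2_of_orthonormal[OF u w orth] assms(2) by simp
  moreover define v' where "v' = v(m - 2 := u, Suc (m - 2) := w)"
  ultimately have "zonotope_generated_by m v' A" "zonotope_generated_by m v' ?U" "zonotope_generated_by m v' ?W"
    using zonotope_generated_by_Suc[OF zonotope_generated_by_Suc[OF A, of u], of w]
      zonotope_generated_by_Suc[OF zonotope_generated_by_Suc_segment[of "m - 2" v u], of w]
      zonotope_generated_by_Suc_segment[of "Suc (m - 2)" "v(m - 2 := u)" w]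
    by simp_all
  then have "?V A * ?V (A + ?U + ?W) \<le> ?V (A + ?U) * ?V (A + ?W)"
    using assms(1) unfolding zonotope_volume_inequality_def by blast
  then show "?V A * hausdorff_volume (CARD('n) - 2) (orth_proj ({u, w}\<^sup>\<bottom>) ` A)
      \<le> hausdorff_volume (CARD('n) - 1) (orth_proj ({u}\<^sup>\<bottom>) ` A)
        * hausdorff_volume (CARD('n) - 1) (orth_proj ({w}\<^sup>\<bottom>) ` A)"
    unfolding hausdorff_volume_orth_proj_perp[OF u cA] hausdorff_volume_orth_proj_perp[OF w cA]
      hausdorff_volume_orth_proj_perp2[OF u w orth cA]
    by (simp add: algebra_simps)
qed

definition adjoined_segments_inequality :: "'n::finite itself \<Rightarrow> nat \<Rightarrow> bool" where
  "adjoined_segments_inequality _ k \<longleftrightarrow>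
     (\<forall>(v :: nat \<Rightarrow> real ^ 'n) x p q. (\<forall>i<k. 0 \<le> x i) \<longrightarrow>
        volume_at k v x * measure lebesgue (zonotope_sum {..<k} v x + closed_segment 0 p + closed_segment 0 q)
          \<le> measure lebesgue (zonotope_sum {..<k} v x + closed_segment 0 p)
            * measure lebesgue (zonotope_sum {..<k} v x + closed_segment 0 q))"

text \<open>The generators \<open>i\<close> and \<open>j\<close> become the segments
  \<open>p\<close> and \<open>q\<close>; the bijection \<open>g\<close> renumbers the others. For
  \<open>m < 2\<close> there is no pair of distinct indices, hence the guarded hypothesis.\<close>

lemma adjoined_segments_imp_exchange:
  assumes "2 \<le> m \<Longrightarrow> adjoined_segments_inequality TYPE('n::finite) (m - 2)"
  shows "volume_exchange_inequality TYPE('n) m"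
  unfolding volume_exchange_inequality_def
proof (intro allI impI, elim conjE)
  fix v :: "nat \<Rightarrow> real ^ 'n" and x :: "nat \<Rightarrow> real" and i j
  assume x: "\<forall>k<m. 0 \<le> x k" and ij: "i < m" "j < m" "i \<noteq> j"
  define J where "J = {..<m} - {i} - {j}"
  have "card J = m - 2" using ij by (simp add: J_def)
  then obtain g where g: "bij_betw g {..<m - 2} J"
    using ex_bij_betw_nat_finite[of J] by (auto simp: J_def atLeast0LessThan)
  have split: "zonotope_sum {..<m} v (x(i := a, j := b))
    = zonotope_sum {..<m - 2} (v \<circ> g) (x \<circ> g) + closed_segment 0 (a *\<^sub>R v i) + closed_segment 0 (b *\<^sub>R v j)"
    for a b
  proof -
    have "zonotope_sum J v (x(i := a, j := b)) = zonotope_sum J v x"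
      by (rule zonotope_sum_cong) (simp add: J_def)
    also have "\<dots> = zonotope_sum {..<m - 2} (v \<circ> g) (x \<circ> g)"
      unfolding zonotope_sum_def using g by (simp add: sum.reindex_bij_betw[symmetric])
    finally show ?thesis
      using ij by (simp add: zonotope_sum_remove[of "{..<m}" i] zonotope_sum_remove[of "{..<m} - {i}" j]
          J_def[symmetric] add_ac)
  qed
  have "\<forall>k<m - 2. 0 \<le> (x \<circ> g) k"
    using x bij_betwE[OF g] by (auto simp: J_def)
  moreover have "adjoined_segments_inequality TYPE('n) (m - 2)" using assms ij by linarith
  ultimately show "volume_at m v (x(i := 0, j := 0)) * volume_at m v (x(i := 1, j := 1))
      \<le> volume_at m v (x(i := 1, j := 0)) * volume_at m v (x(i := 0, j := 1))"
    unfolding split adjoined_segments_inequality_def by simp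
qed

text \<open>The ratio inequality is applied to the segment of \<open>q\<close> as \<open>B\<close>
  and to the direction of \<open>p\<close>; the length of \<open>p\<close> is restored by scaling.
  If \<open>p = 0\<close> or \<open>A\<close> has volume zero, the claim is immediate.\<close>

lemma ratio_monotone_imp_adjoined_segments:
  assumes c: "projection_ratio_monotone TYPE('n::finite) (m - 1)" and "2 \<le> m"
  shows "adjoined_segments_inequality TYPE('n) (m - 2)"
  unfolding adjoined_segments_inequality_def
proof (intro allI impI)
  fix v :: "nat \<Rightarrow> real ^ 'n" and x :: "nat \<Rightarrow> real" and p q :: "real ^ 'n"
  assume x: "\<forall>i<m - 2. 0 \<le> x i"
  let ?V = "measure lebesgue"
  define A where "A = zonotope_sum {..<m - 2} v x"
  define u where "u = p /\<^sub>R norm p"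
  let ?U = "closed_segment 0 u" and ?P = "closed_segment 0 p" and ?Q = "closed_segment 0 q"
  have cA: "compact A" "convex A" by (simp_all add: A_def compact_zonotope_sum convex_zonotope_sum)
  then have cAQ: "compact (A + ?Q)" "convex (A + ?Q)"
    by (auto intro: compact_set_plus convex_set_plus)
  have "?V A * ?V (A + ?P + ?Q) \<le> ?V (A + ?P) * ?V (A + ?Q)"
  proof (cases "p = 0 \<or> ?V A = 0")
    case False
    then have "p \<noteq> 0" and pA: "0 < ?V A" by (auto simp: less_le)
    then have u: "norm u = 1" by (simp add: u_def)
    have pAQ: "0 < ?V (A + ?Q)"
      using measure_plus_ge[OF cA(1) compact_segment, of 0 0 q] pA by simp
    have "Suc (m - 2) = m - 1" using assms(2) by simp
    then have "zonotope_generated_by (m - 1) (v(m - 2 := q)) A" "zonotope_generated_by (m - 1) (v(m - 2 := q)) ?Q"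
      using zonotope_generated_by_Suc[OF zonotope_generated_by_zonotope_sum, of "m - 2" x v q] x
        zonotope_generated_by_Suc_segment[of "m - 2" v q] by (simp_all add: A_def)
    moreover have "aff_dim A = int CARD('n)" using measure_pos_iff_aff_dim[OF cA] pA by simp
    moreover have "u \<in> sphere 0 1" using u by simp
    ultimately have "?V A / hausdorff_volume (CARD('n) - 1) (orth_proj ({u}\<^sup>\<bottom>) ` A)
        \<le> ?V (A + ?Q) / hausdorff_volume (CARD('n) - 1) (orth_proj ({u}\<^sup>\<bottom>) ` (A + ?Q))"
      using c unfolding projection_ratio_monotone_def by blast
    then have "?V A / (?V (A + ?U) - ?V A) \<le> ?V (A + ?Q) / (?V (A + ?Q + ?U) - ?V (A + ?Q))"
      unfolding hausdorff_volume_orth_proj_perp[OF u cA] hausdorff_volume_orth_proj_perp[OF u cAQ] .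
    then have "?V A * ?V (A + ?U + ?Q) \<le> ?V (A + ?U) * ?V (A + ?Q)"
      using measure_plus_segment_strict[OF cA pA u] measure_plus_segment_strict[OF cAQ pAQ u]
      by (simp add: field_simps)
    from plus_segments_inequality_scaleR[OF cA this, of "norm p" 1] \<open>p \<noteq> 0\<close> show ?thesis
      by (simp add: u_def)
  qed (auto simp: set_zero)
  then show "?V A * ?V (A + ?P + ?Q) \<le> ?V (A + ?P) * ?V (A + ?Q)" .
qed

text \<open>The inequality is invariant under injective linear maps, which multiply all volumes by
  one factor and preserve the number of generators. It may thus be transported to a position where
  the two segments are orthogonal.\<close>

lemma projection_product_imp_adjoined_segments:
  assumes d: "projection_product_inequality TYPE('n::finite) k"
  shows "adjoined_segments_inequality TYPE('n) k"
  unfolding adjoined_segments_inequality_def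
proof (intro allI impI)
  fix v :: "nat \<Rightarrow> real ^ 'n" and x :: "nat \<Rightarrow> real" and p q :: "real ^ 'n"
  assume x: "\<forall>i<k. 0 \<le> x i"
  let ?V = "measure lebesgue" and ?S = "closed_segment 0"
  define A where "A = zonotope_sum {..<k} v x"
  have cA: "compact A" "convex A" by (simp_all add: A_def compact_zonotope_sum convex_zonotope_sum)
  define w where "w = q - ((q \<bullet> p) / (p \<bullet> p)) *\<^sub>R p"
  have "?V A * ?V (A + ?S p + ?S q) \<le> ?V (A + ?S p) * ?V (A + ?S q)"
  proof (cases "p = 0 \<or> ?V A = 0 \<or> w = 0")
    case True
    \<comment> \<open>Here \<open>q\<close> is parallel to \<open>p\<close>, and the claim reduces
      to \<alpha> (\<alpha> + 2 \<beta>) \<le> (\<alpha> + \<beta>)^2. In dimension one, where (d)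
      is vacuous, this occurs whenever \<open>p\<close> is nonzero.\<close>
    have "?V A * ?V (A + ?S p + ?S q) \<le> ?V (A + ?S p) * ?V (A + ?S q)" if "w = 0"
    proof -
      define \<alpha> \<beta> where "\<alpha> = ?V A" and "\<beta> = ?V (A + ?S p) - \<alpha>"
      have "A + ?S p + ?S p = A + ?S (2 *\<^sub>R p)"
        using segment_plus_segment[of 1 1 p] by (simp add: add.assoc)
      then have 2: "?V (A + ?S p + ?S p) = \<alpha> + 2 * \<beta>"
        using measure_plus_segment_scaleR[OF cA, of 2 p] by (simp add: \<alpha>_def \<beta>_def)
      have 1: "?V (A + ?S p) = \<alpha> + \<beta>" by (simp add: \<beta>_def)
      have "\<alpha> * (\<alpha> + 2 * \<beta>) \<le> (\<alpha> + \<beta>) * (\<alpha> + \<beta>)"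
        using zero_le_square[of \<beta>] by (simp add: algebra_simps)
      then have "?V A * ?V (A + ?S p + ?S p) \<le> ?V (A + ?S p) * ?V (A + ?S p)"
        unfolding 1 2 \<alpha>_def[symmetric] .
      from plus_segments_inequality_scaleR[OF cA this, of 1 "(q \<bullet> p) / (p \<bullet> p)"] that
      show ?thesis by (simp add: w_def)
    qed
    then show ?thesis using True by (auto simp: set_zero)
  next
    case False
    then have "p \<noteq> 0" "w \<noteq> 0" and pA: "0 < ?V A" by (auto simp: less_le)
    \<comment> \<open>The coefficient is normalized so that \<open>q\<close>, whose inner product
      with \<open>w\<close> equals that of \<open>w\<close> with itself, loses exactly its component
      along \<open>p\<close>. The vector \<open>p\<close>, orthogonal to \<open>w\<close>, stays
      fixed.\<close>
    define T where "T x = x - (x \<bullet> (((q \<bullet> p) / (p \<bullet> p) / (w \<bullet> w)) *\<^sub>R w)) *\<^sub>R p" for x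
    have lin: "linear T" unfolding T_def by (rule linear_shear)
    have pw: "p \<bullet> w = 0" using \<open>p \<noteq> 0\<close> by (simp add: w_def inner_diff_right inner_commute)
    have "q = w + ((q \<bullet> p) / (p \<bullet> p)) *\<^sub>R p" by (simp add: w_def)
    then have "q \<bullet> w = w \<bullet> w" using pw by (metis add.right_neutral inner_add_left inner_scaleR_left mult_zero_right)
    then have Tq: "T q = w" using \<open>w \<noteq> 0\<close> by (simp add: T_def) (simp add: w_def)
    have Tp: "T p = p" by (simp add: T_def pw)
    have "inj T"
    proof (rule linear_injective_0[OF lin, THEN iffD2], intro allI impI)
      fix y assume "T y = 0"
      then have y: "y = (y \<bullet> (((q \<bullet> p) / (p \<bullet> p) / (w \<bullet> w)) *\<^sub>R w)) *\<^sub>R p" by (simp add: T_def)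
      have "y \<bullet> w = 0" by (subst y) (simp add: pw)
      with y show "y = 0" by simp
    qed
    then obtain \<kappa> where \<kappa>: "0 < \<kappa>" "\<And>S. compact S \<Longrightarrow> ?V (T ` S) = \<kappa> * ?V S"
      using measure_linear_inj_image[OF lin] by blast
    have TS: "T ` ?S y = ?S (T y)" for y
      using closed_segment_linear_image[OF lin, of 0 y] by (simp add: linear_0[OF lin])
    define u' w' where "u' = p /\<^sub>R norm p" and "w' = w /\<^sub>R norm w"
    have n: "norm u' = 1" "norm w' = 1" and orth: "orthogonal u' w'"
      using \<open>p \<noteq> 0\<close> \<open>w \<noteq> 0\<close> pw by (simp_all add: u'_def w'_def orthogonal_def)
    have cT: "compact (T ` A)" "convex (T ` A)"
      by (auto intro: compact_linear_image convex_linear_image lin cA)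
    have "zonotope_generated_by k (T \<circ> v) (T ` A)"
      unfolding A_def linear_image_zonotope_sum[OF lin]
      using x by (intro zonotope_generated_by_zonotope_sum) auto
    moreover have "aff_dim (T ` A) = int CARD('n)"
      using measure_pos_iff_aff_dim[OF cT] \<kappa> pA cA by simp
    moreover have "u' \<in> sphere 0 1" "w' \<in> sphere 0 1" using n by simp_all
    ultimately have "?V (T ` A) * hausdorff_volume (CARD('n) - 2) (orth_proj ({u', w'}\<^sup>\<bottom>) ` T ` A)
        \<le> hausdorff_volume (CARD('n) - 1) (orth_proj ({u'}\<^sup>\<bottom>) ` T ` A)
          * hausdorff_volume (CARD('n) - 1) (orth_proj ({w'}\<^sup>\<bottom>) ` T ` A)"
      using d orth unfolding projection_product_inequality_def by blast
    then have "?V (T ` A) * ?V (T ` A + ?S u' + ?S w') \<le> ?V (T ` A + ?S u') * ?V (T ` A + ?S w')"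
      unfolding hausdorff_volume_orth_proj_perp[OF n(1) cT] hausdorff_volume_orth_proj_perp[OF n(2) cT]
        hausdorff_volume_orth_proj_perp2[OF n orth cT]
      by (simp add: algebra_simps)
    from plus_segments_inequality_scaleR[OF cT this, of "norm p" "norm w"] \<open>p \<noteq> 0\<close> \<open>w \<noteq> 0\<close>
    have "?V (T ` A) * ?V (T ` A + ?S p + ?S w) \<le> ?V (T ` A + ?S p) * ?V (T ` A + ?S w)"
      by (simp add: u'_def w'_def)
    then have "?V (T ` A) * ?V (T ` (A + ?S p + ?S q)) \<le> ?V (T ` (A + ?S p)) * ?V (T ` (A + ?S q))"
      by (simp add: linear_image_set_plus[OF lin] TS Tp Tq)
    \<comment> \<open>Both sides are products of two volumes, so each acquires the same
      factor.\<close>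
    then have "\<kappa>\<^sup>2 * (?V A * ?V (A + ?S p + ?S q)) \<le> \<kappa>\<^sup>2 * (?V (A + ?S p) * ?V (A + ?S q))"
      using cA by (simp add: \<kappa>(2) compact_set_plus power2_eq_square mult_ac)
    then show ?thesis using \<kappa>(1) by simp
  qed
  then show "?V A * ?V (A + ?S p + ?S q) \<le> ?V (A + ?S p) * ?V (A + ?S q)" .
qed

theorem proposition5:
  fixes m :: nat
  assumes "CARD('n::finite) \<le> m"
  shows
    "(volume_polynomials_rayleigh TYPE('n) m \<longleftrightarrow> zonotope_volume_inequality TYPE('n) m) \<and>
     (zonotope_volume_inequality TYPE('n) m \<longleftrightarrow> projection_ratio_monotone TYPE('n) (m - 1)) \<and>
     (projection_ratio_monotone TYPE('n) (m - 1) \<longleftrightarrow> projection_product_inequality TYPE('n) (m - 2))"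
proof -
  have "0 < m" using assms zero_less_card_finite[where 'a='n] by linarith
  \<comment> \<open>Two cycles suffice, one through (c) and one through (d), both returning to (b)
    by way of the exchange inequality, which stands for (a).\<close>
  then have b_imp: "zonotope_volume_inequality TYPE('n) m \<Longrightarrow> projection_ratio_monotone TYPE('n) (m - 1)"
    "zonotope_volume_inequality TYPE('n) m \<Longrightarrow> projection_product_inequality TYPE('n) (m - 2)"
    using zonotope_inequality_imp_ratio_monotone zonotope_inequality_imp_projection_product assms by blast+
  have ratio: "projection_ratio_monotone TYPE('n) (m - 1) \<Longrightarrow> volume_exchange_inequality TYPE('n) m"
    using ratio_monotone_imp_adjoined_segments adjoined_segments_imp_exchange by blast
  have product: "projection_product_inequality TYPE('n) (m - 2) \<Longrightarrow> volume_exchange_inequality TYPE('n) m"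
    using projection_product_imp_adjoined_segments adjoined_segments_imp_exchange by blast
  show ?thesis
    unfolding rayleigh_iff_exchange
    using exchange_imp_zonotope_inequality b_imp ratio product by blast
qed

end
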